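(* Let $U\subset\mathbb{R}^n$ be a smooth bounded domain, and let $p$ satisfy $$1<p<\infty \ \text{ if } n\le 2,\qquad 1<p<\frac{4}{n-2}\ \text{ if } 3\le n\le 5.$$ Let $v_0\in H_0^1(U)$ and let $\alpha>d$ be given. Assume that $J(v_0)<\alpha$, $\|v_0\|_{H_0^1(U)}^2<\Lambda_\alpha$ and $I(v_0)>0$. Then there exists a global weak solution $v$ to the problem $$v_t-\Delta v_t-\Delta v=v|v|^{p-1}\log|v| \ \text{ in } U\times\mathbb{R}^+,\qquad v=0 \ \text{ on } \partial U\times\mathbb{R}^+,\qquad v(\cdot,0)=v_0 \ \text{ in } U,$$ with $v\in L^\infty(0,\infty;H_0^1(U))$ and $v_t\in L^\infty(0,\infty;L^2(U))$.
   Context: Notation: $\|g\|_q=(\int_U|g|^q\,dx)^{1/q}$ for $1\le q<\infty$, $\|\cdot\|=\|\cdot\|_2$, $(h,g)_2=\int_U hg\,dx$ (for vector fields, $(\nabla h,\nabla g)_2=\int_U\nabla h\cdot\nabla g\,dx$), and $\|v\|_{H_0^1(U)}^2=\|v\|^2+\|\nabla v\|^2$. The expressions $|s|^{p+1}\log|s|$ and $s|s|^{p-1}\log|s|$ are taken to be $0$ at $s=0$. Functionals on $H_0^1(U)$: $$J(v)=\tfrac12\|\nabla v\|^2-\tfrac1{1+p}\int_U|v|^{1+p}\log|v|\,dx+\tfrac1{(1+p)^2}\|v\|_{1+p}^{1+p},\qquad I(v)=\|\nabla v\|^2-\int_U|v|^{1+p}\log|v|\,dx.$$ Nehari manifold: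 $\mathcal N=\{v\in H_0^1(U): I(v)=0,\ \|\nabla v\|^2\neq0\}$. Depth of the well: $d=\inf_{v\in\mathcal N}J(v)$. For $\alpha>d$: $\mathcal N_\alpha=\{v\in\mathcal N: J(v)<\alpha\}$ and $\Lambda_\alpha=\inf_{v\in\mathcal N_\alpha}\|v\|_{H_0^1(U)}^2$. Weak solution on $(0,T)$: a function $v\in L^\infty((0,T);H_0^1(U))$ with $v_t\in L^2((0,T);L^2(U))$ and $v(x,0)=v_0(x)$, satisfying, for all $w\in H_0^1(U)$ and $t\in(0,T)$, $$(v_t,w)_2+(\nabla v_t,\nabla w)_2+(\nabla v,\nabla w)_2=(v|v|^{p-1}\log|v|,w)_2.$$ A global weak solution is a weak solution that exists for all $t>0$, i.e. whose maximal existence time is $T=\infty$. *)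

theory Defs
  imports "HOL-Analysis.Analysis"
begin

section \<open>Smooth functions and smooth bounded domains\<close>

text \<open>\<open>R\<^sup>n\<close> is an arbitrary Euclidean space \<open>'a\<close> with \<open>n = DIM('a)\<close>.\<close>

primrec C_k :: "nat \<Rightarrow> ('a::euclidean_space \<Rightarrow> real) \<Rightarrow> bool" where
  "C_k 0 f \<longleftrightarrow> continuous_on UNIV f"
| "C_k (Suc k) f \<longleftrightarrow>
     (\<forall>x. f differentiable (at x)) \<and> (\<forall>h. C_k k (\<lambda>x. frechet_derivative f (at x) h))"

definition smooth :: "('a::euclidean_space \<Rightarrow> real) \<Rightarrow> bool" where
  "smooth f \<longleftrightarrow> (\<forall>k. C_k k f)"

text \<open>Near every boundary point the domain is the region strictly above the graph of a smooth
  function, in coordinates whose last axis is the unit vector \<open>e\<close>.  The function \<open>\<gamma>\<close> of the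
  remaining \<open>n - 1\<close> coordinates is given as a function on the whole space that is only evaluated
  on the hyperplane orthogonal to \<open>e\<close>.\<close>

definition smooth_boundary :: "'a::euclidean_space set \<Rightarrow> bool" where
  "smooth_boundary U \<longleftrightarrow>
     (\<forall>z\<in>frontier U. \<exists>r>0. \<exists>e \<gamma>. norm e = 1 \<and> smooth \<gamma> \<and>
        U \<inter> ball z r = {x \<in> ball z r. \<gamma> (x - (x \<bullet> e) *\<^sub>R e) < x \<bullet> e})"

definition smooth_bounded_domain :: "'a::euclidean_space set \<Rightarrow> bool" where
  "smooth_bounded_domain U \<longleftrightarrow>
     open U \<and> connected U \<and> U \<noteq> {} \<and> bounded U \<and> smooth_boundary U"

section \<open>Lebesgue and Sobolev spaces\<close>

text \<open>Elements of function spaces on \<open>U\<close> are represented by functions on the whole space; only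
  their values almost everywhere on \<open>U\<close> matter.  The target may be a Euclidean space, so that
  the same definitions apply to vector fields.\<close>

definition Lebesgue_space ::
  "real \<Rightarrow> 'a::euclidean_space set \<Rightarrow> ('a \<Rightarrow> 'b::euclidean_space) set" where
  "Lebesgue_space q U = {g \<in> borel_measurable (lebesgue_on U).
     integrable (lebesgue_on U) (\<lambda>x. norm (g x) powr q)}"

definition Lnorm ::
  "real \<Rightarrow> 'a::euclidean_space set \<Rightarrow> ('a \<Rightarrow> 'b::euclidean_space) \<Rightarrow> real" where
  "Lnorm q U g = (\<integral>x. norm (g x) powr q \<partial>lebesgue_on U) powr (1 / q)"

definition inner_L2 ::
  "'a::euclidean_space set \<Rightarrow> ('a \<Rightarrow> 'b::euclidean_space) \<Rightarrow> ('a \<Rightarrow> 'b) \<Rightarrow> real" where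
  "inner_L2 U h g = (\<integral>x. h x \<bullet> g x \<partial>lebesgue_on U)"

definition test_functions :: "'a::euclidean_space set \<Rightarrow> ('a \<Rightarrow> real) set" where
  "test_functions U = {\<phi>. smooth \<phi> \<and> compact (closure {x. \<phi> x \<noteq> 0}) \<and> closure {x. \<phi> x \<noteq> 0} \<subseteq> U}"

definition L2_weak_gradient ::
  "'a::euclidean_space set \<Rightarrow> ('a \<Rightarrow> real) \<Rightarrow> ('a \<Rightarrow> 'a) \<Rightarrow> bool" where
  "L2_weak_gradient U u G \<longleftrightarrow> G \<in> Lebesgue_space 2 U \<and>
     (\<forall>\<phi>\<in>test_functions U. \<forall>b\<in>Basis.
        (\<integral>x. u x * frechet_derivative \<phi> (at x) b \<partial>lebesgue_on U) =
        - (\<integral>x. (G x \<bullet> b) * \<phi> x \<partial>lebesgue_on U))"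

definition H1 :: "'a::euclidean_space set \<Rightarrow> ('a \<Rightarrow> real) set" where
  "H1 U = {u \<in> Lebesgue_space 2 U. \<exists>G. L2_weak_gradient U u G}"

text \<open>The weak gradient is unique up to null sets, so the choice is immaterial.\<close>

definition wgrad :: "'a::euclidean_space set \<Rightarrow> ('a \<Rightarrow> real) \<Rightarrow> 'a \<Rightarrow> 'a" where
  "wgrad U u = (SOME G. L2_weak_gradient U u G)"

definition H1norm :: "'a::euclidean_space set \<Rightarrow> ('a \<Rightarrow> real) \<Rightarrow> real" where
  "H1norm U u = sqrt ((Lnorm 2 U u)\<^sup>2 + (Lnorm 2 U (wgrad U u))\<^sup>2)"

definition H01 :: "'a::euclidean_space set \<Rightarrow> ('a \<Rightarrow> real) set" where
  "H01 U = {u \<in> H1 U. \<forall>\<epsilon>>0. \<exists>\<phi>\<in>test_functions U. H1norm U (\<lambda>x. u x - \<phi> x) < \<epsilon>}"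

section \<open>The potential well\<close>

text \<open>All terms below vanish at \<open>s = 0\<close>, since \<open>0 powr a = 0\<close> and \<open>ln 0 = 0\<close>.\<close>

definition J :: "real \<Rightarrow> 'a::euclidean_space set \<Rightarrow> ('a \<Rightarrow> real) \<Rightarrow> real" where
  "J p U v = 1 / 2 * (Lnorm 2 U (wgrad U v))\<^sup>2
     - 1 / (1 + p) * (\<integral>x. \<bar>v x\<bar> powr (1 + p) * ln \<bar>v x\<bar> \<partial>lebesgue_on U)
     + 1 / (1 + p)\<^sup>2 * Lnorm (1 + p) U v powr (1 + p)"

definition I :: "real \<Rightarrow> 'a::euclidean_space set \<Rightarrow> ('a \<Rightarrow> real) \<Rightarrow> real" where
  "I p U v = (Lnorm 2 U (wgrad U v))\<^sup>2
     - (\<integral>x. \<bar>v x\<bar> powr (1 + p) * ln \<bar>v x\<bar> \<partial>lebesgue_on U)"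

definition nehari :: "real \<Rightarrow> 'a::euclidean_space set \<Rightarrow> ('a \<Rightarrow> real) set" where
  "nehari p U = {v \<in> H01 U. I p U v = 0 \<and> (Lnorm 2 U (wgrad U v))\<^sup>2 \<noteq> 0}"

definition well_depth :: "real \<Rightarrow> 'a::euclidean_space set \<Rightarrow> real" where
  "well_depth p U = (INF v\<in>nehari p U. J p U v)"

definition nehari_below :: "real \<Rightarrow> 'a::euclidean_space set \<Rightarrow> real \<Rightarrow> ('a \<Rightarrow> real) set" where
  "nehari_below p U \<alpha> = {v \<in> nehari p U. J p U v < \<alpha>}"

definition Lambda :: "real \<Rightarrow> 'a::euclidean_space set \<Rightarrow> real \<Rightarrow> real" where
  "Lambda p U \<alpha> = (INF v\<in>nehari_below p U \<alpha>. (H1norm U v)\<^sup>2)"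

definition log_source :: "real \<Rightarrow> real \<Rightarrow> real" where
  "log_source p s = s * \<bar>s\<bar> powr (p - 1) * ln \<bar>s\<bar>"

section \<open>Functions of time with values in a function space\<close>

text \<open>Below, \<open>X\<close> is a space of functions and \<open>N\<close> its norm.  Strong measurability means being
  the limit in norm, almost everywhere in time, of simple functions.\<close>

definition strongly_measurable ::
  "real set \<Rightarrow> ('a \<Rightarrow> real) set \<Rightarrow> (('a \<Rightarrow> real) \<Rightarrow> real) \<Rightarrow> (real \<Rightarrow> 'a \<Rightarrow> real) \<Rightarrow> bool" where
  "strongly_measurable S X N f \<longleftrightarrow>
     (\<forall>t\<in>S. f t \<in> X) \<and>
     (\<exists>s. (\<forall>k::nat. simple_function (lebesgue_on S) (s k) \<and> s k ` S \<subseteq> X) \<and>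
          (AE t in lebesgue_on S. (\<lambda>k. N (\<lambda>x. f t x - s k t x)) \<longlonglongrightarrow> 0))"

definition L2_time ::
  "real set \<Rightarrow> ('a \<Rightarrow> real) set \<Rightarrow> (('a \<Rightarrow> real) \<Rightarrow> real) \<Rightarrow> (real \<Rightarrow> 'a \<Rightarrow> real) set" where
  "L2_time S X N = {f. strongly_measurable S X N f \<and> integrable (lebesgue_on S) (\<lambda>t. (N (f t))\<^sup>2)}"

definition Linf_time ::
  "real set \<Rightarrow> ('a \<Rightarrow> real) set \<Rightarrow> (('a \<Rightarrow> real) \<Rightarrow> real) \<Rightarrow> (real \<Rightarrow> 'a \<Rightarrow> real) set" where
  "Linf_time S X N = {f. strongly_measurable S X N f \<and> (\<exists>C. AE t in lebesgue_on S. N (f t) \<le> C)}"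

text \<open>\<open>vt\<close> is the weak time derivative of \<open>v\<close>: \<open>\<integral> \<phi>' v dt = - \<integral> \<phi> vt dt\<close> in \<open>L\<^sup>2(U)\<close> for all scalar
  test functions \<open>\<phi>\<close>.  The \<open>L\<^sup>2(U)\<close>-valued integrals are expressed through their inner products
  with the elements \<open>w\<close> of \<open>L\<^sup>2(U)\<close>.\<close>

definition weak_time_derivative ::
  "real set \<Rightarrow> 'a::euclidean_space set \<Rightarrow> (real \<Rightarrow> 'a \<Rightarrow> real) \<Rightarrow> (real \<Rightarrow> 'a \<Rightarrow> real) \<Rightarrow> bool" where
  "weak_time_derivative S U v vt \<longleftrightarrow>
     (\<forall>\<phi>\<in>test_functions S. \<forall>w\<in>Lebesgue_space 2 U.
        (\<integral>t. deriv \<phi> t * inner_L2 U (v t) w \<partial>lebesgue_on S) =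
        - (\<integral>t. \<phi> t * inner_L2 U (vt t) w \<partial>lebesgue_on S))"

section \<open>Weak solutions\<close>

definition time_interval :: "ereal \<Rightarrow> real set" where
  "time_interval T = {t. 0 < t \<and> ereal t < T}"

text \<open>The initial condition is understood for the representative of \<open>v\<close> that is continuous in
  time with values in \<open>L\<^sup>2(U)\<close>, which exists because \<open>v\<close> and \<open>vt\<close> are square integrable in time
  on bounded intervals.  The term \<open>(\<nabla>vt, \<nabla>w)\<close> presupposes that \<open>vt t\<close> has a weak gradient; it
  lies in \<open>H\<^sub>0\<^sup>1(U)\<close>, like \<open>v t\<close>.  The representative of \<open>vt\<close> is such that the equation holds at
  every time.\<close>

definition weak_solution ::
  "real \<Rightarrow> 'a::euclidean_space set \<Rightarrow> ereal \<Rightarrow> ('a \<Rightarrow> real) \<Rightarrow>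
   (real \<Rightarrow> 'a \<Rightarrow> real) \<Rightarrow> (real \<Rightarrow> 'a \<Rightarrow> real) \<Rightarrow> bool" where
  "weak_solution p U T v0 v vt \<longleftrightarrow>
     v \<in> Linf_time (time_interval T) (H01 U) (H1norm U) \<and>
     vt \<in> L2_time (time_interval T) (Lebesgue_space 2 U) (Lnorm 2 U) \<and>
     weak_time_derivative (time_interval T) U v vt \<and>
     (\<forall>s\<in>insert 0 (time_interval T).
        ((\<lambda>t. Lnorm 2 U (\<lambda>x. v t x - v s x)) \<longlongrightarrow> 0) (at s within insert 0 (time_interval T))) \<and>
     (AE x in lebesgue_on U. v 0 x = v0 x) \<and>
     (\<forall>t\<in>time_interval T. vt t \<in> H01 U \<and>
        (\<forall>w\<in>H01 U.
           integrable (lebesgue_on U) (\<lambda>x. log_source p (v t x) * w x) \<and>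
           inner_L2 U (vt t) w + inner_L2 U (wgrad U (vt t)) (wgrad U w)
             + inner_L2 U (wgrad U (v t)) (wgrad U w)
           = inner_L2 U (\<lambda>x. log_source p (v t x)) w))"

definition global_weak_solution ::
  "real \<Rightarrow> 'a::euclidean_space set \<Rightarrow> ('a \<Rightarrow> real) \<Rightarrow>
   (real \<Rightarrow> 'a \<Rightarrow> real) \<Rightarrow> (real \<Rightarrow> 'a \<Rightarrow> real) \<Rightarrow> bool" where
  "global_weak_solution p U v0 v vt \<longleftrightarrow> weak_solution p U \<infinity> v0 v vt"

end

theory Submission
  imports Defs
begin

text \<open>
  Identify \<open>H\<^sub>0\<^sup>1(U)\<close> with a closed subspace of a Hilbert space and let \<open>G v\<close> be the Riesz
  representative of \<open>w \<mapsto> - (\<nabla>v, \<nabla>w) + (v |v|\<^bsup>p - 1\<^esup> log |v|, w)\<close>.  Since \<open>v\<^sub>t - \<Delta>v\<^sub>t\<close> carries the full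
  \<open>H\<^sub>0\<^sup>1\<close> inner product, the problem is the ordinary differential equation \<open>v' = G v\<close>, and \<open>G\<close> is
  Lipschitz on bounded sets because \<open>H\<^sub>0\<^sup>1(U)\<close> embeds into \<open>L\<^bsup>p + 2\<^esup>(U)\<close>: the exponent \<open>p + 2\<close> is
  subcritical for \<open>n \<ge> 3\<close> exactly when \<open>p < 4 / (n - 2)\<close>.  Moreover \<open>G = - J'\<close> and \<open>(G v, v) = - I v\<close>, so along a
  solution \<open>J\<close> decreases and \<open>\<parallel>v\<parallel>\<^sup>2\<close> has derivative \<open>- 2 I v\<close>.  If \<open>I\<close> vanished at some first time, the
  solution would there be a point of the Nehari manifold with \<open>J < \<alpha>\<close> and norm below \<open>\<Lambda>\<^sub>\<alpha>\<close>, which is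
  impossible.  Hence \<open>I > 0\<close> throughout, the norm never grows, and the solution is global.
\<close>

section \<open>The Hilbert space of square integrable functions\<close>

text \<open>Inverting 1 - \<Delta> makes the Laplacian a bounded operator, so the analytic input is
  an L^q bound for the nonlinearity. The exponent q = p + 2 arises as follows. The derivative of the
  source grows like |s|^(p - 1) |log |s||, and one further power of |s| absorbs the logarithm. A
  Lipschitz estimate then pairs a weight of growth p with two elements of H_0^1, and Hoelder's
  inequality for this triple asks for the exponent p + 2. The second-order remainder of the energy
  leads to the same triple, so one trilinear bound serves both. Two points make the well argument
  delicate. The zero function satisfies I = 0 without lying on the Nehari manifold, so the orbit
  must be kept away from it. And the field has to be truncated outside a ball to be globally
  Lipschitz, while energy identity and I refer to the original field; the argument is therefore run
  up to the first time at which the norm exceeds its initial value. Square integrability of v_t over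
  the half line comes from the dissipation identity, because the energy is bounded on bounded
  sets.\<close>

definition square_integrable :: "('a::euclidean_space \<Rightarrow> 'b::euclidean_space) \<Rightarrow> bool" where
  "square_integrable f \<longleftrightarrow> f \<in> borel_measurable lebesgue \<and> integrable lebesgue (\<lambda>x. (norm (f x))\<^sup>2)"

text \<open>Only a partial equivalence: a function that is not square integrable is related to
  nothing, so the quotient consists of exactly the classes of L^2.\<close>

definition L2_eq :: "('a::euclidean_space \<Rightarrow> 'b::euclidean_space) \<Rightarrow> ('a \<Rightarrow> 'b) \<Rightarrow> bool" where
  "L2_eq f g \<longleftrightarrow> square_integrable f \<and> square_integrable g \<and> (AE x in lebesgue. f x = g x)"

lemma square_integrable_zero [simp]: "square_integrable (\<lambda>x. 0)"
  by (simp add: square_integrable_def)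

lemma square_integrable_measurable [measurable_dest]:
  "square_integrable f \<Longrightarrow> f \<in> borel_measurable lebesgue"
  by (simp add: square_integrable_def)

text \<open>The pair \<open>(u, \<nabla>u)\<close>, extended by zero outside \<open>U\<close>, is a single \<open>R \<times> R\<^sup>n\<close>-valued function, and
  the inner product of \<open>H\<^sup>1(U)\<close> is the \<open>L\<^sup>2\<close> inner product of such pairs.\<close>

quotient_type (overloaded) ('a, 'b) L2fun = "'a::euclidean_space \<Rightarrow> 'b::euclidean_space" / partial: L2_eq
proof (rule part_equivpI)
  show "\<exists>x::'a \<Rightarrow> 'b. L2_eq x x"
    by (rule exI[of _ "\<lambda>x. 0"]) (simp add: L2_eq_def)
qed (auto simp: L2_eq_def symp_def transp_def elim: AE_mp)

abbreviation to_L2 :: "('a::euclidean_space \<Rightarrow> 'b::euclidean_space) \<Rightarrow> ('a, 'b) L2fun" where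
  "to_L2 \<equiv> abs_L2fun"

abbreviation of_L2 :: "('a, 'b) L2fun \<Rightarrow> 'a::euclidean_space \<Rightarrow> 'b::euclidean_space" where
  "of_L2 \<equiv> rep_L2fun"

lemma square_integrable_of_L2 [simp]: "square_integrable (of_L2 x)"
  using Quotient_rep_reflp[OF Quotient_L2fun, of x] by (simp add: L2_eq_def)

lemma to_L2_of_L2 [simp]: "to_L2 (of_L2 x) = x"
  by (rule Quotient_abs_rep[OF Quotient_L2fun])

lemma of_L2_to_L2:
  assumes "square_integrable f" shows "AE x in lebesgue. of_L2 (to_L2 f) x = f x"
proof -
  have "L2_eq f f" using assms by (simp add: L2_eq_def)
  then have "L2_eq (of_L2 (to_L2 f)) f"
    using Quotient_rep_abs[OF Quotient_L2fun] by blast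
  then show ?thesis by (simp add: L2_eq_def)
qed

lemma to_L2_eq_iff:
  assumes "square_integrable f" "square_integrable g"
  shows "to_L2 f = to_L2 g \<longleftrightarrow> (AE x in lebesgue. f x = g x)"
  using Quotient_rel_abs2[OF Quotient_L2fun] Quotient_rel[OF Quotient_L2fun, of f g] assms
  by (auto simp: L2_eq_def)

lemma L2_eqI:
  assumes "AE t in lebesgue. of_L2 x t = of_L2 y t" shows "x = y"
  using to_L2_eq_iff[of "of_L2 x" "of_L2 y"] assms by simp

lemma borel_measurable_of_L2 [measurable]: "of_L2 x \<in> borel_measurable lebesgue"
  using square_integrable_of_L2[of x] by (simp add: square_integrable_def)

lemma integrable_of_L2_square [simp]: "integrable lebesgue (\<lambda>t. (norm (of_L2 x t))\<^sup>2)"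
  using square_integrable_of_L2[of x] by (simp add: square_integrable_def)

lemma square_integrable_bound:
  fixes f :: "'a::euclidean_space \<Rightarrow> 'b::euclidean_space"
  assumes "f \<in> borel_measurable lebesgue" "integrable lebesgue h"
    and "AE x in lebesgue. (norm (f x))\<^sup>2 \<le> h x"
  shows "square_integrable f"
  unfolding square_integrable_def
proof
  have [measurable]: "f \<in> borel_measurable lebesgue" by fact
  show "integrable lebesgue (\<lambda>x. (norm (f x))\<^sup>2)"
    by (rule Bochner_Integration.integrable_bound[OF assms(2)])
       (use assms(3) in \<open>auto intro: order_trans[OF _ abs_ge_self]\<close>)
qed fact

lemma square_integrable_add [simp]:
  assumes "square_integrable f" "square_integrable g"
  shows "square_integrable (\<lambda>x. f x + g x)"
proof (rule square_integrable_bound[where h="\<lambda>x. 2 * (norm (f x))\<^sup>2 + 2 * (norm (g x))\<^sup>2"])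
  show "(\<lambda>x. f x + g x) \<in> borel_measurable lebesgue"
    using assms by measurable
  show "AE x in lebesgue. (norm (f x + g x))\<^sup>2 \<le> 2 * (norm (f x))\<^sup>2 + 2 * (norm (g x))\<^sup>2"
  proof (rule AE_I2)
    fix x
    have "(norm (f x + g x))\<^sup>2 \<le> (norm (f x) + norm (g x))\<^sup>2"
      by (intro power_mono norm_triangle_ineq) auto
    also have "\<dots> \<le> 2 * (norm (f x))\<^sup>2 + 2 * (norm (g x))\<^sup>2"
      using sum_squares_bound[of "norm (f x)" "norm (g x)"] by (simp add: power2_sum)
    finally show "(norm (f x + g x))\<^sup>2 \<le> 2 * (norm (f x))\<^sup>2 + 2 * (norm (g x))\<^sup>2" .
  qed
qed (use assms in \<open>auto simp: square_integrable_def\<close>)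

lemma square_integrable_scaleR [simp]:
  assumes "square_integrable f" shows "square_integrable (\<lambda>x. c *\<^sub>R f x)"
  using assms by (auto simp: square_integrable_def power_mult_distrib)

lemma square_integrable_minus [simp]:
  assumes "square_integrable f" shows "square_integrable (\<lambda>x. - f x)"
  using square_integrable_scaleR[OF assms, of "-1"] by simp

lemma square_integrable_diff [simp]:
  assumes "square_integrable f" "square_integrable g"
  shows "square_integrable (\<lambda>x. f x - g x)"
  using square_integrable_add[OF assms(1) square_integrable_minus[OF assms(2)]] by simp

lemma integrable_inner_square_integrable:
  assumes "square_integrable f" "square_integrable g"
  shows "integrable lebesgue (\<lambda>x. f x \<bullet> g x)"
proof (rule Bochner_Integration.integrable_bound[where f="\<lambda>x. (norm (f x))\<^sup>2 + (norm (g x))\<^sup>2"])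
  show "(\<lambda>x. f x \<bullet> g x) \<in> borel_measurable lebesgue"
    by (intro borel_measurable_inner square_integrable_measurable assms)
  have "\<bar>f x \<bullet> g x\<bar> \<le> (norm (f x))\<^sup>2 + (norm (g x))\<^sup>2" for x
  proof -
    have "\<bar>f x \<bullet> g x\<bar> \<le> norm (f x) * norm (g x)" by (rule Cauchy_Schwarz_ineq2)
    also have "\<dots> \<le> 2 * (norm (f x) * norm (g x))" by simp
    also have "\<dots> \<le> (norm (f x))\<^sup>2 + (norm (g x))\<^sup>2"
      using sum_squares_bound[of "norm (f x)" "norm (g x)"] by simp
    finally show ?thesis .
  qed
  then show "AE x in lebesgue. norm (f x \<bullet> g x) \<le> norm ((norm (f x))\<^sup>2 + (norm (g x))\<^sup>2)"
    by (intro AE_I2) simp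
qed (use assms in \<open>auto simp: square_integrable_def\<close>)

instantiation L2fun :: (euclidean_space, euclidean_space) real_inner
begin

definition zero_L2fun :: "('a, 'b) L2fun" where "zero_L2fun = to_L2 (\<lambda>x. 0)"
definition plus_L2fun :: "('a, 'b) L2fun \<Rightarrow> ('a, 'b) L2fun \<Rightarrow> ('a, 'b) L2fun"
  where "plus_L2fun x y = to_L2 (\<lambda>t. of_L2 x t + of_L2 y t)"
definition minus_L2fun :: "('a, 'b) L2fun \<Rightarrow> ('a, 'b) L2fun \<Rightarrow> ('a, 'b) L2fun"
  where "minus_L2fun x y = to_L2 (\<lambda>t. of_L2 x t - of_L2 y t)"
definition uminus_L2fun :: "('a, 'b) L2fun \<Rightarrow> ('a, 'b) L2fun"
  where "uminus_L2fun x = to_L2 (\<lambda>t. - of_L2 x t)"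
definition scaleR_L2fun :: "real \<Rightarrow> ('a, 'b) L2fun \<Rightarrow> ('a, 'b) L2fun"
  where "scaleR_L2fun c x = to_L2 (\<lambda>t. c *\<^sub>R of_L2 x t)"
definition inner_L2fun :: "('a, 'b) L2fun \<Rightarrow> ('a, 'b) L2fun \<Rightarrow> real"
  where "inner_L2fun x y = (\<integral>t. of_L2 x t \<bullet> of_L2 y t \<partial>lebesgue)"
definition norm_L2fun :: "('a, 'b) L2fun \<Rightarrow> real"
  where "norm_L2fun x = sqrt (inner x x)"
definition dist_L2fun :: "('a, 'b) L2fun \<Rightarrow> ('a, 'b) L2fun \<Rightarrow> real"
  where "dist_L2fun x y = norm (x - y)"
definition sgn_L2fun :: "('a, 'b) L2fun \<Rightarrow> ('a, 'b) L2fun"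
  where "sgn_L2fun x = scaleR (inverse (norm x)) x"
definition uniformity_L2fun :: "(('a, 'b) L2fun \<times> ('a, 'b) L2fun) filter"
  where "uniformity_L2fun = (INF e\<in>{0<..}. principal {(x, y). dist x y < e})"
definition open_L2fun :: "('a, 'b) L2fun set \<Rightarrow> bool"
  where "open_L2fun S = (\<forall>x\<in>S. \<forall>\<^sub>F (x', y) in uniformity. x' = x \<longrightarrow> y \<in> S)"

lemma of_L2_zero: "AE t in lebesgue. of_L2 (0::('a,'b) L2fun) t = 0"
  unfolding zero_L2fun_def by (rule of_L2_to_L2) simp
lemma of_L2_add: "AE t in lebesgue. of_L2 (x + y :: ('a,'b) L2fun) t = of_L2 x t + of_L2 y t"
  unfolding plus_L2fun_def by (rule of_L2_to_L2) simp
lemma of_L2_diff: "AE t in lebesgue. of_L2 (x - y :: ('a,'b) L2fun) t = of_L2 x t - of_L2 y t"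
  unfolding minus_L2fun_def by (rule of_L2_to_L2) simp
lemma of_L2_uminus: "AE t in lebesgue. of_L2 (- x :: ('a,'b) L2fun) t = - of_L2 x t"
  unfolding uminus_L2fun_def by (rule of_L2_to_L2) simp
lemma of_L2_scaleR: "AE t in lebesgue. of_L2 (c *\<^sub>R x :: ('a,'b) L2fun) t = c *\<^sub>R of_L2 x t"
  unfolding scaleR_L2fun_def by (rule of_L2_to_L2) simp

lemma inner_L2_AE:
  assumes "AE t in lebesgue. of_L2 (x::('a,'b) L2fun) t = f t" "AE t in lebesgue. of_L2 (y::('a,'b) L2fun) t = g t"
    "square_integrable f" "square_integrable g"
  shows "x \<bullet> y = (\<integral>t. f t \<bullet> g t \<partial>lebesgue)"
  unfolding inner_L2fun_def
proof (rule integral_cong_AE)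
  show "(\<lambda>t. f t \<bullet> g t) \<in> borel_measurable lebesgue"
    by (intro borel_measurable_inner square_integrable_measurable assms)
  show "AE t in lebesgue. of_L2 x t \<bullet> of_L2 y t = f t \<bullet> g t"
    using assms(1,2) by eventually_elim simp
qed measurable

instance
proof
  fix x y z :: "('a,'b) L2fun" and a b c :: real
  show "dist x y = norm (x - y)" by (rule dist_L2fun_def)
  show "sgn x = inverse (norm x) *\<^sub>R x" by (rule sgn_L2fun_def)
  show "uniformity = (INF e\<in>{0<..}. principal {(x, y). dist (x::('a,'b) L2fun) y < e})"
    by (rule uniformity_L2fun_def)
  show "open S = (\<forall>x\<in>S. \<forall>\<^sub>F (x', y) in uniformity. x' = x \<longrightarrow> y \<in> S)" for S :: "('a,'b) L2fun set"
    by (rule open_L2fun_def)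
  show "norm x = sqrt (x \<bullet> x)" by (rule norm_L2fun_def)
  show "x + y + z = x + (y + z)"
    by (rule L2_eqI, use of_L2_add[of "x + y" z] of_L2_add[of x y] of_L2_add[of x "y + z"] of_L2_add[of y z] in \<open>eventually_elim, simp\<close>)
  show "x + y = y + x" by (simp add: plus_L2fun_def add.commute)
  show "0 + x = x"
    by (rule L2_eqI, use of_L2_add[of 0 x] of_L2_zero in \<open>eventually_elim, simp\<close>)
  show "- x + x = 0"
    by (rule L2_eqI, use of_L2_add[of "- x" x] of_L2_uminus[of x] of_L2_zero in \<open>eventually_elim, simp\<close>)
  show "x - y = x + - y"
    by (rule L2_eqI, use of_L2_add[of x "- y"] of_L2_uminus[of y] of_L2_diff[of x y] in \<open>eventually_elim, simp\<close>)
  show "a *\<^sub>R (x + y) = a *\<^sub>R x + a *\<^sub>R y"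
    by (rule L2_eqI, use of_L2_scaleR[of a "x + y"] of_L2_add[of x y] of_L2_add[of "a *\<^sub>R x" "a *\<^sub>R y"]
      of_L2_scaleR[of a x] of_L2_scaleR[of a y] in \<open>eventually_elim, simp add: algebra_simps\<close>)
  show "(a + b) *\<^sub>R x = a *\<^sub>R x + b *\<^sub>R x"
    by (rule L2_eqI, use of_L2_scaleR[of "a + b" x] of_L2_add[of "a *\<^sub>R x" "b *\<^sub>R x"]
      of_L2_scaleR[of a x] of_L2_scaleR[of b x] in \<open>eventually_elim, simp add: algebra_simps\<close>)
  show "a *\<^sub>R b *\<^sub>R x = (a * b) *\<^sub>R x"
    by (rule L2_eqI, use of_L2_scaleR[of a "b *\<^sub>R x"] of_L2_scaleR[of b x] of_L2_scaleR[of "a * b" x] in \<open>eventually_elim, metis scaleR_scaleR\<close>)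
  show "1 *\<^sub>R x = x"
    by (rule L2_eqI, use of_L2_scaleR[of 1 x] in \<open>eventually_elim, simp\<close>)
  show "x \<bullet> y = y \<bullet> x" by (simp add: inner_L2fun_def inner_commute)
  show "(x + y) \<bullet> z = x \<bullet> z + y \<bullet> z"
    by (subst inner_L2_AE[OF of_L2_add[of x y], of z "of_L2 z"])
       (auto simp: inner_L2fun_def inner_add_left integrable_inner_square_integrable)
  show "a *\<^sub>R x \<bullet> y = a * (x \<bullet> y)"
    by (subst inner_L2_AE[OF of_L2_scaleR[of a x], of y "of_L2 y"]) (auto simp: inner_L2fun_def)
  show "0 \<le> x \<bullet> x" by (simp add: inner_L2fun_def)
  show "(x \<bullet> x = 0) = (x = 0)"
  proof
    assume "x \<bullet> x = 0"
    then have 0: "AE t in lebesgue. (norm (of_L2 x t))\<^sup>2 = 0"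
      by (subst integral_nonneg_eq_0_iff_AE[symmetric]) (auto simp: inner_L2fun_def power2_norm_eq_inner integrable_inner_square_integrable)
    show "x = 0"
      by (rule L2_eqI, use 0 of_L2_zero in \<open>eventually_elim, simp\<close>)
  next
    assume "x = 0"
    then show "x \<bullet> x = 0"
      by (subst inner_L2_AE[where f="\<lambda>_. 0" and g="\<lambda>_. 0"]) (auto simp: of_L2_zero)
  qed
qed

end

lemma inner_to_L2:
  assumes "square_integrable f" "square_integrable g"
  shows "to_L2 f \<bullet> to_L2 g = (\<integral>t. f t \<bullet> g t \<partial>lebesgue)"
  using assms by (intro inner_L2_AE of_L2_to_L2)

lemma norm_to_L2_square:
  assumes "square_integrable f"
  shows "(norm (to_L2 f))\<^sup>2 = (\<integral>t. (norm (f t))\<^sup>2 \<partial>lebesgue)"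
  by (simp add: power2_norm_eq_inner inner_to_L2 assms)

lemma to_L2_add:
  assumes "square_integrable f" "square_integrable g"
  shows "to_L2 f + to_L2 g = to_L2 (\<lambda>t. f t + g t)"
  by (rule L2_eqI, use of_L2_add[of "to_L2 f" "to_L2 g"] of_L2_to_L2[OF assms(1)] of_L2_to_L2[OF assms(2)]
    of_L2_to_L2[OF square_integrable_add[OF assms]] in \<open>eventually_elim, simp\<close>)

lemma to_L2_diff:
  assumes "square_integrable f" "square_integrable g"
  shows "to_L2 f - to_L2 g = to_L2 (\<lambda>t. f t - g t)"
  by (rule L2_eqI, use of_L2_diff[of "to_L2 f" "to_L2 g"] of_L2_to_L2[OF assms(1)] of_L2_to_L2[OF assms(2)]
    of_L2_to_L2[OF square_integrable_diff[OF assms]] in \<open>eventually_elim, simp\<close>)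

lemma to_L2_scaleR:
  assumes "square_integrable f"
  shows "c *\<^sub>R to_L2 f = to_L2 (\<lambda>t. c *\<^sub>R f t)"
  by (rule L2_eqI, use of_L2_scaleR[of c "to_L2 f"] of_L2_to_L2[OF assms]
    of_L2_to_L2[OF square_integrable_scaleR[OF assms], of c] in \<open>eventually_elim, simp\<close>)

section \<open>Almost everywhere convergence and completeness of L^2\<close>

lemma L2_tendsto_AE_subseq:
  fixes X :: "nat \<Rightarrow> ('a::euclidean_space,'b::euclidean_space) L2fun"
  assumes "X \<longlonglongrightarrow> x"
  shows "\<exists>r::nat \<Rightarrow> nat. strict_mono r \<and> (AE t in lebesgue. (\<lambda>n. of_L2 (X (r n)) t) \<longlonglongrightarrow> of_L2 x t)"
proof -
  have sq: "square_integrable (\<lambda>t. of_L2 (X n) t - of_L2 x t)" for n by simp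
  have "(\<lambda>n. (norm (X n - x))\<^sup>2) \<longlonglongrightarrow> 0"
    using assms by (intro tendsto_eq_intros tendsto_norm_zero LIM_zero | simp)+
  moreover have "(norm (X n - x))\<^sup>2 = (\<integral>t. norm ((norm (of_L2 (X n) t - of_L2 x t))\<^sup>2) \<partial>lebesgue)" for n
    by (simp add: power2_norm_eq_inner inner_L2_AE[OF of_L2_diff of_L2_diff sq sq])
  ultimately have "(\<lambda>n. \<integral>t. norm ((norm (of_L2 (X n) t - of_L2 x t))\<^sup>2) \<partial>lebesgue) \<longlonglongrightarrow> 0"
    by simp
  from tendsto_L1_AE_subseq[OF _ this] sq
  obtain r :: "nat \<Rightarrow> nat" where r: "strict_mono r"
    "AE t in lebesgue. (\<lambda>n. (norm (of_L2 (X (r n)) t - of_L2 x t))\<^sup>2) \<longlonglongrightarrow> 0"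
    by (auto simp: square_integrable_def)
  show ?thesis
  proof (rule exI[of _ r], rule conjI)
    show "strict_mono r" by (rule r(1))
    show "AE t in lebesgue. (\<lambda>n. of_L2 (X (r n)) t) \<longlonglongrightarrow> of_L2 x t"
      using r(2)
    proof eventually_elim
      case (elim t)
      then have "(\<lambda>n. norm (of_L2 (X (r n)) t - of_L2 x t)) \<longlonglongrightarrow> 0"
        using tendsto_real_sqrt[OF elim] by simp
      then show ?case by (simp add: LIM_zero_cancel tendsto_norm_zero_iff)
    qed
  qed
qed

text \<open>The core of the Riesz-Fischer theorem. Geometric decay of the norms forces almost
  everywhere convergence of the representatives, and Fatou's lemma, applied to
  \<open>Y m - Y k\<close> as m grows, shows that the pointwise limit is also the limit in norm,
  with the same rate.\<close>

lemma L2_fast_Cauchy_convergent: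
  fixes Y :: "nat \<Rightarrow> ('a::euclidean_space,'b::euclidean_space) L2fun"
  assumes Y: "\<And>k m. k \<le> m \<Longrightarrow> norm (Y m - Y k) \<le> (1/2)^k"
  shows "\<exists>y. \<forall>k. norm (Y k - y) \<le> (1/2)^k"
proof -
  define d where "d = (\<lambda>k t. norm (of_L2 (Y (Suc k)) t - of_L2 (Y k) t))"
  have sq: "square_integrable (\<lambda>t. of_L2 (Y m) t - of_L2 (Y n) t)" for m n by simp
  have nrm: "(norm (Y m - Y n))\<^sup>2 = (\<integral>t. (norm (of_L2 (Y m) t - of_L2 (Y n) t))\<^sup>2 \<partial>lebesgue)" for m n
    by (simp add: power2_norm_eq_inner inner_L2_AE[OF of_L2_diff of_L2_diff sq sq])
  have [measurable]: "d k \<in> borel_measurable lebesgue" for k unfolding d_def by measurable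
  (* The weight 2^k turns square summability of the increments into geometric decay. *)
  have "(\<integral>\<^sup>+t. (\<Sum>k. ennreal (2^k * (d k t)\<^sup>2)) \<partial>lebesgue) = (\<Sum>k. \<integral>\<^sup>+t. ennreal (2^k * (d k t)\<^sup>2) \<partial>lebesgue)"
    by (rule nn_integral_suminf) measurable
  also have "\<dots> \<le> (\<Sum>k. ennreal ((1/2)^k))"
  proof (rule suminf_le)
    fix k
    have "(\<integral>\<^sup>+t. ennreal (2^k * (d k t)\<^sup>2) \<partial>lebesgue) = ennreal (\<integral>t. 2^k * (d k t)\<^sup>2 \<partial>lebesgue)"
      using sq[of "Suc k" k] by (intro nn_integral_eq_integral) (auto simp: d_def square_integrable_def)
    also have "(\<integral>t. 2^k * (d k t)\<^sup>2 \<partial>lebesgue) = 2^k * (norm (Y (Suc k) - Y k))\<^sup>2"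
      by (simp add: nrm d_def)
    also have "\<dots> \<le> 2^k * ((1/2)^k)\<^sup>2"
      by (intro mult_left_mono power_mono Y) auto
    also have "\<dots> = (1/2)^k" by (simp add: power2_eq_square power_divide)
    finally show "(\<integral>\<^sup>+t. ennreal (2^k * (d k t)\<^sup>2) \<partial>lebesgue) \<le> ennreal ((1/2)^k)"
      by (simp add: ennreal_leI)
  qed auto
  also have "\<dots> = ennreal 2"
  proof (rule suminf_ennreal_eq)
    show "(\<lambda>k. (1/2)^k) sums (2::real)" using geometric_sums[of "1/2::real"] by simp
  qed simp
  finally have "(\<integral>\<^sup>+t. (\<Sum>k. ennreal (2^k * (d k t)\<^sup>2)) \<partial>lebesgue) < \<infinity>"
    by (rule le_less_trans) simp
  then have fin: "(\<integral>\<^sup>+t. (\<Sum>k. ennreal (2^k * (d k t)\<^sup>2)) \<partial>lebesgue) \<noteq> \<infinity>"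
    by simp
  have "AE t in lebesgue. (\<Sum>k. ennreal (2^k * (d k t)\<^sup>2)) \<noteq> \<infinity>"
    by (rule nn_integral_PInf_AE[OF _ fin]) measurable
  then have conv: "AE t in lebesgue. convergent (\<lambda>k. of_L2 (Y k) t)"
  proof eventually_elim
    case (elim t)
    then have "summable (\<lambda>k. 2^k * (d k t)\<^sup>2)"
      by (intro summable_suminf_not_top) (simp_all add: infinity_ennreal_def)
    then have "(\<lambda>k. 2^k * (d k t)\<^sup>2) \<longlonglongrightarrow> 0" by (rule summable_LIMSEQ_zero)
    then have "Bseq (\<lambda>k. 2^k * (d k t)\<^sup>2)"
      by (intro convergent_imp_Bseq convergentI)
    then obtain B where B: "B > 0" and B': "\<And>k. norm (2^k * (d k t)\<^sup>2) \<le> B"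
      unfolding Bseq_def by blast
    have bound: "d k t \<le> sqrt B * (1 / sqrt 2)^k" for k
    proof (rule power2_le_imp_le)
      have "(d k t)\<^sup>2 \<le> B / 2^k"
        using B'[of k] by (simp add: field_simps)
      also have "\<dots> = (sqrt B * (1 / sqrt 2)^k)\<^sup>2"
      proof -
        have "((1 / sqrt 2)^k)\<^sup>2 = ((1 / sqrt 2)\<^sup>2)^k"
          by (simp only: power_mult[symmetric] mult.commute)
        also have "(1 / sqrt 2)\<^sup>2 = 1 / (2::real)" by (simp add: power_divide)
        finally show ?thesis using B by (simp add: power_mult_distrib power_divide)
      qed
      finally show "(d k t)\<^sup>2 \<le> (sqrt B * (1 / sqrt 2)^k)\<^sup>2" .
    qed (use B in auto)
    have "summable (\<lambda>k. of_L2 (Y (Suc k)) t - of_L2 (Y k) t)"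
      by (rule summable_comparison_test'[where g="\<lambda>k. sqrt B * (1 / sqrt 2)^k"])
         (use bound in \<open>auto simp: d_def intro!: summable_mult summable_geometric\<close>)
    then have "convergent (\<lambda>n. of_L2 (Y n) t - of_L2 (Y 0) t)"
      unfolding summable_iff_convergent
      by (subst (asm) sum_lessThan_telescope[of "\<lambda>n. of_L2 (Y n) t"])
    from convergent_add[OF this convergent_const[of "of_L2 (Y 0) t"]] show ?case by simp
  qed
  define f where "f = (\<lambda>t. lim (\<lambda>k. of_L2 (Y k) t))"
  have f_lim: "AE t in lebesgue. (\<lambda>k. of_L2 (Y k) t) \<longlonglongrightarrow> f t"
    using conv by eventually_elim (unfold f_def, rule convergent_LIMSEQ_iff[THEN iffD1])
  have [measurable]: "f \<in> borel_measurable lebesgue"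
    unfolding f_def by measurable
  have le: "(\<integral>\<^sup>+t. ennreal ((norm (of_L2 (Y k) t - f t))\<^sup>2) \<partial>lebesgue) \<le> ennreal (((1/2)^k)\<^sup>2)" for k
  proof -
    have "(\<integral>\<^sup>+t. ennreal ((norm (of_L2 (Y k) t - f t))\<^sup>2) \<partial>lebesgue)
       = (\<integral>\<^sup>+t. liminf (\<lambda>m. ennreal ((norm (of_L2 (Y m) t - of_L2 (Y k) t))\<^sup>2)) \<partial>lebesgue)"
    proof (rule nn_integral_cong_AE, use f_lim in eventually_elim)
      case (elim t)
      then have "(\<lambda>m. ennreal ((norm (of_L2 (Y m) t - of_L2 (Y k) t))\<^sup>2))
          \<longlonglongrightarrow> ennreal ((norm (f t - of_L2 (Y k) t))\<^sup>2)"
        by (intro tendsto_intros)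
      from lim_imp_Liminf[OF _ this] show ?case by (simp add: norm_minus_commute)
    qed
    also have "\<dots> \<le> liminf (\<lambda>m. \<integral>\<^sup>+t. ennreal ((norm (of_L2 (Y m) t - of_L2 (Y k) t))\<^sup>2) \<partial>lebesgue)"
      by (rule nn_integral_liminf) measurable
    also have "\<dots> \<le> ennreal (((1/2)^k)\<^sup>2)"
    proof (rule Liminf_le[OF _ eventually_sequentiallyI[of k]])
      fix m assume "k \<le> m"
      have "(\<integral>\<^sup>+t. ennreal ((norm (of_L2 (Y m) t - of_L2 (Y k) t))\<^sup>2) \<partial>lebesgue) = ennreal ((norm (Y m - Y k))\<^sup>2)"
        unfolding nrm using sq[of m k] by (intro nn_integral_eq_integral) (auto simp: square_integrable_def)
      also have "\<dots> \<le> ennreal (((1/2)^k)\<^sup>2)"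
        by (intro ennreal_leI power_mono Y \<open>k \<le> m\<close>) simp
      finally show "(\<integral>\<^sup>+t. ennreal ((norm (of_L2 (Y m) t - of_L2 (Y k) t))\<^sup>2) \<partial>lebesgue) \<le> \<dots>" .
    qed simp
    finally show ?thesis .
  qed
  have sqk: "square_integrable (\<lambda>t. of_L2 (Y k) t - f t)" for k
    unfolding square_integrable_def
  proof
    show "integrable lebesgue (\<lambda>x. (norm (of_L2 (Y k) x - f x))\<^sup>2)"
    proof (rule integrableI_bounded)
      have "(\<integral>\<^sup>+ x. ennreal (norm ((norm (of_L2 (Y k) x - f x))\<^sup>2)) \<partial>lebesgue) \<le> ennreal (((1/2)^k)\<^sup>2)"
        using le[of k] by simp
      also have "\<dots> < \<infinity>" by simp
      finally show "(\<integral>\<^sup>+ x. ennreal (norm ((norm (of_L2 (Y k) x - f x))\<^sup>2)) \<partial>lebesgue) < \<infinity>" .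
    qed measurable
  qed measurable
  have sqf: "square_integrable f"
    using square_integrable_diff[OF square_integrable_of_L2 sqk, of "Y 0" 0] by simp
  show ?thesis
  proof (intro exI allI)
    fix k
    have "Y k - to_L2 f = to_L2 (\<lambda>t. of_L2 (Y k) t - f t)"
      using to_L2_diff[of "of_L2 (Y k)" f] sqf by simp
    then have "ennreal ((norm (Y k - to_L2 f))\<^sup>2) \<le> ennreal (((1/2)^k)\<^sup>2)"
      using le[of k] sqk[of k]
      by (simp add: norm_to_L2_square nn_integral_eq_integral square_integrable_def)
    then have "(norm (Y k - to_L2 f))\<^sup>2 \<le> ((1/2)^k)\<^sup>2" by (subst (asm) ennreal_le_iff) auto
    then show "norm (Y k - to_L2 f) \<le> (1/2)^k" by (rule power2_le_imp_le) simp
  qed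
qed

instance L2fun :: (euclidean_space, euclidean_space) complete_space
proof
  fix X :: "nat \<Rightarrow> ('a,'b) L2fun"
  assume C: "Cauchy X"
  have "\<exists>N. \<forall>m\<ge>N. \<forall>n\<ge>N. norm (X m - X n) < (1/2)^k" for k :: nat
    using C unfolding Cauchy_def dist_norm by (metis zero_less_power half_gt_zero_iff zero_less_one)
  then obtain N where N: "\<And>k m n. m \<ge> N k \<Longrightarrow> n \<ge> N k \<Longrightarrow> norm (X m - X n) < (1/2)^k"
    by metis
  \<comment> \<open>Partial sums replace running maxima: \<open>r\<close> is monotone and dominates
    \<open>N\<close>.\<close>
  define r where "r k = (\<Sum>j\<le>k. N j + 1)" for k
  have r_ge: "N k \<le> r k" for k unfolding r_def by (induction k) auto
  have r_mono: "k \<le> m \<Longrightarrow> r k \<le> r m" for k m unfolding r_def by (intro sum_mono2) auto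
  have "norm (X (r m) - X (r k)) \<le> (1/2)^k" if "k \<le> m" for k m
    using N[OF order_trans[OF r_ge r_mono[OF that]] r_ge] by (rule less_imp_le)
  from L2_fast_Cauchy_convergent[OF this]
  obtain y where y: "\<And>k. norm (X (r k) - y) \<le> (1/2)^k"
    by blast
  have "X \<longlonglongrightarrow> y"
  proof (rule LIMSEQ_I)
    fix e :: real assume "e > 0"
    then obtain k where k: "(1/2)^k < e / 2"
      by (metis half_gt_zero_iff real_arch_pow_inv one_less_numeral_iff semiring_norm(76)
          divide_less_eq_1_pos zero_less_numeral)
    show "\<exists>no. \<forall>n\<ge>no. norm (X n - y) < e"
    proof (intro exI allI impI)
      fix n assume "n \<ge> N k"
      have "norm (X n - y) \<le> norm (X n - X (r k)) + norm (X (r k) - y)"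
        by (metis norm_triangle_ineq diff_add_cancel add_diff_eq)
      also have "\<dots> < e" using N[OF \<open>n \<ge> N k\<close> r_ge] y[of k] k by linarith
      finally show "norm (X n - y) < e" .
    qed
  qed
  then show "convergent X" by (rule convergentI)
qed

instance L2fun :: (euclidean_space, euclidean_space) banach ..

section \<open>Hilbert spaces and ordinary differential equations\<close>

text \<open>A variational proof: the representative minimises
  \<open>(norm w)\<^sup>2 - 2 * l w\<close> over H. Linearity and boundedness of \<open>l\<close>
  are required on H only, which admits functionals given by integrals that converge merely for
  elements of H.\<close>

lemma Riesz_closed_subspace:
  fixes H :: "'x::{real_inner,complete_space} set"
  assumes H: "subspace H" "closed H"
    and add: "\<And>x y. x \<in> H \<Longrightarrow> y \<in> H \<Longrightarrow> l (x + y) = l x + l y"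
    and scale: "\<And>c x. x \<in> H \<Longrightarrow> l (c *\<^sub>R x) = c * l x"
    and bound: "\<And>x. x \<in> H \<Longrightarrow> \<bar>l x\<bar> \<le> C * norm x"
  shows "\<exists>g\<in>H. \<forall>w\<in>H. l w = g \<bullet> w"
proof -
  define F where "F w = (norm w)\<^sup>2 - 2 * l w" for w
  have F_ge: "- C\<^sup>2 \<le> F w" if "w \<in> H" for w
  proof -
    have "2 * l w \<le> 2 * (C * norm w)" using bound[OF that] by linarith
    also have "\<dots> \<le> C\<^sup>2 + (norm w)\<^sup>2" using sum_squares_bound[of C "norm w"] by simp
    finally show ?thesis by (simp add: F_def)
  qed
  have H0: "0 \<in> H" using H(1) by (rule subspace_0)
  define m where "m = Inf (F ` H)"
  have bdd: "bdd_below (F ` H)" using F_ge by (intro bdd_belowI2) auto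
  have m_le: "m \<le> F w" if "w \<in> H" for w
    unfolding m_def using that bdd by (intro cInf_lower) auto
  have "\<exists>w\<in>H. F w < m + 1 / (real n + 1)" for n :: nat
  proof -
    have "Inf (F ` H) < m + 1 / (real n + 1)" by (simp add: m_def)
    then show ?thesis using cInf_less_iff[of "F ` H"] bdd H0 by blast
  qed
  then obtain w where w: "\<And>n::nat. w n \<in> H" "\<And>n::nat. F (w n) < m + 1 / (real n + 1)"
    by metis
  \<comment> \<open>The midpoint of a and b lies in H, so \<open>F\<close> is at least m there; with
    the parallelogram law, two nearly minimal points must be close to each other.\<close>
  have para: "(norm (a - b))\<^sup>2 \<le> 2 * (F a + F b - 2 * m)" if "a \<in> H" "b \<in> H" for a b
  proof -
    have ab: "a + b \<in> H" using H(1) that by (simp add: subspace_add)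
    have mid: "(1/2) *\<^sub>R (a + b) \<in> H" using H(1) ab by (simp add: subspace_scale)
    have "l ((1/2) *\<^sub>R (a + b)) = (l a + l b) / 2" using scale[OF ab] add[OF that] by simp
    then have "F ((1/2) *\<^sub>R (a + b)) = (norm (a + b))\<^sup>2 / 4 - (l a + l b)"
      by (simp add: F_def power_divide)
    with m_le[OF mid] have "4 * m \<le> (norm (a + b))\<^sup>2 - 4 * (l a + l b)" by simp
    moreover have "(norm (a + b))\<^sup>2 + (norm (a - b))\<^sup>2 = 2 * (norm a)\<^sup>2 + 2 * (norm b)\<^sup>2"
      by (simp add: power2_norm_eq_inner inner_add inner_diff inner_commute algebra_simps)
    ultimately show ?thesis by (simp add: F_def)
  qed
  have "Cauchy w"
  proof (rule CauchyI)
    fix e :: real assume e: "0 < e"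
    obtain N :: nat where N: "4 / e\<^sup>2 < real N" using reals_Archimedean2 by blast
    show "\<exists>M. \<forall>m\<ge>M. \<forall>n\<ge>M. norm (w m - w n) < e"
    proof (intro exI allI impI)
      fix j k assume jk: "j \<ge> N" "k \<ge> N"
      have s: "1 / (real i + 1) < e\<^sup>2 / 4" if "i \<ge> N" for i
      proof -
        have "4 / e\<^sup>2 < real i + 1" using N that by linarith
        then have "4 < (real i + 1) * e\<^sup>2" using e by (simp add: divide_less_eq)
        then show ?thesis by (simp add: field_simps)
      qed
      have "(norm (w j - w k))\<^sup>2 \<le> 2 * (F (w j) + F (w k) - 2 * m)" by (intro para w)
      also have "\<dots> < 2 * (e\<^sup>2 / 4 + e\<^sup>2 / 4)"
      proof -
        have "F (w j) < m + e\<^sup>2 / 4"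
          by (rule less_trans[OF w(2)]) (use s[OF jk(1)] in simp)
        moreover have "F (w k) < m + e\<^sup>2 / 4"
          by (rule less_trans[OF w(2)]) (use s[OF jk(2)] in simp)
        ultimately show ?thesis by simp
      qed
      finally have "(norm (w j - w k))\<^sup>2 < e\<^sup>2" by simp
      then show "norm (w j - w k) < e" using e by (simp add: power2_less_imp_less)
    qed
  qed
  then obtain g where g: "w \<longlonglongrightarrow> g" using Cauchy_convergent_iff convergent_def by blast
  have gH: "g \<in> H" using closed_sequentially[OF H(2) _ g] w(1) by blast
  show ?thesis
  proof (intro bexI[OF _ gH] ballI)
    fix v assume v: "v \<in> H"
    \<comment> \<open>First variation of \<open>F\<close> in the direction v. It is carried out
      along the minimising sequence and passed to the limit, where the excess
      \<open>1 / (real n + 1)\<close> disappears.\<close>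
    have ineq: "0 \<le> 2 * t * (g \<bullet> v - l v) + t\<^sup>2 * (norm v)\<^sup>2" for t
    proof (rule LIMSEQ_le)
      show "(\<lambda>n::nat. - (1 / (real n + 1))) \<longlonglongrightarrow> 0"
        using tendsto_minus[OF LIMSEQ_inverse_real_of_nat] by (simp add: inverse_eq_divide add.commute)
      show "(\<lambda>n. 2 * t * (w n \<bullet> v - l v) + t\<^sup>2 * (norm v)\<^sup>2)
          \<longlonglongrightarrow> 2 * t * (g \<bullet> v - l v) + t\<^sup>2 * (norm v)\<^sup>2"
        by (intro tendsto_intros g)
      have "- (1 / (real n + 1)) \<le> 2 * t * (w n \<bullet> v - l v) + t\<^sup>2 * (norm v)\<^sup>2" for n :: nat
      proof -
        have tv: "t *\<^sub>R v \<in> H" using H(1) v by (simp add: subspace_scale)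
        have "(norm (w n + t *\<^sub>R v))\<^sup>2 = (norm (w n))\<^sup>2 + 2 * t * (w n \<bullet> v) + t\<^sup>2 * (norm v)\<^sup>2"
          unfolding power2_norm_eq_inner
          by (simp add: inner_add inner_commute power2_eq_square algebra_simps)
        then have "F (w n + t *\<^sub>R v) = F (w n) + (2 * t * (w n \<bullet> v - l v) + t\<^sup>2 * (norm v)\<^sup>2)"
          using add[OF w(1) tv] scale[OF v]
          by (simp add: F_def algebra_simps)
        moreover have "m \<le> F (w n + t *\<^sub>R v)"
          using H(1) w(1) tv by (intro m_le) (simp add: subspace_add)
        ultimately show ?thesis using w(2)[of n] by linarith
      qed
      then show "\<exists>N. \<forall>n\<ge>N. - (1 / (real n + 1)) \<le> 2 * t * (w n \<bullet> v - l v) + t\<^sup>2 * (norm v)\<^sup>2"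
        by blast
    qed
    show "l v = g \<bullet> v"
    proof (cases "v = 0")
      case True
      then show ?thesis using scale[OF H0, of 0] by simp
    next
      case False
      then have nv: "(norm v)\<^sup>2 > 0" by simp
      define D where "D = g \<bullet> v - l v"
      \<comment> \<open>The value of t at which the quadratic in \<open>ineq\<close> is
        smallest.\<close>
      have "0 \<le> 2 * (- D / (norm v)\<^sup>2) * D + (- D / (norm v)\<^sup>2)\<^sup>2 * (norm v)\<^sup>2"
        using ineq[of "- D / (norm v)\<^sup>2"] by (simp add: D_def)
      also have "\<dots> = - (D\<^sup>2 / (norm v)\<^sup>2)"
        using nv by (simp add: power2_eq_square field_simps)
      finally have "D\<^sup>2 \<le> 0" using nv by (simp add: divide_le_0_iff zero_le_divide_iff)
      then show ?thesis by (simp add: D_def)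
    qed
  qed
qed

section \<open>Ordinary differential equations and the potential well\<close>

lemma global_Picard_Lindelof:
  fixes G :: "'x::banach \<Rightarrow> 'x"
  assumes lip: "\<And>x y. norm (G x - G y) \<le> L * norm (x - y)" and L: "0 < L"
  shows "\<exists>u. u 0 = x0 \<and> (\<forall>t\<ge>0. (u has_vector_derivative G (u t)) (at t within {0..}))"
proof -
  define U where "U = rec_nat (\<lambda>t::real. x0) (\<lambda>k v t. x0 + integral {0..t} (\<lambda>s. G (v s)))"
  have U0: "U 0 t = x0" and US: "U (Suc k) t = x0 + integral {0..t} (\<lambda>s. G (U k s))" for k t
    by (simp_all add: U_def)
  have contG: "continuous_on S G" for S
    by (rule lipschitz_on_continuous_on[OF lipschitz_onI[of S G L]])
       (use lip L in \<open>auto simp: dist_norm\<close>)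
  have contU: "continuous_on {0..T} (U k)" for k T
  proof (induction k arbitrary: T)
    case 0
    then show ?case by (simp add: U0[abs_def])
  next
    case (Suc k)
    have "continuous_on {0..T} (\<lambda>s. G (U k s))"
      by (rule continuous_on_compose2[OF contG[of UNIV] Suc]) auto
    then have "continuous_on {0..T} (\<lambda>t. integral {0..t} (\<lambda>s. G (U k s)))"
      by (intro indefinite_integral_continuous_1 integrable_continuous_real)
    then show ?case unfolding US[abs_def] by (intro continuous_intros)
  qed
  have contGU: "continuous_on {0..T} (\<lambda>s. G (U k s))" for k T
    by (rule continuous_on_compose2[OF contG[of UNIV] contU]) auto
  \<comment> \<open>Chosen so that the first increment, at most \<open>t * norm (G x0)\<close>,
    equals \<open>M * (2 * L * t)\<close> and is thus below
    \<open>M * exp (2 * L * t)\<close>.\<close>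
  define M where "M = norm (G x0) / (2 * L)"
  have M0: "0 \<le> M" using L by (simp add: M_def)
  (* In the norm weighted by exp (- 2 L t) the Picard iteration contracts by 1/2 on the whole half
     line, so no gluing of local solutions is needed. *)
  have step: "norm (U (Suc k) t - U k t) \<le> M * (1/2)^k * exp (2 * L * t)" if "0 \<le> t" for k t
    using that
  proof (induction k arbitrary: t)
    case 0
    have "norm (U (Suc 0) t - U 0 t) = t * norm (G x0)"
      using 0 by (simp add: US U0)
    also have "\<dots> = M * (2 * L * t)" using L by (simp add: M_def)
    also have "\<dots> \<le> M * exp (2 * L * t)"
      using exp_ge_add_one_self[of "2 * L * t"] M0 by (intro mult_left_mono) linarith+
    finally show ?case by simp
  next
    case (Suc k)
    have hi: "((\<lambda>s. L * (M * (1/2)^k * exp (2 * L * s))) has_integral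
        (M * (1/2)^k / 2 * exp (2 * L * t) - M * (1/2)^k / 2 * exp (2 * L * 0))) {0..t}"
    proof (rule fundamental_theorem_of_calculus[OF Suc.prems])
      fix s assume "s \<in> {0..t}"
      show "((\<lambda>s. M * (1/2)^k / 2 * exp (2 * L * s)) has_vector_derivative
          L * (M * (1/2)^k * exp (2 * L * s))) (at s within {0..t})"
        by (auto intro!: derivative_eq_intros simp flip: has_real_derivative_iff_has_vector_derivative)
    qed
    have "U (Suc (Suc k)) t - U (Suc k) t = integral {0..t} (\<lambda>s. G (U (Suc k) s) - G (U k s))"
      by (subst integral_diff[OF integrable_continuous_real[OF contGU] integrable_continuous_real[OF contGU]])
         (simp only: US[of "Suc k" t] US[of k t] add_diff_cancel_left)
    also have "norm \<dots> \<le> integral {0..t} (\<lambda>s. L * (M * (1/2)^k * exp (2 * L * s)))"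
    proof (rule integral_norm_bound_integral)
      show "(\<lambda>s. G (U (Suc k) s) - G (U k s)) integrable_on {0..t}"
        by (intro integrable_continuous_real continuous_on_diff contGU)
      show "(\<lambda>s. L * (M * (1/2)^k * exp (2 * L * s))) integrable_on {0..t}"
        using hi by blast
      fix s assume "s \<in> {0..t}"
      then show "norm (G (U (Suc k) s) - G (U k s)) \<le> L * (M * (1/2)^k * exp (2 * L * s))"
        using lip[of "U (Suc k) s" "U k s"] Suc.IH[of s] L
        by (meson atLeastAtMost_iff mult_left_mono order_trans less_imp_le)
    qed
    also have "\<dots> = M * (1/2)^k / 2 * exp (2 * L * t) - M * (1/2)^k / 2"
      using integral_unique[OF hi] by simp
    also have "\<dots> \<le> M * (1/2)^Suc k * exp (2 * L * t)" using M0 by simp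
    finally show ?case .
  qed
  define u where "u t = x0 + (\<Sum>k. U (Suc k) t - U k t)" for t
  have unif: "uniform_limit {0..T} U u sequentially" for T
  proof -
    have "uniform_limit {0..T} (\<lambda>n t. \<Sum>k<n. U (Suc k) t - U k t) (\<lambda>t. \<Sum>k. U (Suc k) t - U k t) sequentially"
    proof (rule Weierstrass_m_test)
      show "norm (U (Suc k) t - U k t) \<le> M * (1/2)^k * exp (2 * L * T)" if "t \<in> {0..T}" for k t
      proof -
        have "norm (U (Suc k) t - U k t) \<le> M * (1/2)^k * exp (2 * L * t)"
          using step that by simp
        also have "\<dots> \<le> M * (1/2)^k * exp (2 * L * T)"
          using that L M0 by (intro mult_left_mono) auto
        finally show ?thesis .
      qed
      show "summable (\<lambda>k. M * (1/2)^k * exp (2 * L * T))"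
        by (intro summable_mult summable_mult2 summable_geometric) simp
    qed
    then have "uniform_limit {0..T} (\<lambda>n t. x0 + (\<Sum>k<n. U (Suc k) t - U k t)) u sequentially"
      unfolding u_def[abs_def] by (intro uniform_limit_add uniform_limit_const)
    moreover have "x0 + (\<Sum>k<n. U (Suc k) t - U k t) = U n t" for n t
      by (subst sum_lessThan_telescope[of "\<lambda>k. U k t"]) (simp add: U0)
    ultimately show ?thesis by simp
  qed
  have contu: "continuous_on {0..T} u" for T
    by (rule uniform_limit_theorem[OF _ unif]) (auto simp: contU)
  have contGu: "continuous_on {0..T} (\<lambda>s. G (u s))" for T
    by (rule continuous_on_compose2[OF contG[of UNIV] contu]) auto
  have eq: "u t = x0 + integral {0..t} (\<lambda>s. G (u s))" if t: "0 \<le> t" for t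
  proof -
    have "uniform_limit {0..t} (\<lambda>n s. G (U n s)) (\<lambda>s. G (u s)) sequentially"
    proof (rule uniform_limitI)
      fix e :: real assume "e > 0"
      then have "e / L > 0" using L by simp
      from uniform_limitD[OF unif this, of t]
      show "\<forall>\<^sub>F n in sequentially. \<forall>s\<in>{0..t}. dist (G (U n s)) (G (u s)) < e"
      proof (eventually_elim, intro ballI)
        fix n s assume *: "\<forall>s\<in>{0..t}. dist (U n s) (u s) < e / L" "s \<in> {0..t}"
        have "dist (G (U n s)) (G (u s)) \<le> L * dist (U n s) (u s)" using lip by (simp add: dist_norm)
        also have "\<dots> < e" using * L by (simp add: pos_less_divide_eq mult.commute)
        finally show "dist (G (U n s)) (G (u s)) < e" .
      qed
    qed
    from uniform_limit_integral[OF this contGU]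
    obtain A B where AB: "\<And>n. ((\<lambda>s. G (U n s)) has_integral A n) {0..t}"
      "((\<lambda>s. G (u s)) has_integral B) {0..t}" "A \<longlonglongrightarrow> B"
      by auto
    have "(\<lambda>n. U (Suc n) t) \<longlonglongrightarrow> x0 + B"
      unfolding US integral_unique[OF AB(1)] by (intro tendsto_intros AB(3))
    moreover have "(\<lambda>n. U (Suc n) t) \<longlonglongrightarrow> u t"
      using tendsto_uniform_limitI[OF unif[of t], of t] t by (intro LIMSEQ_Suc) auto
    ultimately show ?thesis
      using LIMSEQ_unique integral_unique[OF AB(2)] by metis
  qed
  show ?thesis
  proof (intro exI conjI allI impI)
    show "u 0 = x0" using eq[of 0] by simp
    fix t :: real assume t: "0 \<le> t"
    \<comment> \<open>The interval reaches beyond t, so that near t it coincides with the half line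
      and yields the same derivative; at t = 0 both are one-sided.\<close>
    have "((\<lambda>r. integral {0..r} (\<lambda>s. G (u s))) has_vector_derivative G (u t)) (at t within {0..t+1})"
      by (rule integral_has_vector_derivative[OF contGu]) (use t in auto)
    then have "((\<lambda>r. x0 + integral {0..r} (\<lambda>s. G (u s))) has_vector_derivative G (u t)) (at t within {0..t+1})"
      by (auto intro!: derivative_eq_intros)
    then have "(u has_vector_derivative G (u t)) (at t within {0..t+1})"
      by (rule has_vector_derivative_transform[rotated 2]) (use t eq in auto)
    moreover have "at t within {0..t+1} = at t within {0..}"
      by (rule at_within_nhd[of _ "{..<t+1}"]) auto
    ultimately show "(u has_vector_derivative G (u t)) (at t within {0..})" by simp
  qed
qed

definition radial_retraction :: "real \<Rightarrow> 'x::real_normed_vector \<Rightarrow> 'x" where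
  "radial_retraction R x = (if norm x \<le> R then x else (R / norm x) *\<^sub>R x)"

lemma norm_radial_retraction: "0 \<le> R \<Longrightarrow> norm (radial_retraction R x) \<le> R"
  by (simp add: radial_retraction_def)

text \<open>The constant 2 results from the triangle inequality alone, in any normed space. It is
  enough here, since the retraction serves only to make a locally Lipschitz field globally
  Lipschitz.\<close>

lemma radial_retraction_Lipschitz:
  assumes R: "0 < R"
  shows "norm (radial_retraction R x - radial_retraction R y) \<le> 2 * norm (x - y)"
proof -
  have out_in: "norm (radial_retraction R a - radial_retraction R b) \<le> 2 * norm (a - b)"
    if a: "norm a > R" and b: "norm b \<le> R" for a b :: 'a
  proof -
    have "(R / norm a) *\<^sub>R a - a = (R / norm a - 1) *\<^sub>R a" by (simp add: scaleR_diff_left)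
    also have "norm \<dots> = \<bar>(R / norm a - 1) * norm a\<bar>" by (simp add: abs_mult)
    also have "(R / norm a - 1) * norm a = R - norm a" using a R by (cases "a = 0") (simp_all add: field_simps)
    finally have "norm ((R / norm a) *\<^sub>R a - a) = norm a - R" using a by simp
    then have "norm ((R / norm a) *\<^sub>R a - b) \<le> (norm a - R) + norm (a - b)"
      using norm_triangle_ineq[of "(R / norm a) *\<^sub>R a - a" "a - b"] by simp
    also have "\<dots> \<le> 2 * norm (a - b)" using b norm_triangle_ineq2[of a b] by simp
    finally show ?thesis using a b by (simp add: radial_retraction_def)
  qed
  consider "norm x \<le> R" "norm y \<le> R" | "norm x > R" "norm y \<le> R" | "norm x \<le> R" "norm y > R"
    | "norm x > R" "norm y > R" by linarith
  then show ?thesis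
  proof cases
    case 1
    then show ?thesis by (simp add: radial_retraction_def)
  next
    case 2
    then show ?thesis by (rule out_in)
  next
    case 3
    then show ?thesis using out_in[of y x] by (simp add: norm_minus_commute)
  next
    case 4
    \<comment> \<open>The first term rescales x - y, the second corrects the difference of the two
      scaling factors; each is at most \<open>norm (x - y)\<close> because both points lie outside
      the ball.\<close>
    have "(R / norm x) *\<^sub>R x - (R / norm y) *\<^sub>R y = (R / norm x) *\<^sub>R (x - y) + (R / norm x - R / norm y) *\<^sub>R y"
      by (simp add: algebra_simps)
    also have "norm \<dots> \<le> (R / norm x) * norm (x - y) + \<bar>(R / norm x - R / norm y) * norm y\<bar>"
      using R norm_triangle_ineq[of "(R / norm x) *\<^sub>R (x - y)" "(R / norm x - R / norm y) *\<^sub>R y"]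
      by (simp add: abs_mult)
    also have "(R / norm x - R / norm y) * norm y = (R / norm x) * (norm y - norm x)"
    proof -
      have "norm x \<noteq> 0" "norm y \<noteq> 0" using 4 R by linarith+
      then show ?thesis by (simp add: field_simps)
    qed
    also have "\<bar>(R / norm x) * (norm y - norm x)\<bar> = (R / norm x) * \<bar>norm y - norm x\<bar>"
      using R by (simp add: abs_mult)
    also have "(R / norm x) * norm (x - y) + (R / norm x) * \<bar>norm y - norm x\<bar> \<le> 1 * norm (x - y) + 1 * norm (x - y)"
    proof -
      have "R / norm x \<le> 1" using 4 R by (simp add: divide_le_eq_1)
      then show ?thesis
        using R norm_triangle_ineq3[of y x] by (intro add_mono mult_mono) (auto simp: norm_minus_commute)
    qed
    finally show ?thesis using 4 by (simp add: radial_retraction_def)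
  qed
qed

text \<open>\<open>P x\<close> is the Riesz representative on H of the functional
  \<open>w \<mapsto> x \<bullet> w\<close>.\<close>

lemma orthogonal_projection_exists:
  fixes H :: "'x::{real_inner,complete_space} set"
  assumes H: "subspace H" "closed H"
  shows "\<exists>P. (\<forall>x. P x \<in> H \<and> (\<forall>w\<in>H. P x \<bullet> w = x \<bullet> w)) \<and> (\<forall>x\<in>H. P x = x)
    \<and> (\<forall>x y. norm (P x - P y) \<le> norm (x - y))"
proof -
  have "\<exists>g\<in>H. \<forall>w\<in>H. x \<bullet> w = g \<bullet> w" for x
    by (rule Riesz_closed_subspace[OF H, where C="norm x"])
       (auto simp: inner_add_right Cauchy_Schwarz_ineq2)
  then obtain P where P: "\<And>x. P x \<in> H" "\<And>x w. w \<in> H \<Longrightarrow> x \<bullet> w = P x \<bullet> w" by metis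
  have "P x = x" if "x \<in> H" for x
  proof -
    have "P x - x \<in> H" using H(1) P(1) that by (rule subspace_diff)
    then have "(P x - x) \<bullet> (P x - x) = 0" using P(2)[of "P x - x" x] by (simp add: inner_diff_left)
    then show ?thesis by simp
  qed
  moreover have "norm (P x - P y) \<le> norm (x - y)" for x y
  proof -
    define w where "w = P x - P y"
    have "w \<in> H" unfolding w_def using H(1) P(1) P(1) by (rule subspace_diff)
    then have "w \<bullet> w = (x - y) \<bullet> w" using P(2)[of w] by (simp add: w_def inner_diff_left)
    also have "\<dots> \<le> norm (x - y) * norm w" by (rule norm_cauchy_schwarz)
    finally have "norm w * norm w \<le> norm (x - y) * norm w" by (simp add: norm_eq_sqrt_inner)
    then show ?thesis unfolding w_def[symmetric] by (cases "norm w = 0") auto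
  qed
  ultimately show ?thesis using P by metis
qed

lemma has_vector_derivative_inner:
  assumes "(f has_vector_derivative f') (at x within S)" "(g has_vector_derivative g') (at x within S)"
  shows "((\<lambda>x. f x \<bullet> g x) has_vector_derivative f x \<bullet> g' + f' \<bullet> g x) (at x within S)"
  by (rule bounded_bilinear.has_vector_derivative[OF bounded_bilinear_inner assms])

text \<open>The potential well method in abstract form. The hypothesis on \<open>E\<close> says that
  \<open>G\<close> is minus the gradient of \<open>E\<close> along H, with a quadratic remainder
  that is uniform on balls; this is all the differentiability that the energy identity needs. The
  hypothesis \<open>well\<close> expresses that every nonzero critical point of the ray condition
  below level \<alpha> has squared norm at least \<Lambda>. The integral in the conclusion records
  the dissipation, from which integrability in time follows later.\<close>

theorem potential_well_flow:
  fixes H :: "'x::{real_inner,banach} set" and G :: "'x \<Rightarrow> 'x" and E :: "'x \<Rightarrow> real"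
  assumes H: "subspace H" "closed H"
    and GH: "\<And>x. x \<in> H \<Longrightarrow> G x \<in> H" and G0: "G 0 = 0"
    and lip: "\<And>R. \<exists>L. \<forall>x\<in>H. \<forall>y\<in>H. norm x \<le> R \<longrightarrow> norm y \<le> R \<longrightarrow> norm (G x - G y) \<le> L * norm (x - y)"
    and E: "\<And>R. \<exists>K. \<forall>x\<in>H. \<forall>y\<in>H. norm x \<le> R \<longrightarrow> norm y \<le> R \<longrightarrow>
        \<bar>E x - E y + G y \<bullet> (x - y)\<bar> \<le> K * (norm (x - y))\<^sup>2"
    and v0: "v0 \<in> H" "E v0 < \<alpha>" "(norm v0)\<^sup>2 < \<Lambda>" "G v0 \<bullet> v0 < 0"
    and well: "\<And>x. x \<in> H \<Longrightarrow> x \<noteq> 0 \<Longrightarrow> G x \<bullet> x = 0 \<Longrightarrow> E x < \<alpha> \<Longrightarrow> \<Lambda> \<le> (norm x)\<^sup>2"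
  shows "\<exists>u. u 0 = v0 \<and> (\<forall>t\<ge>0. u t \<in> H \<and> norm (u t) \<le> norm v0 \<and>
      (u has_vector_derivative G (u t)) (at t within {0..}) \<and>
      ((\<lambda>s. (norm (G (u s)))\<^sup>2) has_integral (E v0 - E (u t))) {0..t})"
proof -
  define R where "R = norm v0 + 1"
  have R: "0 < R" by (simp add: R_def add_nonneg_pos)
  obtain L0 where L0: "\<And>x y. x \<in> H \<Longrightarrow> y \<in> H \<Longrightarrow> norm x \<le> R \<Longrightarrow> norm y \<le> R \<Longrightarrow>
      norm (G x - G y) \<le> L0 * norm (x - y)"
    using lip[of R] by blast
  define L where "L = max L0 1"
  have L: "0 < L" by (simp add: L_def)
  have LG: "norm (G x - G y) \<le> L * norm (x - y)"
    if "x \<in> H" "y \<in> H" "norm x \<le> R" "norm y \<le> R" for x y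
    using L0[OF that] mult_right_mono[of L0 L "norm (x - y)"] by (simp add: L_def)
  obtain K where K: "\<And>x y. x \<in> H \<Longrightarrow> y \<in> H \<Longrightarrow> norm x \<le> R \<Longrightarrow> norm y \<le> R \<Longrightarrow>
      \<bar>E x - E y + G y \<bullet> (x - y)\<bar> \<le> K * (norm (x - y))\<^sup>2"
    using E[of R] by blast
  obtain P where PH: "\<And>x. P x \<in> H" and Pw: "\<And>x w. w \<in> H \<Longrightarrow> P x \<bullet> w = x \<bullet> w"
    and Pid: "\<And>x. x \<in> H \<Longrightarrow> P x = x" and Plip: "\<And>x y. norm (P x - P y) \<le> norm (x - y)"
    using orthogonal_projection_exists[OF H] by metis
  (* Projecting onto H and retracting onto a ball makes the vector field globally Lipschitz; the a
     priori bound shows that the solution never leaves the ball. *)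
  define \<Gamma> where "\<Gamma> x = G (radial_retraction R (P x))" for x
  have rH: "radial_retraction R x \<in> H" if "x \<in> H" for x
    using that H(1) by (simp add: radial_retraction_def subspace_scale)
  have \<Gamma>H: "\<Gamma> x \<in> H" for x unfolding \<Gamma>_def by (intro GH rH PH)
  have \<Gamma>lip: "norm (\<Gamma> x - \<Gamma> y) \<le> (2 * L) * norm (x - y)" for x y
  proof -
    have "norm (\<Gamma> x - \<Gamma> y) \<le> L * norm (radial_retraction R (P x) - radial_retraction R (P y))"
      unfolding \<Gamma>_def using R by (intro LG rH PH norm_radial_retraction) auto
    also have "\<dots> \<le> L * (2 * norm (P x - P y))"
      using L by (intro mult_left_mono radial_retraction_Lipschitz[OF R]) auto
    also have "\<dots> \<le> L * (2 * norm (x - y))"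
      using L Plip[of x y] by (intro mult_left_mono) auto
    finally show ?thesis by simp
  qed
  have \<Gamma>G: "\<Gamma> x = G x" if "x \<in> H" "norm x \<le> R" for x
    using that by (simp add: \<Gamma>_def Pid radial_retraction_def)
  obtain u where u0: "u 0 = v0" and
    u': "\<And>t. t \<ge> 0 \<Longrightarrow> (u has_vector_derivative \<Gamma> (u t)) (at t within {0..})"
    using global_Picard_Lindelof[OF \<Gamma>lip, of v0] L by auto
  have u'_at: "(u has_vector_derivative \<Gamma> (u t)) (at t)" if "t > 0" for t
  proof -
    have "at t within {0..} = at t within UNIV"
      by (rule at_within_nhd[of t "{0<..}"]) (use that in auto)
    then show ?thesis using u'[of t] that by simp
  qed
  have uH: "u t \<in> H" if t: "t \<ge> 0" for t
  proof -
    \<comment> \<open>The component of \<open>u t\<close> orthogonal to H. As the field takes values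
      in H, \<open>u s \<bullet> z\<close> is constant in s, and it vanishes at s = 0.\<close>
    define z where "z = u t - P (u t)"
    have zH: "w \<bullet> z = 0" if "w \<in> H" for w
      using Pw[OF that, of "u t"] by (simp add: z_def inner_diff_right inner_commute)
    have "\<exists>c. \<forall>s\<in>{0..}. u s \<bullet> z = c"
    proof (rule has_field_derivative_zero_constant)
      show "((\<lambda>s. u s \<bullet> z) has_field_derivative 0) (at s within {0..})" if "s \<in> {0..}" for s
        using has_vector_derivative_inner[OF u'[of s] has_vector_derivative_const[of z]] that zH[OF \<Gamma>H]
        by (simp add: has_real_derivative_iff_has_vector_derivative)
    qed auto
    then have "u t \<bullet> z = u 0 \<bullet> z" using t by auto
    then have "u t \<bullet> z = 0" using zH[OF v0(1)] u0 by simp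
    then have "z \<bullet> z = 0" using zH[OF PH[of "u t"]] by (simp add: z_def inner_diff_left)
    then show ?thesis using PH[of "u t"] by (simp add: z_def)
  qed
  have contu: "continuous_on {0..} u"
    using u' by (auto simp: continuous_on_eq_continuous_within intro: has_vector_derivative_continuous)
  have cont\<Gamma>: "continuous_on {0..} (\<lambda>t. \<Gamma> (u t))"
  proof -
    have "continuous_on UNIV \<Gamma>"
      by (rule lipschitz_on_continuous_on[OF lipschitz_onI[of _ \<Gamma> "2 * L"]])
         (use \<Gamma>lip L in \<open>auto simp: dist_norm\<close>)
    then show ?thesis by (rule continuous_on_compose2[OF _ contu]) auto
  qed
  define N where "N t = (norm (u t))\<^sup>2" for t
  \<comment> \<open>In the application this is the functional I along the orbit, as long as the
    orbit stays in the ball where \<open>\<Gamma>\<close> and \<open>G\<close> agree.\<close>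
  define \<iota> where "\<iota> t = - (\<Gamma> (u t) \<bullet> u t)" for t
  have cont\<iota>: "continuous_on {0..} \<iota>" unfolding \<iota>_def[abs_def]
    by (intro continuous_intros cont\<Gamma> contu)
  have contN: "continuous_on {0..} N" unfolding N_def[abs_def]
    by (intro continuous_intros contu)
  have N': "(N has_real_derivative (- 2 * \<iota> t)) (at t)" if "t > 0" for t
    unfolding N_def[abs_def] power2_norm_eq_inner \<iota>_def
    using has_vector_derivative_inner[OF u'_at[OF that] u'_at[OF that]]
    by (simp add: has_real_derivative_iff_has_vector_derivative inner_commute)
  have "v0 \<noteq> 0" using v0(4) by auto
  \<comment> \<open>The point 0 satisfies \<open>G x \<bullet> x = 0\<close> but is excluded in
    \<open>well\<close>, so the orbit must be shown never to reach it. A Lipschitz field that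
    vanishes at 0 permits at most exponential decay: \<open>N t * exp (4 * L * t)\<close> is
    nondecreasing.\<close>
  have Npos: "N t > 0" if t: "t \<ge> 0" for t
  proof -
    have "N 0 * exp (4 * L * 0) \<le> N t * exp (4 * L * t)"
    proof (rule DERIV_nonneg_imp_increasing_open[OF t])
      fix s assume s: "0 < s" "s < t"
      have "norm (\<Gamma> (u s)) \<le> 2 * L * norm (u s)"
        using \<Gamma>lip[of "u s" 0] \<Gamma>G[OF subspace_0[OF H(1)]] G0 R by simp
      then have "norm (\<Gamma> (u s)) * norm (u s) \<le> 2 * L * norm (u s) * norm (u s)"
        by (rule mult_right_mono) simp
      then have "\<iota> s \<le> 2 * L * N s"
        using Cauchy_Schwarz_ineq2[of "\<Gamma> (u s)" "u s"]
        by (simp add: \<iota>_def N_def power2_eq_square mult.assoc)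
      then have "0 \<le> (4 * L * N s - 2 * \<iota> s) * exp (4 * L * s)" by simp
      moreover have "((\<lambda>t. N t * exp (4 * L * t)) has_real_derivative
          (4 * L * N s - 2 * \<iota> s) * exp (4 * L * s)) (at s)"
        by (auto intro!: derivative_eq_intros N' s simp: algebra_simps)
      ultimately show "\<exists>y. ((\<lambda>t. N t * exp (4 * L * t)) has_real_derivative y) (at s) \<and> 0 \<le> y"
        by blast
    next
      show "continuous_on {0..t} (\<lambda>t. N t * exp (4 * L * t))"
        by (intro continuous_intros continuous_on_subset[OF contN]) auto
    qed
    moreover have "N 0 > 0" using \<open>v0 \<noteq> 0\<close> by (simp add: N_def u0)
    ultimately show ?thesis by (simp add: zero_less_mult_iff) (smt (verit) exp_gt_zero mult_nonpos_nonneg)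
  qed
  have energy: "((\<lambda>s. (norm (\<Gamma> (u s)))\<^sup>2) has_integral (E v0 - E (u t))) {0..t}"
    if t: "0 \<le> t" and ball: "\<And>s. s \<in> {0..t} \<Longrightarrow> norm (u s) \<le> R" for t
  proof -
    have "((\<lambda>s. - (norm (\<Gamma> (u s)))\<^sup>2) has_integral (E (u t) - E (u 0))) {0..t}"
    proof (rule fundamental_theorem_of_calculus[OF t])
      fix s assume s: "s \<in> {0..t}"
      have us: "(u has_vector_derivative \<Gamma> (u s)) (at s within {0..t})"
        by (rule has_vector_derivative_within_subset[OF u']) (use s in auto)
      have lin: "((\<lambda>\<tau>. - (\<Gamma> (u s) \<bullet> u \<tau>)) has_vector_derivative - (norm (\<Gamma> (u s)))\<^sup>2) (at s within {0..t})"
        using has_vector_derivative_minus[OF has_vector_derivative_inner[OF has_vector_derivative_const[of "\<Gamma> (u s)"] us]]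
        by (simp add: power2_norm_eq_inner)
      \<comment> \<open>\<open>E\<close> is differentiated along u by adding the linear term
        \<open>\<Gamma> (u s) \<bullet> u \<tau>\<close>. What remains is bounded by a multiple of
        \<open>(norm (u \<tau> - u s))\<^sup>2\<close>, hence is of second order in \<tau> - s
        because u has bounded difference quotients at s.\<close>
      have rem: "((\<lambda>\<tau>. E (u \<tau>) + \<Gamma> (u s) \<bullet> u \<tau>) has_vector_derivative 0) (at s within {0..t})"
        unfolding has_vector_derivative_def has_derivative_within'
      proof (intro conjI allI impI)
        show "bounded_linear (\<lambda>x. x *\<^sub>R (0::real))" by simp
        fix e :: real assume e: "0 < e"
        \<comment> \<open>One more than the speed at s; the allowance 1 is the tolerance taken below
          for the difference quotient of u.\<close>
        define B where "B = norm (\<Gamma> (u s)) + 1"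
        have B: "B > 0" by (simp add: B_def add_nonneg_pos)
        obtain \<delta>1 where \<delta>1: "\<delta>1 > 0" "\<And>\<tau>. \<tau> \<in> {0..t} \<Longrightarrow> \<bar>\<tau> - s\<bar> < \<delta>1 \<Longrightarrow> norm (u \<tau> - u s) \<le> B * \<bar>\<tau> - s\<bar>"
        proof -
          obtain d where d: "d > 0" "\<And>\<tau>. \<tau> \<in> {0..t} \<Longrightarrow> 0 < \<bar>\<tau> - s\<bar> \<Longrightarrow> \<bar>\<tau> - s\<bar> < d \<Longrightarrow>
              norm (u \<tau> - u s - (\<tau> - s) *\<^sub>R \<Gamma> (u s)) / \<bar>\<tau> - s\<bar> < 1"
            using us unfolding has_vector_derivative_def has_derivative_within' real_norm_def
            by (metis zero_less_one)
          have "norm (u \<tau> - u s) \<le> B * \<bar>\<tau> - s\<bar>" if "\<tau> \<in> {0..t}" "\<bar>\<tau> - s\<bar> < d" for \<tau>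
          proof (cases "\<tau> = s")
            case False
            then have "norm (u \<tau> - u s - (\<tau> - s) *\<^sub>R \<Gamma> (u s)) < \<bar>\<tau> - s\<bar>"
              using d(2)[OF that(1)] that(2) by (simp add: divide_less_eq)
            then have "norm (u \<tau> - u s) \<le> \<bar>\<tau> - s\<bar> + norm ((\<tau> - s) *\<^sub>R \<Gamma> (u s))"
              using norm_triangle_ineq[of "u \<tau> - u s - (\<tau> - s) *\<^sub>R \<Gamma> (u s)" "(\<tau> - s) *\<^sub>R \<Gamma> (u s)"] by simp
            moreover have "norm ((\<tau> - s) *\<^sub>R \<Gamma> (u s)) = \<bar>\<tau> - s\<bar> * norm (\<Gamma> (u s))" by simp
            ultimately show ?thesis unfolding B_def distrib_right by (simp only: mult_1 mult.commute add.commute)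
          qed simp
          with d(1) that show thesis by blast
        qed
        \<comment> \<open>Makes the quadratic remainder smaller than e times the increment. The
          summand 1 beside \<open>\<bar>K\<bar>\<close> keeps the denominator positive.\<close>
        define \<delta> where "\<delta> = min \<delta>1 (e / ((\<bar>K\<bar> + 1) * B\<^sup>2))"
        have \<delta>: "\<delta> > 0" using \<delta>1(1) e B by (simp add: \<delta>_def add_nonneg_pos)
        show "\<exists>d>0. \<forall>\<tau>\<in>{0..t}. 0 < norm (\<tau> - s) \<and> norm (\<tau> - s) < d \<longrightarrow>
          norm (E (u \<tau>) + \<Gamma> (u s) \<bullet> u \<tau> - (E (u s) + \<Gamma> (u s) \<bullet> u s) - (\<tau> - s) *\<^sub>R 0) / norm (\<tau> - s) < e"
        proof (intro exI[of _ \<delta>] conjI \<delta> ballI impI)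
          fix \<tau> assume \<tau>: "\<tau> \<in> {0..t}" and d: "0 < norm (\<tau> - s) \<and> norm (\<tau> - s) < \<delta>"
          have "\<bar>E (u \<tau>) - E (u s) + \<Gamma> (u s) \<bullet> (u \<tau> - u s)\<bar> \<le> K * (norm (u \<tau> - u s))\<^sup>2"
            using K[OF uH uH ball[OF \<tau>] ball[OF s]] \<tau> s \<Gamma>G[OF uH ball[OF s]] by auto
          also have "\<dots> \<le> (\<bar>K\<bar> + 1) * (B * \<bar>\<tau> - s\<bar>)\<^sup>2"
            using \<delta>1(2)[OF \<tau>] d by (intro mult_mono power_mono) (auto simp: \<delta>_def)
          also have "\<dots> = ((\<bar>K\<bar> + 1) * B\<^sup>2 * \<bar>\<tau> - s\<bar>) * \<bar>\<tau> - s\<bar>"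
            by (simp add: power2_eq_square)
          also have "\<dots> < e * \<bar>\<tau> - s\<bar>"
          proof (rule mult_strict_right_mono)
            have "\<bar>\<tau> - s\<bar> < e / ((\<bar>K\<bar> + 1) * B\<^sup>2)" using d by (simp add: \<delta>_def)
            moreover have "(\<bar>K\<bar> + 1) * B\<^sup>2 > 0" using B by (simp add: add_nonneg_pos)
            ultimately show "(\<bar>K\<bar> + 1) * B\<^sup>2 * \<bar>\<tau> - s\<bar> < e"
              by (simp add: pos_less_divide_eq mult.commute)
          qed (use d in simp)
          finally have "\<bar>E (u \<tau>) + \<Gamma> (u s) \<bullet> u \<tau> - (E (u s) + \<Gamma> (u s) \<bullet> u s)\<bar> < e * \<bar>\<tau> - s\<bar>"
            by (simp add: inner_diff_right algebra_simps)
          then show "norm (E (u \<tau>) + \<Gamma> (u s) \<bullet> u \<tau> - (E (u s) + \<Gamma> (u s) \<bullet> u s) - (\<tau> - s) *\<^sub>R 0) / norm (\<tau> - s) < e"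
            using d by (simp add: divide_less_eq)
        qed
      qed
      show "((\<lambda>\<tau>. E (u \<tau>)) has_vector_derivative - (norm (\<Gamma> (u s)))\<^sup>2) (at s within {0..t})"
        using has_vector_derivative_add[OF rem lin] by simp
    qed
    from has_integral_neg[OF this] show ?thesis by (simp add: u0)
  qed
  have Ebound: "E (u t) < \<alpha>" if t: "0 \<le> t" and ball: "\<And>s. s \<in> {0..t} \<Longrightarrow> norm (u s) \<le> R" for t
    using has_integral_nonneg[OF energy[OF that]] v0(2) by simp
  have \<iota>0: "\<iota> 0 > 0" using v0 R by (simp add: \<iota>_def u0 \<Gamma>G R_def)
  \<comment> \<open>Let t' be the infimum of the times at which the norm exceeds its initial value.
    Up to t' the orbit is in the ball, has energy below \<alpha> and squared norm below \<Lambda>,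
    so \<open>well\<close> forbids a zero of \<open>\<iota>\<close>, which starts positive. Hence
    \<open>\<iota>\<close> is positive at t' and shortly after, the norm does not grow there, and t'
    cannot be the infimum.\<close>
  have norm_le: "norm (u t) \<le> norm v0" if t: "t \<ge> 0" for t
  proof (rule ccontr)
    assume "\<not> norm (u t) \<le> norm v0"
    then have tS: "t \<in> {t. 0 \<le> t \<and> norm (u t) > norm v0}" using t by simp
    define S where "S = {t. 0 \<le> t \<and> norm (u t) > norm v0}"
    have S: "S \<noteq> {}" "bdd_below S" using tS by (auto simp: S_def)
    define t' where "t' = Inf S"
    have t': "0 \<le> t'" unfolding t'_def using S by (intro cInf_greatest) (auto simp: S_def)
    have before: "norm (u s) \<le> norm v0" if "0 \<le> s" "s < t'" for s
    proof (rule ccontr)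
      assume "\<not> norm (u s) \<le> norm v0"
      then have "s \<in> S" using that by (simp add: S_def)
      then have "t' \<le> s" unfolding t'_def using S by (intro cInf_lower) auto
      with that show False by simp
    qed
    have upto: "norm (u s) \<le> norm v0" if s: "s \<in> {0..t'}" for s
    \<comment> \<open>The case t' = 0 is separate because \<open>{0..<t'}\<close> is then empty and
      its closure does not contain t'.\<close>
    proof (cases "s < t' \<or> t' = 0")
      case True
      then show ?thesis using before s u0 by auto
    next
      case False
      then have st: "s = t'" "0 < t'" using s t' by auto
      have "closure {0..<t'} = {0..t'}" using st by simp
      moreover have "norm (u s) \<le> norm v0" if "s \<in> closure {0..<t'}" for s
        by (rule continuous_le_on_closure[of "{0..<t'}" "\<lambda>s. norm (u s)" s "norm v0"])
           (use that before st in \<open>auto intro!: continuous_on_norm continuous_on_subset[OF contu]\<close>)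
      ultimately show ?thesis using s by auto
    qed
    then have ball: "norm (u s) \<le> R" if "s \<in> {0..t'}" for s
      using that by (fastforce simp: R_def)
    have \<iota>pos: "\<iota> t' > 0"
    proof (rule ccontr)
      assume "\<not> \<iota> t' > 0"
      then have "\<exists>s\<ge>0. s \<le> t' \<and> \<iota> s = 0"
        using \<iota>0 t' by (intro IVT2' continuous_on_subset[OF cont\<iota>]) auto
      then obtain s where s: "0 \<le> s" "s \<le> t'" "\<iota> s = 0" by blast
      have "\<Lambda> \<le> (norm (u s))\<^sup>2"
      proof (rule well[OF uH[OF s(1)]])
        show "u s \<noteq> 0" using Npos[OF s(1)] by (auto simp: N_def)
        show "G (u s) \<bullet> u s = 0" using s \<Gamma>G[OF uH[OF s(1)] ball] by (simp add: \<iota>_def)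
        show "E (u s) < \<alpha>" using s by (intro Ebound ball) auto
      qed
      moreover have "(norm (u s))\<^sup>2 \<le> (norm v0)\<^sup>2" using upto[of s] s by (intro power_mono) auto
      ultimately show False using v0(3) by simp
    qed
    have "(\<iota> \<longlongrightarrow> \<iota> t') (at t' within {0..})"
      using cont\<iota> t' by (auto simp: continuous_on_def)
    then have "\<forall>\<^sub>F s in at t' within {0..}. \<iota> s > 0"
      using \<iota>pos by (rule order_tendstoD)
    then obtain \<delta> where \<delta>: "\<delta> > 0" "\<And>s. s \<ge> 0 \<Longrightarrow> s \<noteq> t' \<Longrightarrow> dist s t' < \<delta> \<Longrightarrow> \<iota> s > 0"
      unfolding eventually_at by auto
    have "Inf S < t' + \<delta>" using \<delta> by (simp add: t'_def)
    then obtain s where s: "s \<in> S" "s < t' + \<delta>" using cInf_less_iff[OF S] by blast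
    then have "t' \<le> s" unfolding t'_def using S by (intro cInf_lower) auto
    have "N s \<le> N t'"
    proof (rule DERIV_nonpos_imp_decreasing_open[OF \<open>t' \<le> s\<close>])
      fix x assume x: "t' < x" "x < s"
      then have "\<iota> x > 0" using \<delta>(2)[of x] t' s by (auto simp: dist_real_def)
      then show "\<exists>y. (N has_real_derivative y) (at x) \<and> y \<le> 0"
        using N'[of x] x t' by (intro exI[of _ "- 2 * \<iota> x"]) auto
    next
      show "continuous_on {t'..s} N" using t' by (intro continuous_on_subset[OF contN]) auto
    qed
    then have "norm (u s) \<le> norm (u t')" by (simp add: N_def)
    also have "\<dots> \<le> norm v0" using upto[of t'] t' by simp
    finally show False using s by (simp add: S_def)
  qed
  then have ball: "norm (u t) \<le> R" if "t \<ge> 0" for t using that by (fastforce simp: R_def)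
  have G_eq: "\<Gamma> (u t) = G (u t)" if "t \<ge> 0" for t by (rule \<Gamma>G[OF uH[OF that] ball[OF that]])
  show ?thesis
  proof (intro exI[of _ u] conjI allI impI u0)
    fix t :: real assume t: "t \<ge> 0"
    show "u t \<in> H" "norm (u t) \<le> norm v0" by (rule uH[OF t], rule norm_le[OF t])
    show "(u has_vector_derivative G (u t)) (at t within {0..})" using u'[OF t] G_eq[OF t] by simp
    have "((\<lambda>s. (norm (\<Gamma> (u s)))\<^sup>2) has_integral (E v0 - E (u t))) {0..t}"
      using t ball by (intro energy) auto
    then show "((\<lambda>s. (norm (G (u s)))\<^sup>2) has_integral (E v0 - E (u t))) {0..t}"
      by (rule has_integral_cong[THEN iffD1, rotated]) (simp add: G_eq)
  qed
qed

section \<open>Smooth functions and test functions\<close>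

lemma frechet_derivative_eq: "(f has_derivative f') (at x) \<Longrightarrow> frechet_derivative f (at x) = f'"
  by (rule frechet_derivative_at[symmetric])

lemma C_k_SucI:
  assumes "\<And>x. (f has_derivative D x) (at x)" "\<And>h. C_k k (\<lambda>x. D x h)"
  shows "C_k (Suc k) f"
proof -
  have "frechet_derivative f (at x) = D x" for x
    by (rule frechet_derivative_eq[OF assms(1)])
  then show ?thesis
    using assms by (auto simp: differentiable_def)
qed

lemma C_k_Suc_has_derivative:
  "C_k (Suc k) f \<Longrightarrow> (f has_derivative frechet_derivative f (at x)) (at x)"
  by (simp add: frechet_derivative_works)

lemma C_k_Suc_imp: "C_k (Suc k) f \<Longrightarrow> C_k k f"
proof (induction k arbitrary: f)
  case 0
  then show ?case
    by (auto simp: continuous_on_eq_continuous_at differentiable_imp_continuous_within)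
next
  case (Suc k)
  have "C_k k (\<lambda>x. frechet_derivative f (at x) h)" for h
    using Suc.prems by (intro Suc.IH) simp
  with Suc.prems show ?case by simp
qed

lemma C_k_const [simp]: "C_k k (\<lambda>x. c)"
proof (induction k arbitrary: c)
  case (Suc k)
  show ?case by (rule C_k_SucI[where D="\<lambda>x h. 0"]) (auto intro!: derivative_eq_intros Suc)
qed simp

lemma C_k_add: "C_k k f \<Longrightarrow> C_k k g \<Longrightarrow> C_k k (\<lambda>x. f x + g x)"
proof (induction k arbitrary: f g)
  case (Suc k)
  note d = Suc.prems[THEN C_k_Suc_has_derivative]
  show ?case
    by (rule C_k_SucI[OF has_derivative_add[OF d]]) (use Suc in auto)
qed (auto intro: continuous_intros)

lemma C_k_mult: "C_k k f \<Longrightarrow> C_k k g \<Longrightarrow> C_k k (\<lambda>x. f x * g x)"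
proof (induction k arbitrary: f g)
  case (Suc k)
  note d = Suc.prems[THEN C_k_Suc_has_derivative]
  note l = Suc.prems[THEN C_k_Suc_imp]
  show ?case
    by (rule C_k_SucI[OF has_derivative_mult[OF d]], intro C_k_add Suc.IH l) (use Suc.prems in auto)
qed (auto intro: continuous_intros)

lemma C_k_inner: "C_k k (\<lambda>x. x \<bullet> b)"
proof (cases k)
  case (Suc j)
  show ?thesis unfolding Suc
    by (rule C_k_SucI[where D="\<lambda>x h. h \<bullet> b"]) (auto intro!: derivative_eq_intros)
qed (auto intro!: continuous_intros)

lemma C_k_compose:
  fixes g :: "real \<Rightarrow> real"
  shows "C_k k g \<Longrightarrow> C_k k f \<Longrightarrow> C_k k (\<lambda>x. g (f x))"
proof (induction k arbitrary: f g)
  case 0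
  then show ?case by (auto intro: continuous_on_compose2)
next
  case (Suc k)
  \<comment> \<open>On the line a derivative is multiplication by its value at 1. Only this scalar
    factor is composed with \<open>f\<close>, so the induction hypothesis applies to it.\<close>
  define G where "G y = frechet_derivative g (at y) 1" for y
  have lin: "frechet_derivative g (at y) s = s * G y" for y s
    using linear_frechet_derivative[of g "at y"] linear_scale[of "frechet_derivative g (at y)" s 1] Suc.prems(1)
    by (simp add: G_def)
  have G: "C_k k G" unfolding G_def[abs_def] using Suc.prems by simp
  show ?case
  proof (rule C_k_SucI)
    show "((\<lambda>x. g (f x)) has_derivative (\<lambda>h. frechet_derivative f (at x) h * G (f x))) (at x)" for x
      using has_derivative_compose[OF Suc.prems(2)[THEN C_k_Suc_has_derivative, of x]
          Suc.prems(1)[THEN C_k_Suc_has_derivative, of "f x"]]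
      by (simp add: lin)
    show "C_k k (\<lambda>x. frechet_derivative f (at x) h * G (f x))" for h
      by (rule C_k_mult[OF _ Suc.IH[OF G C_k_Suc_imp[OF Suc.prems(2)]]]) (use Suc.prems(2) in simp)
  qed
qed

lemma C_k_prod:
  assumes "finite A" "\<And>i. i \<in> A \<Longrightarrow> C_k k (f i)"
  shows "C_k k (\<lambda>x. \<Prod>i\<in>A. f i x)"
  using assms by (induction A rule: finite_induct) (auto intro: C_k_mult)

lemma C_k_Suc_real:
  fixes g :: "real \<Rightarrow> real"
  assumes "\<And>x. (g has_real_derivative g' x) (at x)" "C_k k g'"
  shows "C_k (Suc k) g"
  by (rule C_k_SucI[where D="\<lambda>x h. g' x * h"])
     (use assms in \<open>auto simp: has_field_derivative_def intro!: C_k_mult\<close>)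

section \<open>Smooth cutoff functions of boxes\<close>

lemma C_k_exp: "C_k k (exp :: real \<Rightarrow> real)"
proof (induction k)
  case (Suc k)
  show ?case by (rule C_k_Suc_real[OF DERIV_exp Suc])
qed (simp add: continuous_on_exp)

text \<open>The standard flat function exp(-1/x), divided by powers of x so that the family is
  closed under differentiation: the derivative of a member is a combination of members with larger
  m. Smoothness then follows by one induction for all m at once.\<close>

definition flat_exp :: "nat \<Rightarrow> real \<Rightarrow> real" where
  "flat_exp m x = (if x \<le> 0 then 0 else exp (- (1 / x)) / x ^ m)"

lemma flat_exp_tendsto_0: "((\<lambda>x. flat_exp m x) \<longlongrightarrow> 0) (at 0)"
proof -
  have "((\<lambda>x::real. inverse x ^ m / exp (inverse x)) \<longlongrightarrow> 0) (at_right 0)"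
    by (rule filterlim_compose[OF tendsto_power_div_exp_0 filterlim_inverse_at_top_right])
  then have "((\<lambda>x. flat_exp m x) \<longlongrightarrow> 0) (at_right 0)"
  proof (rule Lim_transform_eventually)
    show "\<forall>\<^sub>F x in at_right 0. inverse x ^ m / exp (inverse x) = flat_exp m x"
      unfolding eventually_at_right_field
      by (rule exI[of _ 1]) (auto simp: flat_exp_def exp_minus field_simps)
  qed
  moreover have "((\<lambda>x. flat_exp m x) \<longlongrightarrow> 0) (at_left 0)"
    by (rule Lim_transform_eventually[OF tendsto_const])
       (auto simp: flat_exp_def eventually_at_left_field intro!: exI[of _ "-1"])
  ultimately show ?thesis by (simp add: filterlim_split_at)
qed

lemma flat_exp_has_derivative:
  "(flat_exp m has_real_derivative flat_exp (m + 2) x - real m * flat_exp (Suc m) x) (at x)"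
proof -
  consider "x < 0" | "x = 0" | "x > 0" by linarith
  then show ?thesis
  proof cases
    case 1
    have "((\<lambda>_. 0) has_real_derivative 0) (at x)" by simp
    then have "(flat_exp m has_real_derivative 0) (at x)"
      by (rule has_field_derivative_transform_within_open[of _ _ _ "{..<0}"])
         (use 1 in \<open>auto simp: flat_exp_def\<close>)
    with 1 show ?thesis by (simp add: flat_exp_def)
  next
    case 2
    have "((\<lambda>h. (flat_exp m (0 + h) - flat_exp m 0) / h) \<longlongrightarrow> 0) (at 0)"
      using flat_exp_tendsto_0[of "Suc m"]
      by (rule Lim_transform_eventually) (auto simp: flat_exp_def eventually_at_filter)
    with 2 show ?thesis by (simp add: flat_exp_def DERIV_def)
  next
    case 3
    have "((\<lambda>x. exp (- (1 / x)) / x ^ m) has_real_derivative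
        flat_exp (m + 2) x - real m * flat_exp (Suc m) x) (at x)"
    proof -
      have "((\<lambda>x. exp (- (1 / x)) / x ^ m) has_real_derivative
          (exp (- (1 / x)) * (1 / x\<^sup>2) * x ^ m - exp (- (1 / x)) * (real m * x ^ (m - 1))) / (x ^ m * x ^ m)) (at x)"
        using 3 by (auto intro!: derivative_eq_intros simp: power2_eq_square)
      moreover have "(exp (- (1 / x)) * (1 / x\<^sup>2) * x ^ m - exp (- (1 / x)) * (real m * x ^ (m - 1))) / (x ^ m * x ^ m)
          = flat_exp (m + 2) x - real m * flat_exp (Suc m) x"
        using 3 by (cases m) (simp_all add: flat_exp_def power2_eq_square field_simps)
      ultimately show ?thesis by simp
    qed
    then show ?thesis
      by (rule has_field_derivative_transform_within_open[of _ _ _ "{0<..}"])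
         (use 3 in \<open>auto simp: flat_exp_def\<close>)
  qed
qed

lemma C_k_flat_exp: "C_k k (flat_exp m)"
proof (induction k arbitrary: m)
  case 0
  show ?case
    using DERIV_isCont[OF flat_exp_has_derivative] by (simp add: continuous_at_imp_continuous_on)
next
  case (Suc k)
  have "C_k k (\<lambda>x. flat_exp (m + 2) x + (- real m) * flat_exp (Suc m) x)"
    by (intro C_k_add C_k_mult C_k_const Suc)
  then show ?case by (intro C_k_Suc_real[OF flat_exp_has_derivative]) simp
qed

text \<open>A product of one-dimensional factors, positive exactly on the open box. Differences are
  written as sums and multiples by -1 so that the closure rules of \<open>C_k\<close> apply as they
  stand.\<close>

definition box_bump :: "'a::euclidean_space \<Rightarrow> 'a \<Rightarrow> 'a \<Rightarrow> real" where
  "box_bump a c x = (\<Prod>b\<in>Basis. flat_exp 0 (x \<bullet> b + - (a \<bullet> b)) * flat_exp 0 (c \<bullet> b + - 1 * (x \<bullet> b)))"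

lemma flat_exp_0_pos: "flat_exp 0 x \<ge> 0" "flat_exp 0 x > 0 \<longleftrightarrow> x > 0" "flat_exp 0 x = 0 \<longleftrightarrow> x \<le> 0"
  by (auto simp: flat_exp_def)

lemma box_bump_pos: "x \<in> box a c \<Longrightarrow> box_bump a c x > 0"
  unfolding box_bump_def by (intro prod_pos mult_pos_pos) (auto simp: flat_exp_0_pos mem_box)

lemma box_bump_zero: "x \<notin> box a c \<Longrightarrow> box_bump a c x = 0"
  unfolding box_bump_def by (rule prod_zero) (auto simp: flat_exp_0_pos mem_box not_less)

lemma box_bump_nonneg: "box_bump a c x \<ge> 0"
  using box_bump_pos[of x a c] box_bump_zero[of x a c] by (cases "x \<in> box a c") auto

lemma C_k_box_bump: "C_k k (box_bump a c)"
  unfolding box_bump_def[abs_def]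
  by (intro C_k_prod C_k_mult C_k_compose[OF C_k_flat_exp] C_k_add C_k_inner C_k_const finite_Basis)

text \<open>Composing the bump with 1 - exp(-j s) drives it to the indicator of the open box as j
  grows, while the support stays in the closed box and the values stay in [0, 1]. This supplies
  smooth approximations of indicators without convolution.\<close>

definition box_cutoff :: "'a::euclidean_space \<Rightarrow> 'a \<Rightarrow> nat \<Rightarrow> 'a \<Rightarrow> real" where
  "box_cutoff a c j x = 1 + - 1 * exp (- real j * box_bump a c x)"

lemma box_cutoff_test_function:
  assumes "cbox a c \<subseteq> U" shows "box_cutoff a c j \<in> test_functions U"
proof -
  have "smooth (box_cutoff a c j)"
    unfolding smooth_def box_cutoff_def[abs_def]
    by (intro allI C_k_add C_k_mult C_k_const C_k_compose[OF C_k_exp] C_k_box_bump)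
  moreover have "closure {x. box_cutoff a c j x \<noteq> 0} \<subseteq> cbox a c"
    by (rule closure_minimal)
       (use box_bump_zero[of _ a c] box_subset_cbox[of a c] in \<open>force simp: box_cutoff_def\<close>)+
  moreover from this have "compact (closure {x. box_cutoff a c j x \<noteq> 0})"
    by (metis bounded_cbox bounded_subset closed_closure compact_eq_bounded_closed)
  ultimately show ?thesis using assms by (auto simp: test_functions_def)
qed

lemma box_cutoff_bounds: "0 \<le> box_cutoff a c j x" "box_cutoff a c j x \<le> 1"
  using box_bump_nonneg[of a c x] by (auto simp: box_cutoff_def)

lemma box_cutoff_tendsto: "(\<lambda>j. box_cutoff a c j x) \<longlonglongrightarrow> indicator (box a c) x"
proof (cases "x \<in> box a c")
  case True
  then have "(\<lambda>j. (exp (- box_bump a c x)) ^ j) \<longlonglongrightarrow> 0"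
    by (intro LIMSEQ_realpow_zero) (auto dest: box_bump_pos)
  from tendsto_diff[OF tendsto_const[of 1] this]
  have "(\<lambda>j. 1 - (exp (- box_bump a c x)) ^ j) \<longlonglongrightarrow> 1" by simp
  with True show ?thesis
    by (simp add: box_cutoff_def flip: exp_of_nat_mult)
qed (auto simp: box_cutoff_def box_bump_zero)

section \<open>The fundamental lemma of the calculus of variations\<close>

lemma test_function_continuous: "\<phi> \<in> test_functions U \<Longrightarrow> continuous_on S \<phi>"
  using continuous_on_subset[of UNIV \<phi> S] by (auto simp: test_functions_def smooth_def dest: spec[of _ 0])

lemma test_function_measurable [measurable_dest]:
  "\<phi> \<in> test_functions U \<Longrightarrow> \<phi> \<in> borel_measurable borel"
  by (rule borel_measurable_continuous_onI[OF test_function_continuous])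

text \<open>The cutoffs converge to indicators, so f has integral zero over every box whose closure
  lies in U. Boxes form an intersection-stable generator of the Borel sets, which extends this to
  all measurable subsets of one box and gives f = 0 almost everywhere there. Countably many closed
  boxes cover U.\<close>

theorem fundamental_lemma_calculus_of_variations:
  fixes f :: "'a::euclidean_space \<Rightarrow> real"
  assumes U: "open U" and f: "integrable lebesgue f"
    and zero: "\<And>\<phi>. \<phi> \<in> test_functions U \<Longrightarrow> (\<integral>x. f x * \<phi> x \<partial>lebesgue) = 0"
  shows "AE x in lebesgue. x \<in> U \<longrightarrow> f x = 0"
proof -
  have [measurable]: "f \<in> borel_measurable lebesgue" using f by auto
  have box0: "(\<integral>x. indicator (box a c) x * f x \<partial>lebesgue) = 0" if "cbox a c \<subseteq> U" for a c
  proof -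
    have meas: "box_cutoff a c j \<in> borel_measurable lebesgue" for j
      using test_function_measurable[OF box_cutoff_test_function[OF that]]
      by (simp add: measurable_completion)
    have "(\<lambda>j. \<integral>x. f x * box_cutoff a c j x \<partial>lebesgue) \<longlonglongrightarrow> (\<integral>x. f x * indicator (box a c) x \<partial>lebesgue)"
    proof (rule integral_dominated_convergence[where w="\<lambda>x. \<bar>f x\<bar>"])
      show "AE x in lebesgue. (\<lambda>j. f x * box_cutoff a c j x) \<longlonglongrightarrow> f x * indicator (box a c) x"
        by (intro AE_I2 tendsto_intros box_cutoff_tendsto)
      show "AE x in lebesgue. norm (f x * box_cutoff a c j x) \<le> \<bar>f x\<bar>" for j
        using box_cutoff_bounds[of a c j] by (intro AE_I2) (simp add: abs_mult mult_left_le)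
    next
      have "box a c \<in> sets lebesgue" by auto
      then show "(\<lambda>x. f x * indicator (box a c) x) \<in> borel_measurable lebesgue"
        by (intro borel_measurable_times borel_measurable_indicator) auto
      show "(\<lambda>x. f x * box_cutoff a c j x) \<in> borel_measurable lebesgue" for j
        by (intro borel_measurable_times meas) auto
      show "integrable lebesgue (\<lambda>x. \<bar>f x\<bar>)" using f by (rule integrable_abs)
    qed
    then show ?thesis
      using zero[OF box_cutoff_test_function[OF that]] by (simp add: LIMSEQ_const_iff mult.commute)
  qed
  have box_AE: "AE x in lebesgue. x \<in> cbox a c \<longrightarrow> f x = 0" if ac: "cbox a c \<subseteq> U" for a c
  proof -
    \<comment> \<open>With f cut to one box inside U, the integral of h over any other box is an
      integral of f over the intersection, again a box inside U, to which \<open>box0\<close>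
      applies.\<close>
    define h where "h x = indicator (box a c) x * f x" for x
    have h: "integrable lebesgue h"
      using integrable_mult_indicator[OF _ f, of "box a c"] by (simp add: h_def[abs_def])
    have hA: "set_integrable lebesgue A h" if "A \<in> sets lebesgue" for A
      using integrable_mult_indicator[OF that h] by (simp add: set_integrable_def)
    have borel: "set_lebesgue_integral lebesgue A h = 0" if A: "A \<in> sets borel" for A
    proof -
      have gen: "sigma_sets UNIV (range (\<lambda>(a, b). box a b :: 'a set)) = sets borel"
        by (simp add: borel_eq_box)
      have stable: "Int_stable (range (\<lambda>(a, b). box a b :: 'a set))"
        by (auto simp: Int_stable_def box_Int_box)
      have generators_UNIV: "range (\<lambda>(a, b). box a b :: 'a set) \<subseteq> Pow UNIV" by simp
      have "A \<in> sigma_sets UNIV (range (\<lambda>(a, b). box a b :: 'a set))"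
        using A gen by simp
      from stable generators_UNIV this show ?thesis
      proof (induction rule: sigma_sets_induct_disjoint)
        case (basic A)
        then obtain a' c' where A: "A = box a' c'" by auto
        obtain e g where eg: "box a' c' \<inter> box a c = box e g" by (auto simp: box_Int_box)
        show ?case
        proof (cases "box e g = {}")
          case True
          then have "indicator A x *\<^sub>R h x = 0" for x
            using eg by (auto simp: h_def A indicator_def)
          then show ?thesis unfolding set_lebesgue_integral_def by (simp only: Bochner_Integration.integral_zero)
        next
          case False
          have "box e g \<subseteq> cbox a c" using eg box_subset_cbox by blast
          then have "cbox e g \<subseteq> U"
            using closure_minimal[of "box e g" "cbox a c"] ac closure_box[OF False] by auto
          from box0[OF this] have "(\<integral>x. indicator (box e g) x * f x \<partial>lebesgue) = 0" .
          moreover have "indicator (box e g) x * f x = indicator A x *\<^sub>R h x" for x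
            unfolding eg[symmetric] by (auto simp: h_def A indicator_def)
          ultimately show ?thesis by (simp add: set_lebesgue_integral_def)
        qed
      next
        case (compl A)
        then have A: "A \<in> sets lebesgue" unfolding gen by simp
        have "integral\<^sup>L lebesgue h = 0"
          using box0[OF ac] by (simp add: h_def[abs_def])
        moreover have "set_lebesgue_integral lebesgue (A \<union> (UNIV - A)) h
            = set_lebesgue_integral lebesgue A h + set_lebesgue_integral lebesgue (UNIV - A) h"
          using A by (intro set_integral_Un hA) auto
        ultimately show ?case using compl.IH by (simp add: set_lebesgue_integral_def)
      next
        case (union A)
        then have A: "A i \<in> sets lebesgue" for i unfolding gen by auto
        have "set_lebesgue_integral lebesgue (\<Union>i. A i) h = (\<Sum>i. set_lebesgue_integral lebesgue (A i) h)"
          using union(1) A by (intro lebesgue_integral_countable_add hA) (auto simp: disjoint_family_on_def)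
        then show ?case using union.IH by simp
      qed (auto simp: set_lebesgue_integral_def)
    qed
    have "AE x in lebesgue. h x = 0"
    proof (rule density_unique_real[OF h Bochner_Integration.integrable_zero])
      \<comment> \<open>A Lebesgue measurable set differs from a Borel set by a subset of a Borel
        null set, so the Borel case is enough.\<close>
      fix A :: "'a set" assume "A \<in> sets lebesgue"
      then obtain S N N' where SN: "A = S \<union> N" "N \<subseteq> N'" "N' \<in> null_sets lborel" "S \<in> sets lborel"
        by (rule sets_completionE)
      have "AE x in lebesgue. x \<notin> N'"
        using SN(3) by (intro AE_completion AE_not_in)
      then have "AE x in lebesgue. indicator A x *\<^sub>R h x = indicator S x *\<^sub>R h x"
        by eventually_elim (use SN in \<open>auto simp: indicator_def\<close>)
      then have "set_lebesgue_integral lebesgue A h = set_lebesgue_integral lebesgue S h"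
        unfolding set_lebesgue_integral_def
        using hA[of A] hA[of S] \<open>A \<in> sets lebesgue\<close> SN(4)
        by (intro integral_cong_AE) (auto simp: set_integrable_def)
      then show "set_lebesgue_integral lebesgue A h = set_lebesgue_integral lebesgue A (\<lambda>_. 0)"
        using borel[of S] SN(4) by (simp add: set_lebesgue_integral_def)
    qed
    moreover have "AE x in lebesgue. x \<notin> cbox a c - box a c"
      using negligible_frontier_interval[of a c] by (intro AE_not_in) (simp add: negligible_iff_null_sets)
    ultimately show ?thesis
      by eventually_elim (auto simp: h_def indicator_def split: if_splits)
  qed
  obtain D where D: "countable D" "D \<subseteq> Pow U" "\<And>X. X \<in> D \<Longrightarrow> \<exists>a b. X = cbox a b" "\<Union>D = U"
    using open_countable_Union_open_cbox[OF U] by metis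
  have "AE x in lebesgue. \<forall>X\<in>D. x \<in> X \<longrightarrow> f x = 0"
  proof (rule AE_ball_countable'[OF _ D(1)])
    fix X assume "X \<in> D"
    with D(2,3) box_AE show "AE x in lebesgue. x \<in> X \<longrightarrow> f x = 0" by blast
  qed
  then show ?thesis by eventually_elim (use D(4) in auto)
qed

section \<open>Integration by parts for test functions\<close>

lemma integrable_compactly_supported:
  fixes f :: "'a::euclidean_space \<Rightarrow> 'b::euclidean_space"
  assumes "continuous_on UNIV f" "\<And>x. x \<notin> cball 0 R \<Longrightarrow> f x = 0"
  shows "integrable lborel f"
proof -
  have "integrable lborel (\<lambda>x. indicator (cball 0 R) x *\<^sub>R f x)"
    using assms(1) continuous_on_subset by (intro borel_integrable_compact) auto
  also have "(\<lambda>x. indicator (cball 0 R) x *\<^sub>R f x) = f"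
    using assms(2) by (auto simp: indicator_def fun_eq_iff)
  finally show ?thesis .
qed

lemma frechet_derivative_zero_outside:
  fixes f :: "'a::euclidean_space \<Rightarrow> real"
  assumes "\<And>x. x \<notin> K \<Longrightarrow> f x = 0" "closed K" "x \<notin> K"
  shows "frechet_derivative f (at x) = (\<lambda>h. 0)"
proof (rule frechet_derivative_eq)
  show "(f has_derivative (\<lambda>h. 0)) (at x)"
    by (rule has_derivative_transform_within_open[OF has_derivative_const[of 0], of "- K"])
       (use assms in auto)
qed

lemma lborel_integral_translate:
  fixes f :: "'a::euclidean_space \<Rightarrow> 'b::{banach, second_countable_topology}"
  assumes [measurable]: "f \<in> borel_measurable borel"
  shows "(\<integral>x. f (c + x) \<partial>lborel) = (\<integral>x. f x \<partial>lborel)"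
  by (subst (2) lborel_distr_plus[of c, symmetric]) (simp add: integral_distr)

lemma has_real_derivative_along_line:
  assumes "C_k 1 f"
  shows "((\<lambda>s. f (x + s *\<^sub>R h)) has_real_derivative frechet_derivative f (at (x + s *\<^sub>R h)) h) (at s)"
proof -
  have der: "(f has_derivative frechet_derivative f (at y)) (at y)" for y
    using C_k_Suc_has_derivative[of 0 f y] assms by simp
  have "((\<lambda>s. f (x + s *\<^sub>R h)) has_derivative
      (\<lambda>r. frechet_derivative f (at (x + s *\<^sub>R h)) (r *\<^sub>R h))) (at s)"
    by (rule has_derivative_compose[OF _ der]) (auto intro!: derivative_eq_intros)
  moreover have "frechet_derivative f (at (x + s *\<^sub>R h)) (r *\<^sub>R h) = frechet_derivative f (at (x + s *\<^sub>R h)) h * r" for r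
    using linear_scale[OF has_derivative_linear[OF der]] by (simp add: mult.commute)
  ultimately show ?thesis by (simp add: has_field_derivative_def)
qed

text \<open>The derivative is the limit of difference quotients, whose integrals vanish by
  translation invariance of the measure. The mean value theorem provides the dominating constant. In
  this way every direction h is treated at once, without iterated integrals along coordinate
  axes.\<close>

lemma integral_frechet_derivative_zero:
  fixes f :: "'a::euclidean_space \<Rightarrow> real"
  assumes f: "C_k 1 f" and supp: "\<And>x. x \<notin> cball 0 R \<Longrightarrow> f x = 0"
  shows "(\<integral>x. frechet_derivative f (at x) h \<partial>lborel) = 0"
proof -
  define D where "D x = frechet_derivative f (at x) h" for x
  have contD: "continuous_on UNIV D" using f by (simp add: D_def[abs_def])
  have contf: "continuous_on UNIV f" using C_k_Suc_imp[of 0 f] f by simp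
  have [measurable]: "f \<in> borel_measurable borel" "D \<in> borel_measurable borel"
    using contf contD by (auto intro: borel_measurable_continuous_onI)
  have D0: "D x = 0" if "x \<notin> cball 0 R" for x
    using frechet_derivative_zero_outside[of "cball 0 R" f x] supp that by (simp add: D_def)
  have "bounded (D ` cball 0 R)"
    by (intro compact_imp_bounded compact_continuous_image continuous_on_subset[OF contD]) auto
  then obtain B where B: "B > 0" "\<And>x. x \<in> cball 0 R \<Longrightarrow> \<bar>D x\<bar> \<le> B"
    unfolding bounded_pos by auto
  have DB: "\<bar>D x\<bar> \<le> B" for x using B D0[of x] by (cases "x \<in> cball 0 R") auto
  have line: "((\<lambda>s. f (x + s *\<^sub>R h)) has_real_derivative D (x + s *\<^sub>R h)) (at s)" for x s
    unfolding D_def by (rule has_real_derivative_along_line[OF f])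
  define q where "q j x = real (Suc j) * (f (inverse (real (Suc j)) *\<^sub>R h + x) - f x)" for j x
  have [measurable]: "q j \<in> borel_measurable borel" for j unfolding q_def[abs_def] by measurable
  have int_f: "integrable lborel f" by (rule integrable_compactly_supported[OF contf supp])
  have q0: "(\<integral>x. q j x \<partial>lborel) = 0" for j
  proof -
    define c where "c = inverse (real (Suc j)) *\<^sub>R h"
    have "integrable lborel (\<lambda>x. f (c + x))"
    proof (rule integrable_compactly_supported)
      show "continuous_on UNIV (\<lambda>x. f (c + x))"
        by (intro continuous_on_compose2[OF contf] continuous_intros) auto
      show "f (c + x) = 0" if "x \<notin> cball 0 (R + norm c)" for x
        using norm_triangle_ineq[of "c + x" "- c"] that by (intro supp) auto
    qed
    then show ?thesis
      using int_f unfolding q_def c_def[symmetric]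
      by (simp add: Bochner_Integration.integral_diff lborel_integral_translate)
  qed
  \<comment> \<open>Shifting by at most \<open>norm h\<close> moves the support by no more than
    that, hence the enlarged ball.\<close>
  have q_bound: "\<bar>q j x\<bar> \<le> B * indicator (cball 0 (R + norm h)) x" for j x
  proof -
    define t where "t = inverse (real (Suc j))"
    have t: "0 < t" "t \<le> 1" by (auto simp: t_def inverse_le_1_iff)
    show ?thesis
    proof (cases "x \<in> cball 0 (R + norm h)")
      case True
      obtain z where "f (x + t *\<^sub>R h) - f (x + 0 *\<^sub>R h) = (t - 0) * D (x + z *\<^sub>R h)"
        using MVT2[OF t(1) line] by blast
      then have "q j x = D (x + z *\<^sub>R h)"
        by (simp add: q_def t_def add.commute)
      with True DB show ?thesis by simp
    next
      case False
      have "norm (t *\<^sub>R h) \<le> norm h" using t by (simp add: mult_left_le_one_le)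
      then have "norm (t *\<^sub>R h + x) > R" "norm x > R"
        using False norm_triangle_ineq[of "t *\<^sub>R h + x" "- (t *\<^sub>R h)"] norm_ge_zero[of h]
        unfolding mem_cball dist_0_norm norm_minus_cancel by (simp_all del: norm_ge_zero norm_scaleR)
      then have "q j x = 0" using supp by (simp add: q_def t_def)
      with False show ?thesis by simp
    qed
  qed
  have "(\<lambda>j. \<integral>x. q j x \<partial>lborel) \<longlonglongrightarrow> (\<integral>x. D x \<partial>lborel)"
  proof (rule integral_dominated_convergence[where w="\<lambda>x. B * indicator (cball 0 (R + norm h)) x"])
    show "AE x in lborel. (\<lambda>j. q j x) \<longlonglongrightarrow> D x"
    proof (rule AE_I2)
      fix x
      have "((\<lambda>s. (f (x + s *\<^sub>R h) - f x) / s) \<longlongrightarrow> D x) (at 0)"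
        using line[of x 0] by (simp add: DERIV_def)
      moreover have "filterlim (\<lambda>j. inverse (real (Suc j))) (at 0) sequentially"
        by (rule filterlim_atI[OF LIMSEQ_inverse_real_of_nat]) simp
      ultimately have "((\<lambda>j. (f (x + inverse (real (Suc j)) *\<^sub>R h) - f x) / inverse (real (Suc j))) \<longlongrightarrow> D x) sequentially"
        by (rule filterlim_compose)
      then show "(\<lambda>j. q j x) \<longlonglongrightarrow> D x"
        by (simp add: q_def add.commute divide_inverse mult.commute)
    qed
    show "integrable lborel (\<lambda>x::'a. B * indicator (cball 0 (R + norm h)) x)"
      using emeasure_bounded_finite[of "cball (0::'a) (R + norm h)"]
      by (intro integrable_mult_right integrable_real_indicator) auto
  qed (use q_bound in auto)
  then show ?thesis by (simp add: q0 LIMSEQ_const_iff D_def)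
qed

definition grad :: "('a::euclidean_space \<Rightarrow> real) \<Rightarrow> 'a \<Rightarrow> 'a" where
  "grad \<phi> x = (\<Sum>b\<in>Basis. frechet_derivative \<phi> (at x) b *\<^sub>R b)"

lemma grad_inner_Basis: "b \<in> Basis \<Longrightarrow> grad \<phi> x \<bullet> b = frechet_derivative \<phi> (at x) b"
  by (simp add: grad_def)

lemma test_functionD:
  assumes "\<phi> \<in> test_functions U"
  shows "C_k k \<phi>" "x \<notin> U \<Longrightarrow> \<phi> x = 0" "x \<notin> U \<Longrightarrow> frechet_derivative \<phi> (at x) = (\<lambda>h. 0)"
    "x \<notin> U \<Longrightarrow> grad \<phi> x = 0"
proof -
  show "C_k k \<phi>" using assms by (simp add: test_functions_def smooth_def)
  have sub: "closure {x. \<phi> x \<noteq> 0} \<subseteq> U" using assms by (simp add: test_functions_def)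
  have out: "y \<notin> closure {x. \<phi> x \<noteq> 0} \<Longrightarrow> \<phi> y = 0" for y
    using closure_subset[of "{x. \<phi> x \<noteq> 0}"] by auto
  show "x \<notin> U \<Longrightarrow> \<phi> x = 0" using sub out by blast
  show *: "x \<notin> U \<Longrightarrow> frechet_derivative \<phi> (at x) = (\<lambda>h. 0)"
    using sub by (intro frechet_derivative_zero_outside[OF out closed_closure]) auto
  show "x \<notin> U \<Longrightarrow> grad \<phi> x = 0" by (simp add: grad_def *)
qed

lemma test_function_support:
  assumes "\<phi> \<in> test_functions U"
  obtains R where "\<And>x. x \<notin> cball 0 R \<Longrightarrow> \<phi> x = 0" "\<And>x. x \<notin> cball 0 R \<Longrightarrow> frechet_derivative \<phi> (at x) = (\<lambda>h. 0)"
    "\<And>x. x \<notin> cball 0 R \<Longrightarrow> grad \<phi> x = 0"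
proof -
  have "bounded (closure {x. \<phi> x \<noteq> 0})"
    using assms by (auto simp: test_functions_def intro: compact_imp_bounded)
  then obtain R where R: "closure {x. \<phi> x \<noteq> 0} \<subseteq> cball 0 R"
    by (metis bounded_any_center mem_cball dist_commute subsetI)
  have "\<phi> \<in> test_functions (cball 0 R)" using assms R by (simp add: test_functions_def)
  with that test_functionD show thesis by metis
qed

lemma C_k_imp_continuous: "C_k k f \<Longrightarrow> continuous_on S f"
  by (rule continuous_on_subset[of UNIV], induction k) (simp, metis C_k_Suc_imp, simp)

lemma continuous_frechet_derivative:
  "C_k (Suc k) \<phi> \<Longrightarrow> continuous_on S (\<lambda>x. frechet_derivative \<phi> (at x) h)"
  by (rule C_k_imp_continuous[of k]) simp

lemma continuous_grad: "C_k (Suc k) \<phi> \<Longrightarrow> continuous_on S (grad \<phi>)"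
  unfolding grad_def[abs_def] by (intro continuous_intros continuous_frechet_derivative)

lemma frechet_derivative_C1:
  assumes "C_k 1 \<phi>" "C_k 1 \<psi>"
  shows "frechet_derivative (\<lambda>x. \<phi> x + \<psi> x) (at x) = (\<lambda>h. frechet_derivative \<phi> (at x) h + frechet_derivative \<psi> (at x) h)"
    "frechet_derivative (\<lambda>x. c * \<phi> x) (at x) = (\<lambda>h. c * frechet_derivative \<phi> (at x) h)"
    "frechet_derivative (\<lambda>x. \<phi> x * \<psi> x) (at x) = (\<lambda>h. \<phi> x * frechet_derivative \<psi> (at x) h + frechet_derivative \<phi> (at x) h * \<psi> x)"
proof -
  note d = assms[unfolded One_nat_def, THEN C_k_Suc_has_derivative, of x]
  show "frechet_derivative (\<lambda>x. \<phi> x + \<psi> x) (at x) = (\<lambda>h. frechet_derivative \<phi> (at x) h + frechet_derivative \<psi> (at x) h)"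
    by (rule frechet_derivative_eq[OF has_derivative_add[OF d]])
  show "frechet_derivative (\<lambda>x. c * \<phi> x) (at x) = (\<lambda>h. c * frechet_derivative \<phi> (at x) h)"
    by (rule frechet_derivative_eq[OF has_derivative_mult_right[OF d(1)]])
  show "frechet_derivative (\<lambda>x. \<phi> x * \<psi> x) (at x) = (\<lambda>h. \<phi> x * frechet_derivative \<psi> (at x) h + frechet_derivative \<phi> (at x) h * \<psi> x)"
    by (rule frechet_derivative_eq[OF has_derivative_mult[OF d]])
qed

lemma test_function_add:
  assumes "\<phi> \<in> test_functions U" "\<psi> \<in> test_functions U"
  shows "(\<lambda>x. \<phi> x + \<psi> x) \<in> test_functions U"
proof -
  have "closure {x. \<phi> x + \<psi> x \<noteq> 0} \<subseteq> closure ({x. \<phi> x \<noteq> 0} \<union> {x. \<psi> x \<noteq> 0})"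
    by (rule closure_mono) auto
  then have sub: "closure {x. \<phi> x + \<psi> x \<noteq> 0} \<subseteq> closure {x. \<phi> x \<noteq> 0} \<union> closure {x. \<psi> x \<noteq> 0}"
    by (simp add: closure_Un)
  have "compact (closure {x. \<phi> x \<noteq> 0} \<union> closure {x. \<psi> x \<noteq> 0})"
    using assms by (auto simp: test_functions_def)
  from compact_Int_closed[OF this closed_closure, of "{x. \<phi> x + \<psi> x \<noteq> 0}"] sub
  have "compact (closure {x. \<phi> x + \<psi> x \<noteq> 0})" by (simp add: Int_absorb1)
  with assms sub show ?thesis by (auto simp: test_functions_def smooth_def intro: C_k_add)
qed

lemma test_function_cmult:
  assumes "\<phi> \<in> test_functions U"
  shows "(\<lambda>x. c * \<phi> x) \<in> test_functions U"
proof -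
  have sub: "closure {x. c * \<phi> x \<noteq> 0} \<subseteq> closure {x. \<phi> x \<noteq> 0}"
    by (rule closure_mono) auto
  have "compact (closure {x. \<phi> x \<noteq> 0})" using assms by (auto simp: test_functions_def)
  from compact_Int_closed[OF this closed_closure, of "{x. c * \<phi> x \<noteq> 0}"] sub
  have "compact (closure {x. c * \<phi> x \<noteq> 0})" by (simp add: Int_absorb1)
  with assms sub show ?thesis by (auto simp: test_functions_def smooth_def intro: C_k_mult)
qed

lemma test_function_zero: "(\<lambda>x. 0) \<in> test_functions U"
  by (simp add: test_functions_def smooth_def)

lemma square_integrable_compactly_supported:
  fixes f :: "'a::euclidean_space \<Rightarrow> 'b::euclidean_space"
  assumes "continuous_on UNIV f" "\<And>x. x \<notin> cball 0 R \<Longrightarrow> f x = 0"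
  shows "square_integrable f"
proof -
  have m: "f \<in> borel_measurable borel" by (rule borel_measurable_continuous_onI[OF assms(1)])
  have "integrable lborel (\<lambda>x. (norm (f x))\<^sup>2)"
    by (rule integrable_compactly_supported[of _ R]) (use assms in \<open>auto intro!: continuous_intros\<close>)
  then have "integrable lebesgue (\<lambda>x. (norm (f x))\<^sup>2)"
    using m by (subst integrable_completion) auto
  then show ?thesis using m by (simp add: square_integrable_def measurable_completion)
qed

lemma test_function_integration_by_parts:
  fixes \<phi> \<psi> :: "'a::euclidean_space \<Rightarrow> real"
  assumes \<phi>: "\<phi> \<in> test_functions U" and \<psi>: "\<psi> \<in> test_functions V"
  shows "(\<integral>x. \<phi> x * frechet_derivative \<psi> (at x) h + frechet_derivative \<phi> (at x) h * \<psi> x \<partial>lebesgue) = 0"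
proof -
  note c = test_functionD(1)[OF \<phi>, of 1] test_functionD(1)[OF \<psi>, of 1]
  obtain R where R: "\<And>x. x \<notin> cball 0 R \<Longrightarrow> \<phi> x = 0" using test_function_support[OF \<phi>] by metis
  have "(\<lambda>x. frechet_derivative (\<lambda>x. \<phi> x * \<psi> x) (at x) h) \<in> borel_measurable borel"
    by (intro borel_measurable_continuous_onI continuous_frechet_derivative[of 0])
       (use C_k_mult[OF c] in simp)
  moreover have "(\<integral>x. frechet_derivative (\<lambda>x. \<phi> x * \<psi> x) (at x) h \<partial>lborel) = 0"
    by (rule integral_frechet_derivative_zero[OF C_k_mult[OF c], of R]) (simp add: R)
  ultimately have "(\<integral>x. frechet_derivative (\<lambda>x. \<phi> x * \<psi> x) (at x) h \<partial>lebesgue) = 0"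
    by (subst integral_completion) auto
  then show ?thesis by (simp add: frechet_derivative_C1[OF c])
qed

section \<open>The space \<open>H\<^sub>0\<^sup>1(U)\<close> as a closed subspace\<close>

lemma norm_powr_2: "norm x powr 2 = (norm x)\<^sup>2"
  by (cases "x = 0") auto

lemma Lebesgue_space_2_iff:
  assumes "U \<in> sets lebesgue"
  shows "g \<in> Lebesgue_space 2 U \<longleftrightarrow> square_integrable (\<lambda>x. if x \<in> U then g x else 0)"
proof -
  have "(norm (if x \<in> U then g x else 0))\<^sup>2 = (if x \<in> U then (norm (g x))\<^sup>2 else 0)" for x by simp
  then show ?thesis
    unfolding Lebesgue_space_def square_integrable_def
    by (simp add: norm_powr_2 borel_measurable_if[OF assms] Lebesgue_Measure.integrable_restrict_UNIV[OF assms])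
qed

lemma Lnorm_2_square:
  assumes "U \<in> sets lebesgue"
  shows "(Lnorm 2 U g)\<^sup>2 = (\<integral>x. (norm (if x \<in> U then g x else 0))\<^sup>2 \<partial>lebesgue)"
proof -
  have "(norm (if x \<in> U then g x else 0))\<^sup>2 = (if x \<in> U then (norm (g x))\<^sup>2 else 0)" for x by simp
  then have "(\<integral>x. (norm (if x \<in> U then g x else 0))\<^sup>2 \<partial>lebesgue) = (\<integral>x. (norm (g x))\<^sup>2 \<partial>lebesgue_on U)"
    by (simp add: Lebesgue_Measure.integral_restrict_UNIV[OF assms])
  moreover have "(Lnorm 2 U g)\<^sup>2 = (\<integral>x. (norm (g x))\<^sup>2 \<partial>lebesgue_on U)"
    by (simp add: Lnorm_def norm_powr_2 powr_half_sqrt)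
  ultimately show ?thesis by simp
qed

lemma Lnorm_nonneg: "0 \<le> Lnorm q U g"
  by (simp add: Lnorm_def)

lemma L2_weak_gradient_iff:
  assumes U: "U \<in> sets lebesgue"
  shows "L2_weak_gradient U u G \<longleftrightarrow> G \<in> Lebesgue_space 2 U \<and>
     (\<forall>\<phi>\<in>test_functions U. \<forall>b\<in>Basis.
        (\<integral>x. (if x \<in> U then u x else 0) * frechet_derivative \<phi> (at x) b \<partial>lebesgue) =
        - (\<integral>x. ((if x \<in> U then G x else 0) \<bullet> b) * \<phi> x \<partial>lebesgue))"
proof -
  have "(\<integral>x. (if x \<in> U then u x else 0) * frechet_derivative \<phi> (at x) b \<partial>lebesgue)
      = (\<integral>x. u x * frechet_derivative \<phi> (at x) b \<partial>lebesgue_on U)" for \<phi> b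
    by (subst Lebesgue_Measure.integral_restrict_UNIV[OF U, symmetric], rule Bochner_Integration.integral_cong) auto
  moreover have "(\<integral>x. ((if x \<in> U then G x else 0) \<bullet> b) * \<phi> x \<partial>lebesgue)
      = (\<integral>x. (G x \<bullet> b) * \<phi> x \<partial>lebesgue_on U)" for \<phi> b
    by (subst Lebesgue_Measure.integral_restrict_UNIV[OF U, symmetric], rule Bochner_Integration.integral_cong) auto
  ultimately show ?thesis by (simp add: L2_weak_gradient_def)
qed

text \<open>The last pair encodes the definition of the weak gradient: for h = b, c = b,
  orthogonality of (u, G) to (the b-derivative of \<phi>, \<phi> b) in L^2 is exactly integration by
  parts against \<phi> in the direction b.\<close>

lemma square_integrable_test:
  assumes "\<phi> \<in> test_functions U"
  shows "square_integrable \<phi>" "square_integrable (grad \<phi>)"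
    "square_integrable (\<lambda>x. (\<phi> x, grad \<phi> x))"
    "square_integrable (\<lambda>x. frechet_derivative \<phi> (at x) h)"
    "square_integrable (\<lambda>x. (frechet_derivative \<phi> (at x) h, \<phi> x *\<^sub>R c))"
proof -
  obtain R where R: "\<And>x. x \<notin> cball 0 R \<Longrightarrow> \<phi> x = 0" "\<And>x. x \<notin> cball 0 R \<Longrightarrow> frechet_derivative \<phi> (at x) = (\<lambda>h. 0)"
    "\<And>x. x \<notin> cball 0 R \<Longrightarrow> grad \<phi> x = 0"
    using test_function_support[OF assms] by metis
  note C = C_k_imp_continuous[OF test_functionD(1)[OF assms, of 0]]
    continuous_grad[OF test_functionD(1)[OF assms, of "Suc 0"]]
    continuous_frechet_derivative[OF test_functionD(1)[OF assms, of "Suc 0"]]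
  show "square_integrable \<phi>" "square_integrable (grad \<phi>)"
    "square_integrable (\<lambda>x. (\<phi> x, grad \<phi> x))"
    "square_integrable (\<lambda>x. frechet_derivative \<phi> (at x) h)"
    "square_integrable (\<lambda>x. (frechet_derivative \<phi> (at x) h, \<phi> x *\<^sub>R c))"
    by (rule square_integrable_compactly_supported[of _ R];
        auto simp: R zero_prod_def intro!: continuous_intros C)+
qed

lemma square_integrable_Pair:
  "square_integrable (\<lambda>x. (f x, g x)) \<longleftrightarrow> square_integrable f \<and> square_integrable g"
proof
  assume *: "square_integrable (\<lambda>x. (f x, g x))"
  then have i: "integrable lebesgue (\<lambda>x. (norm (f x))\<^sup>2 + (norm (g x))\<^sup>2)"
    and m: "(\<lambda>x. (f x, g x)) \<in> borel_measurable lebesgue"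
    by (auto simp: square_integrable_def norm_Pair)
  have "f \<in> borel_measurable lebesgue" "g \<in> borel_measurable lebesgue"
    using measurable_compose[OF m borel_measurable_continuous_onI[OF continuous_on_fst[OF continuous_on_id]]]
      measurable_compose[OF m borel_measurable_continuous_onI[OF continuous_on_snd[OF continuous_on_id]]]
    by simp_all
  then show "square_integrable f \<and> square_integrable g"
    by (auto intro!: square_integrable_bound[OF _ i])
next
  assume *: "square_integrable f \<and> square_integrable g"
  have "(\<lambda>x. (f x, g x)) \<in> borel_measurable lebesgue"
    using * by (intro borel_measurable_Pair) (auto simp: square_integrable_def)
  with * show "square_integrable (\<lambda>x. (f x, g x))"
    by (simp add: square_integrable_def norm_Pair)
qed

definition H01_test :: "'a::euclidean_space set \<Rightarrow> ('a, real \<times> 'a) L2fun set" where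
  "H01_test U = (\<lambda>\<phi>. to_L2 (\<lambda>x. (\<phi> x, grad \<phi> x))) ` test_functions U"

text \<open>The closure of the graph of the gradient over test functions. Closedness holds by
  construction; the weak gradient identity and the vanishing outside U are recovered afterwards as
  orthogonality relations.\<close>

definition H01_space :: "'a::euclidean_space set \<Rightarrow> ('a, real \<times> 'a) L2fun set" where
  "H01_space U = closure (H01_test U)"

definition embed :: "'a::euclidean_space set \<Rightarrow> ('a \<Rightarrow> real) \<Rightarrow> ('a, real \<times> 'a) L2fun" where
  "embed U u = to_L2 (\<lambda>x. if x \<in> U then (u x, wgrad U u x) else 0)"

lemma grad_add: "C_k 1 \<phi> \<Longrightarrow> C_k 1 \<psi> \<Longrightarrow> grad (\<lambda>x. \<phi> x + \<psi> x) x = grad \<phi> x + grad \<psi> x"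
  by (simp add: grad_def frechet_derivative_C1 scaleR_left_distrib sum.distrib)

lemma grad_cmult: "C_k 1 \<phi> \<Longrightarrow> grad (\<lambda>x. c * \<phi> x) x = c *\<^sub>R grad \<phi> x"
  by (simp add: grad_def frechet_derivative_C1 scaleR_sum_right)

lemma subspace_H01_test: "subspace (H01_test U)"
proof (rule subspaceI)
  have "to_L2 (\<lambda>x. (0::real, grad (\<lambda>x. 0) x)) = (0 :: ('a, real \<times> 'a) L2fun)"
    using grad_cmult[of "\<lambda>x::'a. 0" 0] by (simp add: zero_L2fun_def zero_prod_def)
  then show "0 \<in> H01_test U"
    unfolding H01_test_def
    by (intro image_eqI[of _ _ "\<lambda>x. 0"] test_function_zero) simp
next
  fix x y assume "x \<in> H01_test U" "y \<in> H01_test U"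
  then obtain \<phi> \<psi> where *: "\<phi> \<in> test_functions U" "\<psi> \<in> test_functions U"
    "x = to_L2 (\<lambda>x. (\<phi> x, grad \<phi> x))" "y = to_L2 (\<lambda>x. (\<psi> x, grad \<psi> x))"
    by (auto simp: H01_test_def)
  have "x + y = to_L2 (\<lambda>x. (\<phi> x + \<psi> x, grad (\<lambda>x. \<phi> x + \<psi> x) x))"
    unfolding * using *(1,2) by (subst to_L2_add) (auto simp: square_integrable_test grad_add[OF test_functionD(1)[OF *(1)] test_functionD(1)[OF *(2)]])
  then show "x + y \<in> H01_test U"
    using test_function_add[OF *(1,2)] by (auto simp: H01_test_def)
next
  fix c x assume "x \<in> H01_test U"
  then obtain \<phi> where *: "\<phi> \<in> test_functions U" "x = to_L2 (\<lambda>x. (\<phi> x, grad \<phi> x))"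
    by (auto simp: H01_test_def)
  have "c *\<^sub>R x = to_L2 (\<lambda>x. (c * \<phi> x, grad (\<lambda>x. c * \<phi> x) x))"
    unfolding * using *(1) by (subst to_L2_scaleR) (auto simp: square_integrable_test grad_cmult[OF test_functionD(1)[OF *(1)]])
  then show "c *\<^sub>R x \<in> H01_test U"
    using test_function_cmult[OF *(1)] by (auto simp: H01_test_def)
qed

lemma subspace_closure_normed:
  fixes S :: "'x::real_normed_vector set"
  assumes S: "subspace S" shows "subspace (closure S)"
proof (rule subspaceI)
  show "0 \<in> closure S" using subspace_0[OF S] closure_subset by blast
  show "x + y \<in> closure S" if xy: "x \<in> closure S" "y \<in> closure S" for x y
  proof -
    obtain X Y where "\<And>n. X n \<in> S" "X \<longlonglongrightarrow> x" "\<And>n. Y n \<in> S" "Y \<longlonglongrightarrow> y"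
      using xy unfolding closure_sequential by blast
    then show ?thesis unfolding closure_sequential
      by (intro exI[of _ "\<lambda>n. X n + Y n"] conjI allI tendsto_add subspace_add[OF S])
  qed
  show "c *\<^sub>R x \<in> closure S" if x: "x \<in> closure S" for c x
  proof -
    obtain X where "\<And>n. X n \<in> S" "X \<longlonglongrightarrow> x" using x unfolding closure_sequential by blast
    then show ?thesis unfolding closure_sequential
      by (intro exI[of _ "\<lambda>n. c *\<^sub>R X n"] conjI allI tendsto_scaleR tendsto_const subspace_scale[OF S])
  qed
qed

lemma subspace_H01_space: "subspace (H01_space U)"
  unfolding H01_space_def by (rule subspace_closure_normed[OF subspace_H01_test])

lemma closed_H01_space: "closed (H01_space U)"
  by (simp add: H01_space_def)

text \<open>Orthogonality to a fixed z is a closed condition, so it passes from test functions to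
  their closure. Both the support in U and the weak gradient identity take this form for a suitable
  z.\<close>

lemma H01_space_orthogonalI:
  assumes h: "h \<in> H01_space U"
    and P: "\<And>\<phi>. \<phi> \<in> test_functions U \<Longrightarrow> to_L2 (\<lambda>x. (\<phi> x, grad \<phi> x)) \<bullet> z = 0"
  shows "h \<bullet> z = 0"
proof -
  have "H01_space U \<subseteq> {h. h \<bullet> z = 0}"
    unfolding H01_space_def
  proof (rule closure_minimal)
    show "closed {h. h \<bullet> z = 0}"
      by (intro closed_Collect_eq continuous_on_inner continuous_on_id continuous_on_const)
  qed (use P in \<open>auto simp: H01_test_def\<close>)
  with h show ?thesis by blast
qed

text \<open>Take for z the part of h outside U. Test pairs vanish there and are orthogonal to it,
  hence so is h; but the inner product of h with z is that of z with itself.\<close>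

lemma H01_space_outside:
  assumes h: "h \<in> H01_space U" and U: "U \<in> sets lebesgue"
  shows "AE x in lebesgue. x \<notin> U \<longrightarrow> of_L2 h x = 0"
proof -
  have sq: "square_integrable (\<lambda>x. if x \<in> U then 0 else of_L2 h x)"
  proof (rule square_integrable_bound[OF _ integrable_of_L2_square[of h]])
    show "(\<lambda>x. if x \<in> U then 0 else of_L2 h x) \<in> borel_measurable lebesgue"
      using U by (intro measurable_If_set) auto
  qed simp
  have "h \<bullet> to_L2 (\<lambda>x. if x \<in> U then 0 else of_L2 h x) = 0"
  proof (rule H01_space_orthogonalI[OF h])
    fix \<phi> assume \<phi>: "\<phi> \<in> test_functions U"
    have "(\<phi> x, grad \<phi> x) \<bullet> (if x \<in> U then 0 else of_L2 h x) = 0" for x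
      using test_functionD(2,4)[OF \<phi>] by (simp flip: zero_prod_def)
    then show "to_L2 (\<lambda>x. (\<phi> x, grad \<phi> x)) \<bullet> to_L2 (\<lambda>x. if x \<in> U then 0 else of_L2 h x) = 0"
      using \<phi> sq by (simp add: inner_to_L2 square_integrable_test)
  qed
  moreover have "h \<bullet> to_L2 (\<lambda>x. if x \<in> U then 0 else of_L2 h x)
      = to_L2 (\<lambda>x. if x \<in> U then 0 else of_L2 h x) \<bullet> to_L2 (\<lambda>x. if x \<in> U then 0 else of_L2 h x)"
    using inner_to_L2[OF square_integrable_of_L2 sq, of h]
    by (simp add: inner_to_L2[OF sq sq]) (rule Bochner_Integration.integral_cong; simp)
  ultimately have "to_L2 (\<lambda>x. if x \<in> U then 0 else of_L2 h x) = to_L2 (\<lambda>x. 0)"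
    by (simp flip: zero_L2fun_def)
  then have "AE x in lebesgue. (if x \<in> U then 0 else of_L2 h x) = 0"
    by (subst (asm) to_L2_eq_iff) (use sq in auto)
  then show ?thesis by eventually_elim auto
qed

lemma H01_space_weak_gradient:
  assumes h: "h \<in> H01_space U" and U: "U \<in> sets lebesgue"
  shows "(\<lambda>x. fst (of_L2 h x)) \<in> Lebesgue_space 2 U"
    "L2_weak_gradient U (\<lambda>x. fst (of_L2 h x)) (\<lambda>x. snd (of_L2 h x))"
proof -
  have sq: "square_integrable (\<lambda>x. fst (of_L2 h x))" "square_integrable (\<lambda>x. snd (of_L2 h x))"
    using square_integrable_of_L2[of h] square_integrable_Pair[of "\<lambda>x. fst (of_L2 h x)" "\<lambda>x. snd (of_L2 h x)"]
    by simp_all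
  have cut: "square_integrable (\<lambda>x. if x \<in> U then f x else 0)" if "square_integrable f" for f :: "'a \<Rightarrow> 'b::euclidean_space"
  proof (rule square_integrable_bound)
    show "(\<lambda>x. if x \<in> U then f x else 0) \<in> borel_measurable lebesgue"
      using U that by (intro measurable_If_set) (auto simp: square_integrable_def)
    show "integrable lebesgue (\<lambda>x. (norm (f x))\<^sup>2)" using that by (simp add: square_integrable_def)
  qed simp
  show "(\<lambda>x. fst (of_L2 h x)) \<in> Lebesgue_space 2 U"
    using cut[OF sq(1)] by (simp add: Lebesgue_space_2_iff[OF U])
  show "L2_weak_gradient U (\<lambda>x. fst (of_L2 h x)) (\<lambda>x. snd (of_L2 h x))"
    unfolding L2_weak_gradient_iff[OF U]
  proof (intro conjI ballI)
    show "(\<lambda>x. snd (of_L2 h x)) \<in> Lebesgue_space 2 U"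
      using cut[OF sq(2)] by (simp add: Lebesgue_space_2_iff[OF U])
    fix \<psi> and b :: 'a assume \<psi>: "\<psi> \<in> test_functions U" and b: "b \<in> Basis"
    note st = square_integrable_test[OF \<psi>]
    have "h \<bullet> to_L2 (\<lambda>x. (frechet_derivative \<psi> (at x) b, \<psi> x *\<^sub>R b)) = 0"
    proof (rule H01_space_orthogonalI[OF h])
      fix \<phi> assume \<phi>: "\<phi> \<in> test_functions U"
      show "to_L2 (\<lambda>x. (\<phi> x, grad \<phi> x)) \<bullet> to_L2 (\<lambda>x. (frechet_derivative \<psi> (at x) b, \<psi> x *\<^sub>R b)) = 0"
        using test_function_integration_by_parts[OF \<phi> \<psi>, of b]
        by (subst inner_to_L2) (simp_all add: square_integrable_test[OF \<phi>] st grad_inner_Basis[OF b] mult.commute)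
    qed
    moreover have "h \<bullet> to_L2 (\<lambda>x. (frechet_derivative \<psi> (at x) b, \<psi> x *\<^sub>R b))
       = (\<integral>x. fst (of_L2 h x) \<bullet> frechet_derivative \<psi> (at x) b + snd (of_L2 h x) \<bullet> (\<psi> x *\<^sub>R b) \<partial>lebesgue)"
      using inner_to_L2[OF square_integrable_of_L2 st(5), of h b b] by (simp add: inner_prod_def)
    moreover have "\<dots> = (\<integral>x. fst (of_L2 h x) \<bullet> frechet_derivative \<psi> (at x) b \<partial>lebesgue)
        + (\<integral>x. snd (of_L2 h x) \<bullet> (\<psi> x *\<^sub>R b) \<partial>lebesgue)"
      using square_integrable_Pair[of "\<lambda>x. frechet_derivative \<psi> (at x) b" "\<lambda>x. \<psi> x *\<^sub>R b"] st(5)[of b b]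
      by (intro Bochner_Integration.integral_add integrable_inner_square_integrable sq) auto
    moreover have "(\<integral>x. fst (of_L2 h x) \<bullet> frechet_derivative \<psi> (at x) b \<partial>lebesgue)
        = (\<integral>x. (if x \<in> U then fst (of_L2 h x) else 0) * frechet_derivative \<psi> (at x) b \<partial>lebesgue)"
      by (rule Bochner_Integration.integral_cong) (auto simp: test_functionD(3)[OF \<psi>])
    moreover have "(\<integral>x. snd (of_L2 h x) \<bullet> (\<psi> x *\<^sub>R b) \<partial>lebesgue)
        = (\<integral>x. ((if x \<in> U then snd (of_L2 h x) else 0) \<bullet> b) * \<psi> x \<partial>lebesgue)"
      by (rule Bochner_Integration.integral_cong) (auto simp: test_functionD(2)[OF \<psi>])
    ultimately show "(\<integral>x. (if x \<in> U then fst (of_L2 h x) else 0) * frechet_derivative \<psi> (at x) b \<partial>lebesgue) =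
        - (\<integral>x. ((if x \<in> U then snd (of_L2 h x) else 0) \<bullet> b) * \<psi> x \<partial>lebesgue)"
      by linarith
  qed
qed

lemma L2_weak_gradient_unique:
  fixes U :: "'a::euclidean_space set"
  assumes U: "open U" "bounded U" and G: "L2_weak_gradient U u G" "L2_weak_gradient U u G'"
  shows "AE x in lebesgue. x \<in> U \<longrightarrow> G x = G' x"
proof -
  have Us: "U \<in> sets lebesgue" using U by auto
  have fin: "emeasure lebesgue U < \<infinity>" using emeasure_bounded_finite[OF U(2)] U(1) by simp
  define E where "E x = (if x \<in> U then G x - G' x else 0)" for x
  have sqG: "square_integrable (\<lambda>x. if x \<in> U then G x else 0)" "square_integrable (\<lambda>x. if x \<in> U then G' x else 0)"
    using G by (auto simp: L2_weak_gradient_def Lebesgue_space_2_iff[OF Us])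
  have E_eq: "E x = (if x \<in> U then G x else 0) - (if x \<in> U then G' x else 0)" for x by (simp add: E_def)
  have sqE: "square_integrable E" unfolding E_eq[abs_def] by (intro square_integrable_diff sqG)
  have "AE x in lebesgue. x \<in> U \<longrightarrow> E x \<bullet> b = 0" if b: "b \<in> Basis" for b
  proof (rule fundamental_lemma_calculus_of_variations[OF U(1)])
    \<comment> \<open>On a bounded U the constant vector b, cut to U, is square integrable. The
      component of \<open>E\<close> along b is then integrable as an inner product, which the
      fundamental lemma requires.\<close>
    have sqb: "square_integrable (\<lambda>x. if x \<in> U then b else 0)"
      unfolding square_integrable_def
    proof
      show "(\<lambda>x. if x \<in> U then b else 0) \<in> borel_measurable lebesgue"
        using Us by (intro measurable_If_set) auto
      have "integrable lebesgue (\<lambda>x. indicator U x :: real)"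
        using Us fin by (intro integrable_real_indicator) auto
      moreover have "(norm (if x \<in> U then b else 0))\<^sup>2 = indicator U x" for x
        using b by (simp add: indicator_def)
      ultimately show "integrable lebesgue (\<lambda>x. (norm (if x \<in> U then b else 0))\<^sup>2)" by simp
    qed
    have "E x \<bullet> (if x \<in> U then b else 0) = E x \<bullet> b" for x by (simp add: E_def)
    then show "integrable lebesgue (\<lambda>x. E x \<bullet> b)"
      using integrable_inner_square_integrable[OF sqE sqb] by simp
    fix \<phi> assume \<phi>: "\<phi> \<in> test_functions U"
    have i: "integrable lebesgue (\<lambda>x. (F x \<bullet> b) * \<phi> x)" if "square_integrable F" for F :: "'a \<Rightarrow> 'a"
    proof -
      have "square_integrable (\<lambda>x. \<phi> x *\<^sub>R b)"
        using square_integrable_test(5)[OF \<phi>, of b b] by (simp add: square_integrable_Pair)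
      from integrable_inner_square_integrable[OF that this] show ?thesis by (simp add: mult.commute)
    qed
    have "(\<integral>x. (E x \<bullet> b) * \<phi> x \<partial>lebesgue) = (\<integral>x. ((if x \<in> U then G x else 0) \<bullet> b) * \<phi> x \<partial>lebesgue)
        - (\<integral>x. ((if x \<in> U then G' x else 0) \<bullet> b) * \<phi> x \<partial>lebesgue)"
      unfolding E_eq inner_diff_left left_diff_distrib
      by (intro Bochner_Integration.integral_diff i sqG)
    also have "\<dots> = 0"
      using G \<phi> b by (auto simp: L2_weak_gradient_iff[OF Us])
    finally show "(\<integral>x. (E x \<bullet> b) * \<phi> x \<partial>lebesgue) = 0" .
  qed
  then have "AE x in lebesgue. \<forall>b\<in>Basis. x \<in> U \<longrightarrow> E x \<bullet> b = 0"
    by (intro AE_finite_allI) auto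
  then show ?thesis
  proof eventually_elim
    case (elim x)
    then show ?case by (auto simp: E_def intro: euclidean_eqI[of "G x" "G' x"] simp: inner_diff_left)
  qed
qed

lemma wgrad_AE_eq:
  assumes U: "open U" "bounded U" and G: "L2_weak_gradient U u G"
  shows "L2_weak_gradient U u (wgrad U u)" "AE x in lebesgue. x \<in> U \<longrightarrow> wgrad U u x = G x"
proof -
  show w: "L2_weak_gradient U u (wgrad U u)"
    unfolding wgrad_def using someI[of "L2_weak_gradient U u", OF G] .
  show "AE x in lebesgue. x \<in> U \<longrightarrow> wgrad U u x = G x"
    by (rule L2_weak_gradient_unique[OF U w G])
qed

lemma square_integrable_cut:
  fixes f :: "'a::euclidean_space \<Rightarrow> 'b::euclidean_space"
  assumes U: "U \<in> sets lebesgue" and f: "square_integrable f"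
  shows "square_integrable (\<lambda>x. if x \<in> U then f x else 0)"
proof (rule square_integrable_bound)
  show "(\<lambda>x. if x \<in> U then f x else 0) \<in> borel_measurable lebesgue"
    using U f by (intro measurable_If_set) (auto simp: square_integrable_def)
  show "integrable lebesgue (\<lambda>x. (norm (f x))\<^sup>2)" using f by (simp add: square_integrable_def)
qed simp

section \<open>Value and gradient components of a pair\<close>

definition fstL :: "('a::euclidean_space, 'b::euclidean_space \<times> 'c::euclidean_space) L2fun \<Rightarrow> ('a, 'b) L2fun" where
  "fstL x = to_L2 (\<lambda>t. fst (of_L2 x t))"

definition sndL :: "('a::euclidean_space, 'b::euclidean_space \<times> 'c::euclidean_space) L2fun \<Rightarrow> ('a, 'c) L2fun" where
  "sndL x = to_L2 (\<lambda>t. snd (of_L2 x t))"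

lemma square_integrable_fst_snd [simp]:
  "square_integrable (\<lambda>t. fst (of_L2 x t))" "square_integrable (\<lambda>t. snd (of_L2 x t))"
  using square_integrable_of_L2[of x] square_integrable_Pair[of "\<lambda>t. fst (of_L2 x t)" "\<lambda>t. snd (of_L2 x t)"]
  by simp_all

lemma of_L2_fstL: "AE t in lebesgue. of_L2 (fstL x) t = fst (of_L2 x t)"
  unfolding fstL_def by (rule of_L2_to_L2) simp

lemma of_L2_sndL: "AE t in lebesgue. of_L2 (sndL x) t = snd (of_L2 x t)"
  unfolding sndL_def by (rule of_L2_to_L2) simp

lemma fstL_to_L2: "square_integrable (\<lambda>t. (f t, g t)) \<Longrightarrow> fstL (to_L2 (\<lambda>t. (f t, g t))) = to_L2 f"
  unfolding fstL_def by (subst to_L2_eq_iff, simp, simp add: square_integrable_Pair, drule of_L2_to_L2) (auto elim: eventually_mono)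

lemma sndL_to_L2: "square_integrable (\<lambda>t. (f t, g t)) \<Longrightarrow> sndL (to_L2 (\<lambda>t. (f t, g t))) = to_L2 g"
  unfolding sndL_def by (subst to_L2_eq_iff, simp, simp add: square_integrable_Pair, drule of_L2_to_L2) (auto elim: eventually_mono)

lemma inner_fstL_sndL: "x \<bullet> y = fstL x \<bullet> fstL y + sndL x \<bullet> sndL y"
proof -
  have "x \<bullet> y = (\<integral>t. fst (of_L2 x t) \<bullet> fst (of_L2 y t) + snd (of_L2 x t) \<bullet> snd (of_L2 y t) \<partial>lebesgue)"
    by (simp add: inner_L2fun_def inner_prod_def)
  also have "\<dots> = fstL x \<bullet> fstL y + sndL x \<bullet> sndL y"
    unfolding fstL_def sndL_def
    by (subst Bochner_Integration.integral_add) (simp_all add: inner_to_L2 integrable_inner_square_integrable)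
  finally show ?thesis .
qed

lemma bounded_linear_fstL: "bounded_linear fstL"
proof (rule bounded_linear_intro[where K=1])
  show "fstL (x + y) = fstL x + fstL y" for x y :: "('a, 'b \<times> 'c) L2fun"
    by (rule L2_eqI, use of_L2_fstL[of x] of_L2_fstL[of y] of_L2_fstL[of "x + y"] of_L2_add[of x y]
        of_L2_add[of "fstL x" "fstL y"] in \<open>eventually_elim, simp\<close>)
  show "fstL (c *\<^sub>R x) = c *\<^sub>R fstL x" for c and x :: "('a, 'b \<times> 'c) L2fun"
    by (rule L2_eqI, use of_L2_fstL[of x] of_L2_fstL[of "c *\<^sub>R x"] of_L2_scaleR[of c x]
        of_L2_scaleR[of c "fstL x"] in \<open>eventually_elim, simp\<close>)
  show "norm (fstL x) \<le> norm x * 1" for x :: "('a, 'b \<times> 'c) L2fun"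
    using inner_fstL_sndL[of x x] by (simp add: norm_eq_sqrt_inner)
qed

lemma bounded_linear_sndL: "bounded_linear sndL"
proof (rule bounded_linear_intro[where K=1])
  show "sndL (x + y) = sndL x + sndL y" for x y :: "('a, 'b \<times> 'c) L2fun"
    by (rule L2_eqI, use of_L2_sndL[of x] of_L2_sndL[of y] of_L2_sndL[of "x + y"] of_L2_add[of x y]
        of_L2_add[of "sndL x" "sndL y"] in \<open>eventually_elim, simp\<close>)
  show "sndL (c *\<^sub>R x) = c *\<^sub>R sndL x" for c and x :: "('a, 'b \<times> 'c) L2fun"
    by (rule L2_eqI, use of_L2_sndL[of x] of_L2_sndL[of "c *\<^sub>R x"] of_L2_scaleR[of c x]
        of_L2_scaleR[of c "sndL x"] in \<open>eventually_elim, simp\<close>)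
  show "norm (sndL x) \<le> norm x * 1" for x :: "('a, 'b \<times> 'c) L2fun"
    using inner_fstL_sndL[of x x] by (simp add: norm_eq_sqrt_inner)
qed

lemmas sndL_add = linear_add[OF bounded_linear.linear[OF bounded_linear_sndL]]
  and sndL_diff = linear_diff[OF bounded_linear.linear[OF bounded_linear_sndL]]
  and sndL_scaleR = linear_scale[OF bounded_linear.linear[OF bounded_linear_sndL]]

lemma norm_fstL_le: "norm (fstL x) \<le> norm x"
  using inner_fstL_sndL[of x x] by (simp add: norm_eq_sqrt_inner)

lemma norm_sndL_le: "norm (sndL x) \<le> norm x"
  using inner_fstL_sndL[of x x] by (simp add: norm_eq_sqrt_inner)

lemma L2_weak_gradient_diff:
  assumes U: "U \<in> sets lebesgue"
    and u: "u \<in> Lebesgue_space 2 U" "v \<in> Lebesgue_space 2 U"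
    and G: "L2_weak_gradient U u G" "L2_weak_gradient U v G'"
  shows "(\<lambda>x. u x - v x) \<in> Lebesgue_space 2 U" "L2_weak_gradient U (\<lambda>x. u x - v x) (\<lambda>x. G x - G' x)"
proof -
  have eq: "(if x \<in> U then f x - g x else 0) = (if x \<in> U then f x else 0) - (if x \<in> U then g x else 0)"
    for x and f g :: "'a \<Rightarrow> 'b::real_vector" by simp
  note sq = u[unfolded Lebesgue_space_2_iff[OF U]]
  have sG: "square_integrable (\<lambda>x. if x \<in> U then G x else 0)" "square_integrable (\<lambda>x. if x \<in> U then G' x else 0)"
    using G by (auto simp: L2_weak_gradient_iff[OF U] Lebesgue_space_2_iff[OF U])
  show "(\<lambda>x. u x - v x) \<in> Lebesgue_space 2 U"
    unfolding Lebesgue_space_2_iff[OF U] eq by (intro square_integrable_diff sq)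
  show "L2_weak_gradient U (\<lambda>x. u x - v x) (\<lambda>x. G x - G' x)"
    unfolding L2_weak_gradient_iff[OF U] Lebesgue_space_2_iff[OF U] eq
  proof (intro conjI ballI square_integrable_diff sG)
    fix \<phi> and b :: 'a assume \<phi>: "\<phi> \<in> test_functions U" and b: "b \<in> Basis"
    have i: "integrable lebesgue (\<lambda>x. (F x \<bullet> b) * \<phi> x)" if "square_integrable F" for F :: "'a \<Rightarrow> 'a"
    proof -
      have "square_integrable (\<lambda>x. \<phi> x *\<^sub>R b)"
        using square_integrable_test(5)[OF \<phi>, of b b] by (simp add: square_integrable_Pair)
      from integrable_inner_square_integrable[OF that this] show ?thesis by (simp add: mult.commute)
    qed
    have j: "integrable lebesgue (\<lambda>x. f x * frechet_derivative \<phi> (at x) b)" if "square_integrable f" for f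
      using integrable_inner_square_integrable[OF that square_integrable_test(4)[OF \<phi>, of b]] by simp
    show "(\<integral>x. ((if x \<in> U then u x else 0) - (if x \<in> U then v x else 0)) * frechet_derivative \<phi> (at x) b \<partial>lebesgue)
       = - (\<integral>x. ((if x \<in> U then G x else 0) - (if x \<in> U then G' x else 0)) \<bullet> b * \<phi> x \<partial>lebesgue)"
      unfolding inner_diff_left left_diff_distrib
      using G \<phi> b
      by (simp add: Bochner_Integration.integral_diff i j sq sG L2_weak_gradient_iff[OF U])
  qed
qed

lemma L2_weak_gradient_test:
  assumes U: "U \<in> sets lebesgue" and \<phi>: "\<phi> \<in> test_functions U"
  shows "\<phi> \<in> Lebesgue_space 2 U" "L2_weak_gradient U \<phi> (grad \<phi>)"
proof -
  have eq: "(if x \<in> U then \<phi> x else 0) = \<phi> x" "(if x \<in> U then grad \<phi> x else 0) = grad \<phi> x" for x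
    by (auto simp: test_functionD[OF \<phi>])
  show "\<phi> \<in> Lebesgue_space 2 U"
    by (simp add: Lebesgue_space_2_iff[OF U] eq square_integrable_test[OF \<phi>])
  show "L2_weak_gradient U \<phi> (grad \<phi>)"
    unfolding L2_weak_gradient_iff[OF U] eq Lebesgue_space_2_iff[OF U]
  proof (intro conjI ballI square_integrable_test[OF \<phi>])
    fix \<psi> and b :: 'a assume \<psi>: "\<psi> \<in> test_functions U" and b: "b \<in> Basis"
    have "(\<integral>x. \<phi> x * frechet_derivative \<psi> (at x) b \<partial>lebesgue) + (\<integral>x. frechet_derivative \<phi> (at x) b * \<psi> x \<partial>lebesgue) = 0"
      using test_function_integration_by_parts[OF \<phi> \<psi>, of b]
        integrable_inner_square_integrable[OF square_integrable_test(1)[OF \<phi>] square_integrable_test(4)[OF \<psi>, of b]]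
        integrable_inner_square_integrable[OF square_integrable_test(4)[OF \<phi>, of b] square_integrable_test(1)[OF \<psi>]]
      by (subst Bochner_Integration.integral_add[symmetric]) simp_all
    then show "(\<integral>x. \<phi> x * frechet_derivative \<psi> (at x) b \<partial>lebesgue) = - (\<integral>x. grad \<phi> x \<bullet> b * \<psi> x \<partial>lebesgue)"
      by (simp add: grad_inner_Basis[OF b])
  qed
qed

section \<open>Identification of \<open>H01 U\<close> with the closed subspace\<close>

context
  fixes U :: "'a::euclidean_space set"
  assumes U: "open U" "bounded U"
begin

lemma U_sets: "U \<in> sets lebesgue"
  using U by auto

lemma H1_weak_gradient: "u \<in> H1 U \<Longrightarrow> L2_weak_gradient U u (wgrad U u)"
  using wgrad_AE_eq(1)[OF U] by (auto simp: H1_def)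

lemma square_integrable_embed:
  assumes "u \<in> H1 U"
  shows "square_integrable (\<lambda>x. if x \<in> U then (u x, wgrad U u x) else 0)"
    "square_integrable (\<lambda>x. if x \<in> U then u x else 0)"
    "square_integrable (\<lambda>x. if x \<in> U then wgrad U u x else 0)"
proof -
  show *: "square_integrable (\<lambda>x. if x \<in> U then u x else 0)"
    "square_integrable (\<lambda>x. if x \<in> U then wgrad U u x else 0)"
    using assms H1_weak_gradient[OF assms]
    by (auto simp: H1_def Lebesgue_space_2_iff[OF U_sets] L2_weak_gradient_iff[OF U_sets])
  have "(if x \<in> U then (u x, wgrad U u x) else 0) = (if x \<in> U then u x else 0, if x \<in> U then wgrad U u x else 0)" for x
    by (simp add: zero_prod_def)
  with * show "square_integrable (\<lambda>x. if x \<in> U then (u x, wgrad U u x) else 0)"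
    by (simp add: square_integrable_Pair)
qed

lemma embed_alt: "embed U u = to_L2 (\<lambda>x. (if x \<in> U then u x else 0, if x \<in> U then wgrad U u x else 0))"
  unfolding embed_def by (rule arg_cong[of _ _ to_L2]) (auto simp: zero_prod_def)

lemma fstL_embed: "u \<in> H1 U \<Longrightarrow> fstL (embed U u) = to_L2 (\<lambda>x. if x \<in> U then u x else 0)"
  unfolding embed_alt by (rule fstL_to_L2) (simp add: square_integrable_Pair square_integrable_embed)

lemma sndL_embed: "u \<in> H1 U \<Longrightarrow> sndL (embed U u) = to_L2 (\<lambda>x. if x \<in> U then wgrad U u x else 0)"
  unfolding embed_alt by (rule sndL_to_L2) (simp add: square_integrable_Pair square_integrable_embed)

lemma Lnorm_fstL: "u \<in> H1 U \<Longrightarrow> Lnorm 2 U u = norm (fstL (embed U u))"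
  by (rule power2_eq_imp_eq[OF _ Lnorm_nonneg norm_ge_zero])
     (simp add: Lnorm_2_square[OF U_sets] fstL_embed norm_to_L2_square square_integrable_embed)

lemma Lnorm_sndL: "u \<in> H1 U \<Longrightarrow> Lnorm 2 U (wgrad U u) = norm (sndL (embed U u))"
  by (rule power2_eq_imp_eq[OF _ Lnorm_nonneg norm_ge_zero])
     (simp add: Lnorm_2_square[OF U_sets] sndL_embed norm_to_L2_square square_integrable_embed)

lemma H1norm_embed: "u \<in> H1 U \<Longrightarrow> H1norm U u = norm (embed U u)"
  using inner_fstL_sndL[of "embed U u" "embed U u"]
  by (simp add: H1norm_def Lnorm_fstL Lnorm_sndL norm_eq_sqrt_inner)

lemma inner_L2_integral: "Defs.inner_L2 U f g = (\<integral>x. (if x \<in> U then f x else 0) \<bullet> (if x \<in> U then g x else 0) \<partial>lebesgue)"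
proof -
  have "(if x \<in> U then f x else 0) \<bullet> (if x \<in> U then g x else 0) = (if x \<in> U then f x \<bullet> g x else 0)" for x by simp
  then show ?thesis by (simp add: Defs.inner_L2_def Lebesgue_Measure.integral_restrict_UNIV[OF U_sets])
qed

lemma inner_L2_fstL:
  "u \<in> H1 U \<Longrightarrow> w \<in> Lebesgue_space 2 U \<Longrightarrow>
    Defs.inner_L2 U u w = fstL (embed U u) \<bullet> to_L2 (\<lambda>x. if x \<in> U then w x else 0)"
  by (simp add: inner_L2_integral fstL_embed inner_to_L2 square_integrable_embed Lebesgue_space_2_iff[OF U_sets])

lemma inner_L2_sndL:
  "u \<in> H1 U \<Longrightarrow> w \<in> H1 U \<Longrightarrow>
    Defs.inner_L2 U (wgrad U u) (wgrad U w) = sndL (embed U u) \<bullet> sndL (embed U w)"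
  by (simp add: inner_L2_integral sndL_embed inner_to_L2 square_integrable_embed)

text \<open>By uniqueness any weak gradient may stand in for the chosen \<open>wgrad U u\<close>,
  since the two give the same class. Embeddings can thus be computed from an explicit
  gradient.\<close>

lemma embed_eqI:
  assumes G: "u \<in> Lebesgue_space 2 U" "L2_weak_gradient U u G"
  shows "u \<in> H1 U" "embed U u = to_L2 (\<lambda>x. (if x \<in> U then u x else 0, if x \<in> U then G x else 0))"
proof -
  show u: "u \<in> H1 U" using G by (auto simp: H1_def)
  have "square_integrable (\<lambda>x. if x \<in> U then G x else 0)"
    using G(2) by (simp add: L2_weak_gradient_iff[OF U_sets] Lebesgue_space_2_iff[OF U_sets])
  then show "embed U u = to_L2 (\<lambda>x. (if x \<in> U then u x else 0, if x \<in> U then G x else 0))"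
    unfolding embed_alt using wgrad_AE_eq(2)[OF U G(2)]
    by (subst to_L2_eq_iff) (auto simp: square_integrable_Pair square_integrable_embed[OF u] elim: eventually_mono)
qed

lemma embed_test:
  assumes \<phi>: "\<phi> \<in> test_functions U"
  shows "\<phi> \<in> H1 U" "embed U \<phi> = to_L2 (\<lambda>x. (\<phi> x, grad \<phi> x))"
proof -
  note e = embed_eqI[OF L2_weak_gradient_test[OF U_sets \<phi>]]
  show "\<phi> \<in> H1 U" by (rule e)
  have "(if x \<in> U then \<phi> x else 0, if x \<in> U then grad \<phi> x else 0) = (\<phi> x, grad \<phi> x)" for x
    by (auto simp: test_functionD[OF \<phi>])
  then show "embed U \<phi> = to_L2 (\<lambda>x. (\<phi> x, grad \<phi> x))" unfolding e by simp
qed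

lemma embed_diff:
  assumes u: "u \<in> H1 U" and v: "v \<in> H1 U"
  shows "(\<lambda>x. u x - v x) \<in> H1 U" "embed U (\<lambda>x. u x - v x) = embed U u - embed U v"
proof -
  have L: "u \<in> Lebesgue_space 2 U" "v \<in> Lebesgue_space 2 U" using u v by (auto simp: H1_def)
  note e = embed_eqI[OF L2_weak_gradient_diff[OF U_sets L H1_weak_gradient[OF u] H1_weak_gradient[OF v]]]
  show "(\<lambda>x. u x - v x) \<in> H1 U" by (rule e)
  show "embed U (\<lambda>x. u x - v x) = embed U u - embed U v"
    unfolding e(2) embed_alt
    by (subst to_L2_diff) (auto simp: square_integrable_Pair square_integrable_embed u v intro!: arg_cong[of _ _ to_L2])
qed

text \<open>With \<open>embed_H01\<close> this gives both directions of the identification. On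
  differences from test functions \<open>H1norm\<close> is the distance of the embeddings, so
  approximability by test functions and membership in the closure are the same condition.\<close>

lemma H01_space_embed:
  assumes h: "h \<in> H01_space U"
  shows "(\<lambda>x. fst (of_L2 h x)) \<in> H01 U" "embed U (\<lambda>x. fst (of_L2 h x)) = h"
proof -
  note e = embed_eqI[OF H01_space_weak_gradient[OF h U_sets]]
  have cut: "square_integrable (\<lambda>x. if x \<in> U then fst (of_L2 h x) else 0)"
    "square_integrable (\<lambda>x. if x \<in> U then snd (of_L2 h x) else 0)"
    by (intro square_integrable_cut[OF U_sets] square_integrable_fst_snd)+
  have "to_L2 (\<lambda>x. (if x \<in> U then fst (of_L2 h x) else 0, if x \<in> U then snd (of_L2 h x) else 0)) = to_L2 (of_L2 h)"
    using H01_space_outside[OF h U_sets]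
    by (subst to_L2_eq_iff) (auto simp: square_integrable_Pair cut zero_prod_def prod_eq_iff elim!: eventually_mono)
  then show eh: "embed U (\<lambda>x. fst (of_L2 h x)) = h" unfolding e by simp
  show "(\<lambda>x. fst (of_L2 h x)) \<in> H01 U"
    unfolding H01_def
  proof (intro CollectI conjI allI impI)
    show "(\<lambda>x. fst (of_L2 h x)) \<in> H1 U" by (rule e)
    fix \<epsilon> :: real assume "\<epsilon> > 0"
    then obtain y where "y \<in> H01_test U" "dist y h < \<epsilon>"
      using h unfolding H01_space_def closure_approachable by blast
    then obtain \<phi> where \<phi>: "\<phi> \<in> test_functions U" "norm (h - to_L2 (\<lambda>x. (\<phi> x, grad \<phi> x))) < \<epsilon>"
      by (auto simp: H01_test_def dist_norm norm_minus_commute)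
    show "\<exists>\<phi>\<in>test_functions U. H1norm U (\<lambda>x. fst (of_L2 h x) - \<phi> x) < \<epsilon>"
      using \<phi> embed_diff[OF e(1) embed_test(1)[OF \<phi>(1)]]
      by (intro bexI[OF _ \<phi>(1)]) (simp add: H1norm_embed eh embed_test(2))
  qed
qed

lemma embed_H01:
  assumes u: "u \<in> H01 U"
  shows "embed U u \<in> H01_space U"
  unfolding H01_space_def closure_approachable
proof (intro allI impI)
  fix \<epsilon> :: real assume "\<epsilon> > 0"
  then obtain \<phi> where \<phi>: "\<phi> \<in> test_functions U" "H1norm U (\<lambda>x. u x - \<phi> x) < \<epsilon>" and uH: "u \<in> H1 U"
    using u by (auto simp: H01_def)
  note d = embed_diff[OF uH embed_test(1)[OF \<phi>(1)]]
  have "dist (to_L2 (\<lambda>x. (\<phi> x, grad \<phi> x))) (embed U u) < \<epsilon>"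
    using \<phi>(2) unfolding H1norm_embed[OF d(1)] d(2) embed_test(2)[OF \<phi>(1)]
    by (simp add: dist_norm norm_minus_commute)
  then show "\<exists>y\<in>H01_test U. dist y (embed U u) < \<epsilon>"
    using \<phi>(1) by (auto simp: H01_test_def)
qed

lemma H01_imp_H1: "u \<in> H01 U \<Longrightarrow> u \<in> H1 U"
  by (simp add: H01_def)

lemma of_L2_embed:
  "u \<in> H1 U \<Longrightarrow> AE x in lebesgue. of_L2 (embed U u) x = (if x \<in> U then (u x, wgrad U u x) else 0)"
  unfolding embed_def by (rule of_L2_to_L2[OF square_integrable_embed(1)])

end

section \<open>The subcritical Sobolev inequality\<close>

lemma grad_inner:
  assumes "C_k 1 \<phi>" shows "grad \<phi> x \<bullet> h = frechet_derivative \<phi> (at x) h"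
proof -
  interpret linear "frechet_derivative \<phi> (at x)"
    using assms by (intro linear_frechet_derivative) simp
  have "frechet_derivative \<phi> (at x) h = frechet_derivative \<phi> (at x) (\<Sum>b\<in>Basis. (h \<bullet> b) *\<^sub>R b)"
    by (simp add: euclidean_representation)
  also have "\<dots> = grad \<phi> x \<bullet> h"
    unfolding sum scale grad_def inner_sum_left
    by (rule sum.cong) (simp_all add: inner_commute)
  finally show ?thesis by simp
qed

text \<open>The fundamental theorem of calculus on the segment from x to x + h, at whose far end
  \<phi> vanishes. A nonnegative integral is used so that the later interchanges of integrals need
  no integrability.\<close>

lemma line_integral_bound:
  fixes \<phi> :: "'a::euclidean_space \<Rightarrow> real"
  assumes \<phi>: "C_k 1 \<phi>" and 0: "\<phi> (x + h) = 0"
  shows "ennreal \<bar>\<phi> x\<bar> \<le> (\<integral>\<^sup>+s. ennreal (norm h * norm (grad \<phi> (x + s *\<^sub>R h))) * indicator {0..1} s \<partial>lborel)"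
proof -
  have cont: "continuous_on S (\<lambda>s. grad \<phi> (x + s *\<^sub>R h) \<bullet> h)" for S
    using \<phi> by (intro continuous_intros continuous_on_compose2[OF continuous_grad[of 0 \<phi> UNIV]]) auto
  have *: "has_bochner_integral lborel (\<lambda>s. (grad \<phi> (x + s *\<^sub>R h) \<bullet> h) * indicator {0..1} s)
      (\<phi> (x + 1 *\<^sub>R h) - \<phi> (x + 0 *\<^sub>R h))"
    using cont[of UNIV]
    by (intro has_bochner_integral_FTC_Icc_real has_real_derivative_along_line[OF \<phi>, folded grad_inner[OF \<phi>]])
       (auto simp: continuous_on_eq_continuous_at)
  have "ennreal \<bar>\<phi> x\<bar> = ennreal (norm (\<integral>s. (grad \<phi> (x + s *\<^sub>R h) \<bullet> h) * indicator {0..1} s \<partial>lborel))"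
    using 0 by (subst has_bochner_integral_integral_eq[OF *]) simp
  also have "\<dots> \<le> (\<integral>\<^sup>+s. norm ((grad \<phi> (x + s *\<^sub>R h) \<bullet> h) * indicator {0..1} s) \<partial>lborel)"
    by (rule integral_norm_bound_ennreal) (use * in \<open>rule integrable.intros\<close>)
  also have "\<dots> \<le> (\<integral>\<^sup>+s. ennreal (norm h * norm (grad \<phi> (x + s *\<^sub>R h))) * indicator {0..1} s \<partial>lborel)"
  proof (rule nn_integral_mono)
    fix s :: real
    show "ennreal (norm ((grad \<phi> (x + s *\<^sub>R h) \<bullet> h) * indicator {0..1} s))
        \<le> ennreal (norm h * norm (grad \<phi> (x + s *\<^sub>R h))) * indicator {0..1} s"
      using Cauchy_Schwarz_ineq2[of "grad \<phi> (x + s *\<^sub>R h)" h]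
      by (auto simp: indicator_def mult.commute intro!: ennreal_leI)
  qed
  finally show ?thesis .
qed

lemma nn_integral_lborel_translate:
  fixes f :: "'a::euclidean_space \<Rightarrow> ennreal"
  assumes [measurable]: "f \<in> borel_measurable borel"
  shows "(\<integral>\<^sup>+x. f (c + x) \<partial>lborel) = (\<integral>\<^sup>+x. f x \<partial>lborel)"
  by (subst (2) lborel_distr_plus[of c, symmetric]) (simp add: nn_integral_distr)

lemma nn_integral_lborel_scale:
  fixes f :: "'a::euclidean_space \<Rightarrow> ennreal"
  assumes [measurable]: "f \<in> borel_measurable borel" and s: "s > 0"
  shows "(\<integral>\<^sup>+h. f (x + s *\<^sub>R h) \<partial>lborel) = ennreal (s powr - real DIM('a)) * (\<integral>\<^sup>+x. f x \<partial>lborel)"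
proof -
  have "(\<integral>\<^sup>+x. f x \<partial>lborel) = ennreal (s ^ DIM('a)) * (\<integral>\<^sup>+h. f (x + s *\<^sub>R h) \<partial>lborel)"
    using s by (subst lborel_affine[of s x]) (simp_all add: nn_integral_density nn_integral_distr nn_integral_cmult)
  moreover have "ennreal (s powr - real DIM('a)) * ennreal (s ^ DIM('a)) = 1"
    using s by (simp add: ennreal_mult[symmetric] powr_minus powr_realpow)
  ultimately show ?thesis by (simp add: mult.assoc[symmetric])
qed

text \<open>Interpolation between an L^2 bound and a uniform bound L, in pointwise form. If A is at
  most M b, the last term dominates; otherwise b is at most A / M, and of the resulting power of A
  all but the square is replaced by a power of L. The threshold M is free and is balanced when the
  inequality is applied.\<close>

lemma Young_truncated:
  fixes A b M L r :: real
  assumes "0 \<le> A" "A \<le> L" "0 \<le> b" "0 < M" "2 < r"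
  shows "A * b powr (r - 1) \<le> L powr (r - 2) * M powr (1 - r) * A\<^sup>2 + M * b powr r"
proof (cases "A \<le> M * b")
  case True
  have "A * b powr (r - 1) \<le> (M * b) * b powr (r - 1)"
    using True by (intro mult_right_mono) auto
  also have "\<dots> = M * b powr r"
    using assms by (cases "b = 0") (auto simp: powr_diff)
  finally show ?thesis using assms by (smt (verit) mult_nonneg_nonneg powr_ge_zero zero_le_power2)
next
  case False
  then have A: "A > 0" using assms by (smt (verit) mult_nonneg_nonneg)
  have "b \<le> A / M" using False assms by (simp add: field_simps)
  then have "A * b powr (r - 1) \<le> A * (A / M) powr (r - 1)"
    using assms by (intro mult_left_mono powr_mono2) auto
  also have "\<dots> = A powr (r - 2) * M powr (1 - r) * A\<^sup>2"
    using A assms by (simp add: powr_divide powr_diff power2_eq_square field_simps)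
  also have "\<dots> \<le> L powr (r - 2) * M powr (1 - r) * A\<^sup>2"
    using assms by (intro mult_right_mono powr_mono2) auto
  finally show ?thesis using assms by (smt (verit) mult_nonneg_nonneg powr_ge_zero)
qed

text \<open>If \<open>K\<close> translates \<open>U\<close> off itself, then \<open>|\<phi> x|\<close> is at most a constant times the integral over
  \<open>s \<in> [0, 1]\<close> of the average of \<open>g = |\<nabla>\<phi>|\<close> over \<open>x + s K\<close>.  This average has \<open>L\<^sup>2\<close> norm at most \<open>\<parallel>g\<parallel>\<close>
  and is bounded by \<open>\<parallel>g\<parallel>\<close> times \<open>s\<^bsup>- n / 2\<^esup>\<close>, up to constants, so its \<open>L\<^sup>r\<close> norm is of order
  \<open>s\<^bsup>- \<beta>\<^esup>\<close> with \<open>\<beta> = n (1 / 2 - 1 / r)\<close>.  Integrability in \<open>s\<close> is the condition \<open>\<beta> < 1\<close>.\<close>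

lemma averaged_gradient_bound:
  fixes g :: "'a::euclidean_space \<Rightarrow> real"
  assumes [measurable]: "g \<in> borel_measurable borel" "b \<in> borel_measurable borel" "K \<in> sets borel"
    and g0: "\<And>x. 0 \<le> g x" and b0: "\<And>x. 0 \<le> b x"
    and g2: "(\<integral>\<^sup>+x. ennreal ((g x)\<^sup>2) \<partial>lborel) \<le> ennreal (N\<^sup>2)" and N: "0 < N"
    and br: "(\<integral>\<^sup>+x. ennreal (b x powr r) \<partial>lborel) \<le> 1" and r: "2 < r"
    and m: "emeasure lborel K = ennreal m" "0 < m" and s: "0 < s"
  shows "(\<integral>\<^sup>+x. (\<integral>\<^sup>+h. ennreal (g (x + s *\<^sub>R h)) * indicator K h \<partial>lborel) * ennreal (b x powr (r - 1)) \<partial>lborel)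
    \<le> ennreal (2 * (s powr (- (real DIM('a) * (r - 2) / (2 * r))) * m powr ((r + 2) / (2 * r)) * N))"
proof -
  define n where "n = real DIM('a)"
  \<comment> \<open>\<open>M\<close> is the claimed bound without its factor 2 and also the
    threshold used in \<open>Young_truncated\<close>. \<open>L\<close> bounds the average over K
    uniformly in x: Cauchy-Schwarz on K contributes m^(1/2), and rescaling h by s contributes
    s^(-n/2).\<close>
  define M where "M = s powr (- (n * (r - 2) / (2 * r))) * m powr ((r + 2) / (2 * r)) * N"
  define L where "L = m powr (1/2) * s powr (- n / 2) * N"
  have M0: "0 < M" and L0: "0 < L" using m s N by (auto simp: M_def L_def)
  have L2: "L\<^sup>2 = m * (s powr - n * N\<^sup>2)"
  proof -
    have "L\<^sup>2 = (m powr (1/2) * m powr (1/2)) * (s powr (- n / 2) * s powr (- n / 2)) * (N * N)"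
      by (simp add: L_def power2_eq_square)
    also have "m powr (1/2) * m powr (1/2) = m" using m by (simp flip: powr_add)
    also have "s powr (- n / 2) * s powr (- n / 2) = s powr - n" by (simp flip: powr_add)
    finally show ?thesis by (simp add: power2_eq_square)
  qed
  define \<kappa> where "\<kappa> = L powr (r - 2) * M powr (1 - r)"
  have \<kappa>0: "0 \<le> \<kappa>" by (simp add: \<kappa>_def)
  \<comment> \<open>The threshold is chosen so that both terms of \<open>Young_truncated\<close>
    contribute M after integration. In logarithms this identity between powers becomes
    linear.\<close>
  have \<kappa>: "\<kappa> * m * (m * N\<^sup>2) = M"
  proof -
    define x y z where "x = ln m" "y = ln s" "z = ln N"
    then have e: "m = exp x" "s = exp y" "N = exp z" using m s N by auto
    have lnL: "ln L = x / 2 - n / 2 * y + z" 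
      unfolding L_def e by (simp add: powr_def exp_add[symmetric])
    have lnM: "ln M = - (n * (r - 2) / (2 * r)) * y + (r + 2) / (2 * r) * x + z"
      unfolding M_def e by (simp add: powr_def exp_add[symmetric])
    have "\<kappa> * m * (m * N\<^sup>2) = exp ((r - 2) * ln L + (1 - r) * ln M + x + (x + 2 * z))"
    proof -
      have "exp x * (exp x * (exp z)\<^sup>2) = exp (x + (x + 2 * z))"
        by (simp only: exp_add exp_double)
      then show ?thesis
        using L0 M0 unfolding \<kappa>_def e by (simp add: powr_def exp_add mult.assoc)
    qed
    also have "(r - 2) * ln L + (1 - r) * ln M + x + (x + 2 * z) = ln M"
      using r unfolding lnL lnM by (simp add: field_simps)
    finally show ?thesis using M0 by simp
  qed
  have pt: "(\<integral>\<^sup>+h. ennreal (g (x + s *\<^sub>R h)) * indicator K h \<partial>lborel) * ennreal (b x powr (r - 1))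
     \<le> ennreal \<kappa> * (ennreal m * (\<integral>\<^sup>+h. ennreal ((g (x + s *\<^sub>R h))\<^sup>2) * indicator K h \<partial>lborel)) + ennreal M * ennreal (b x powr r)"
    (is "?A * _ \<le> ennreal \<kappa> * (ennreal m * ?B) + _") for x
  proof -
    have "?A\<^sup>2 = (\<integral>\<^sup>+h. (ennreal (g (x + s *\<^sub>R h)) * indicator K h) * indicator K h \<partial>lborel)\<^sup>2"
      by (intro arg_cong[of _ _ "\<lambda>z. z\<^sup>2"] nn_integral_cong) (auto simp: indicator_def)
    also have "\<dots> \<le> (\<integral>\<^sup>+h. (ennreal (g (x + s *\<^sub>R h)) * indicator K h)\<^sup>2 \<partial>lborel) * (\<integral>\<^sup>+h. (indicator K h)\<^sup>2 \<partial>lborel)"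
      by (rule Cauchy_Schwarz_nn_integral) measurable
    also have "(\<integral>\<^sup>+h. (ennreal (g (x + s *\<^sub>R h)) * indicator K h)\<^sup>2 \<partial>lborel) = ?B"
      by (rule nn_integral_cong) (auto simp: indicator_def ennreal_power g0)
    also have "(\<integral>\<^sup>+h. (indicator K h)\<^sup>2 \<partial>lborel) = (\<integral>\<^sup>+h. indicator K h \<partial>lborel)"
      by (rule nn_integral_cong) (auto simp: indicator_def)
    also have "\<dots> = ennreal m" using m by simp
    finally have A2: "?A\<^sup>2 \<le> ennreal m * ?B" by (simp add: mult.commute)
    have "?B \<le> (\<integral>\<^sup>+h. ennreal ((g (x + s *\<^sub>R h))\<^sup>2) \<partial>lborel)"
      by (rule nn_integral_mono) (auto simp: indicator_def)
    also have "\<dots> = ennreal (s powr - n) * (\<integral>\<^sup>+x. ennreal ((g x)\<^sup>2) \<partial>lborel)"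
      unfolding n_def by (rule nn_integral_lborel_scale[OF _ s]) measurable
    also have "\<dots> \<le> ennreal (s powr - n) * ennreal (N\<^sup>2)"
      by (intro mult_left_mono g2) simp
    finally have B: "?B \<le> ennreal (s powr - n * N\<^sup>2)" by (simp add: ennreal_mult)
    have AL: "?A\<^sup>2 \<le> ennreal (L\<^sup>2)"
      using order_trans[OF A2 mult_left_mono[OF B]] m by (simp add: L2 ennreal_mult)
    have "\<exists>A. ?A = ennreal A \<and> 0 \<le> A \<and> A \<le> L"
    proof (cases ?A)
      case (real A)
      then have "A\<^sup>2 \<le> L\<^sup>2" using AL by (simp add: ennreal_power)
      then have "A \<le> L" using L0 by (rule power2_le_imp_le[OF _ less_imp_le])
      with real show ?thesis by blast
    next
      case top
      then show ?thesis using AL by (simp add: top_unique)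
    qed
    then obtain A where A: "?A = ennreal A" "0 \<le> A" "A \<le> L" by blast
    have "?A * ennreal (b x powr (r - 1)) \<le> ennreal (\<kappa> * A\<^sup>2 + M * b x powr r)"
      using Young_truncated[OF A(2,3) b0 M0 r, of x] A(2) \<kappa>0
      by (simp add: A(1) \<kappa>_def ennreal_mult[symmetric] ennreal_leI)
    also have "\<dots> = ennreal \<kappa> * ?A\<^sup>2 + ennreal M * ennreal (b x powr r)"
      using A \<kappa>0 M0 by (simp add: ennreal_mult ennreal_power ennreal_plus)
    also have "\<dots> \<le> ennreal \<kappa> * (ennreal m * ?B) + ennreal M * ennreal (b x powr r)"
      by (intro add_right_mono mult_left_mono A2) simp
    finally show ?thesis .
  qed
  \<comment> \<open>Integrating in x first removes the shift \<open>s *\<^sub>R h\<close>, so this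
    L^2 bound does not depend on s.\<close>
  have BB: "(\<integral>\<^sup>+x. (\<integral>\<^sup>+h. ennreal ((g (x + s *\<^sub>R h))\<^sup>2) * indicator K h \<partial>lborel) \<partial>lborel) \<le> ennreal (m * N\<^sup>2)"
  proof -
    have "(\<integral>\<^sup>+x. (\<integral>\<^sup>+h. ennreal ((g (x + s *\<^sub>R h))\<^sup>2) * indicator K h \<partial>lborel) \<partial>lborel)
        = (\<integral>\<^sup>+h. (\<integral>\<^sup>+x. ennreal ((g (x + s *\<^sub>R h))\<^sup>2) * indicator K h \<partial>lborel) \<partial>lborel)"
      by (rule lborel_pair.Fubini') measurable
    also have "\<dots> = (\<integral>\<^sup>+h. (\<integral>\<^sup>+x. ennreal ((g x)\<^sup>2) \<partial>lborel) * indicator K h \<partial>lborel)"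
    proof (rule nn_integral_cong)
      fix h :: 'a
      have "(\<integral>\<^sup>+x. ennreal ((g (x + s *\<^sub>R h))\<^sup>2) * indicator K h \<partial>lborel)
          = (\<integral>\<^sup>+x. ennreal ((g (x + s *\<^sub>R h))\<^sup>2) \<partial>lborel) * indicator K h"
        by (rule nn_integral_multc) measurable
      also have "(\<integral>\<^sup>+x. ennreal ((g (x + s *\<^sub>R h))\<^sup>2) \<partial>lborel) = (\<integral>\<^sup>+x. ennreal ((g (s *\<^sub>R h + x))\<^sup>2) \<partial>lborel)"
        by (simp only: add.commute)
      also have "(\<integral>\<^sup>+x. ennreal ((g (s *\<^sub>R h + x))\<^sup>2) \<partial>lborel) = (\<integral>\<^sup>+x. ennreal ((g x)\<^sup>2) \<partial>lborel)"
        by (rule nn_integral_lborel_translate) measurable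
      finally show "(\<integral>\<^sup>+x. ennreal ((g (x + s *\<^sub>R h))\<^sup>2) * indicator K h \<partial>lborel)
          = (\<integral>\<^sup>+x. ennreal ((g x)\<^sup>2) \<partial>lborel) * indicator K h" .
    qed
    also have "\<dots> = (\<integral>\<^sup>+x. ennreal ((g x)\<^sup>2) \<partial>lborel) * ennreal m"
      using m by (simp add: nn_integral_cmult)
    also have "\<dots> \<le> ennreal (N\<^sup>2) * ennreal m" by (intro mult_right_mono g2) simp
    finally show ?thesis using m by (simp add: ennreal_mult mult.commute)
  qed
  have "(\<integral>\<^sup>+x. (\<integral>\<^sup>+h. ennreal (g (x + s *\<^sub>R h)) * indicator K h \<partial>lborel) * ennreal (b x powr (r - 1)) \<partial>lborel)
     \<le> (\<integral>\<^sup>+x. ennreal \<kappa> * (ennreal m * (\<integral>\<^sup>+h. ennreal ((g (x + s *\<^sub>R h))\<^sup>2) * indicator K h \<partial>lborel)) + ennreal M * ennreal (b x powr r) \<partial>lborel)"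
    by (intro nn_integral_mono pt)
  also have "\<dots> = ennreal \<kappa> * (ennreal m * (\<integral>\<^sup>+x. (\<integral>\<^sup>+h. ennreal ((g (x + s *\<^sub>R h))\<^sup>2) * indicator K h \<partial>lborel) \<partial>lborel)) + ennreal M * (\<integral>\<^sup>+x. ennreal (b x powr r) \<partial>lborel)"
    by (subst nn_integral_add) (measurable, simp add: nn_integral_cmult)
  also have "\<dots> \<le> ennreal \<kappa> * (ennreal m * ennreal (m * N\<^sup>2)) + ennreal M * 1"
    by (intro add_mono mult_left_mono BB br) auto
  also have "\<dots> = ennreal (2 * M)"
    using \<kappa>0 m M0 \<kappa> by (simp add: ennreal_mult[symmetric] ennreal_plus[symmetric] mult.assoc del: ennreal_plus)
  finally show ?thesis by (simp add: M_def n_def)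
qed


lemma Sobolev_normalized:
  fixes U :: "'a::euclidean_space set"
  assumes U: "bounded U" and r: "2 < r" and \<beta>: "real DIM('a) * (r - 2) / (2 * r) < 1"
  shows "\<exists>C>0. \<forall>\<phi>\<in>test_functions U. \<forall>N>0.
    (\<integral>\<^sup>+x. ennreal (\<bar>\<phi> x\<bar> powr r) \<partial>lborel) = 1 \<longrightarrow>
    (\<integral>\<^sup>+x. ennreal ((norm (grad \<phi> x))\<^sup>2) \<partial>lborel) \<le> ennreal (N\<^sup>2) \<longrightarrow> 1 \<le> C * N"
proof -
  define \<beta> where "\<beta> = real DIM('a) * (r - 2) / (2 * r)"
  obtain D where D: "0 < D" "U \<subseteq> ball 0 D"
    using bounded_subset_ballD[OF U, of 0] by blast
  obtain e :: 'a where e: "e \<in> Basis" using nonempty_Basis by blast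
  \<comment> \<open>Vectors in this ball have length between 2 D and 4 D, so each of them carries a
    point of norm below D to a point of norm at least D, outside U.\<close>
  define K where "K = cball ((3 * D) *\<^sub>R e) D"
  have ne: "norm ((3 * D) *\<^sub>R e) = 3 * D" using e D by simp
  have K_ge: "2 * D \<le> norm h" and K_le: "norm h \<le> 4 * D" if "h \<in> K" for h
    using that ne norm_triangle_ineq[of h "(3 * D) *\<^sub>R e - h"] norm_triangle_ineq[of "(3 * D) *\<^sub>R e" "h - (3 * D) *\<^sub>R e"]
    by (auto simp: K_def dist_norm norm_minus_commute)
  have Kb: "K \<in> sets borel" by (simp add: K_def)
  define m where "m = measure lborel K"
  have mK: "emeasure lborel K = ennreal m"
    using emeasure_bounded_finite[of K] by (simp add: m_def K_def emeasure_eq_ennreal_measure)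
  have m0: "0 < m" using D content_cball_pos[of D "(3 * D) *\<^sub>R e"] by (simp add: m_def K_def)
  define c where "c = m powr ((r + 2) / (2 * r))"
  \<comment> \<open>Collects 4 D from the length of h, the factor 2 of
    \<open>averaged_gradient_bound\<close>, 1 / (1 - \<beta>) as the integral of s^(-\<beta>) over
    [0, 1], and 1 / m from averaging over \<open>K\<close>.\<close>
  define C where "C = 8 * D * c / (1 - \<beta>) / m"
  have C0: "C > 0" using D m0 \<beta> by (simp add: C_def c_def \<beta>_def)
  have beta_int: "(\<integral>\<^sup>+s. ennreal (s powr - \<beta>) * indicator {0..1} s \<partial>lborel) = ennreal (1 / (1 - \<beta>))"
  proof -
    have "((\<lambda>s. s powr - \<beta>) has_integral (1 powr (- \<beta> + 1) / (- \<beta> + 1))) {0..1}"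
      using \<beta> by (intro has_integral_powr_from_0) (auto simp: \<beta>_def)
    then have "((\<lambda>s. s powr - \<beta>) has_integral (1 / (1 - \<beta>))) {0..1}" by simp
    from nn_integral_has_integral_lebesgue[OF _ this]
    have "(\<integral>\<^sup>+s. ennreal (indicator {0..1} s * s powr - \<beta>) \<partial>lborel) = ennreal (1 / (1 - \<beta>))" by simp
    moreover have "ennreal (indicator {0..1} s * s powr - \<beta>) = ennreal (s powr - \<beta>) * indicator {0..1} s" for s
      by (simp add: indicator_def)
    ultimately show ?thesis by simp
  qed
  show ?thesis
  proof (intro exI[of _ C] conjI C0 ballI allI impI)
    fix \<phi> and N :: real
    assume \<phi>: "\<phi> \<in> test_functions U" and N: "0 < N"
      and one: "(\<integral>\<^sup>+x. ennreal (\<bar>\<phi> x\<bar> powr r) \<partial>lborel) = 1"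
      and gN: "(\<integral>\<^sup>+x. ennreal ((norm (grad \<phi> x))\<^sup>2) \<partial>lborel) \<le> ennreal (N\<^sup>2)"
    note C1 = test_functionD(1)[OF \<phi>, of 1]
    define g where "g x = norm (grad \<phi> x)" for x
    define b where "b x = \<bar>\<phi> x\<bar>" for x
    have [measurable]: "g \<in> borel_measurable borel" "b \<in> borel_measurable borel"
      using continuous_grad[of 0 \<phi> UNIV] C1 C_k_imp_continuous[OF C1, of UNIV]
      unfolding g_def[abs_def] b_def[abs_def]
      by (auto intro!: borel_measurable_continuous_onI continuous_intros)
    have [measurable]: "K \<in> sets borel" by (rule Kb)
    have br: "b x powr r = b x * b x powr (r - 1)" for x
      using r by (cases "b x = 0") (auto simp: b_def powr_diff)
    have bound: "ennreal (b x powr r) * indicator K h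
        \<le> (\<integral>\<^sup>+s. ennreal (4 * D) * (ennreal (g (x + s *\<^sub>R h)) * indicator K h * ennreal (b x powr (r - 1)) * indicator {0..1} s) \<partial>lborel)" for x h
    proof (cases "h \<in> K \<and> x \<in> U")
      case False
      then show ?thesis using test_functionD(2)[OF \<phi>, of x] r by (auto simp: b_def)
    next
      case True
      have "norm x < D" using True D by auto
      then have "D \<le> norm (x + h)"
        using K_ge[of h] True norm_triangle_ineq[of "x + h" "- x"] by simp
      then have "x + h \<notin> U" using D(2) by auto
      then have "ennreal (b x) \<le> (\<integral>\<^sup>+s. ennreal (norm h * g (x + s *\<^sub>R h)) * indicator {0..1} s \<partial>lborel)"
        unfolding b_def g_def by (intro line_integral_bound C1 test_functionD(2)[OF \<phi>])
      also have "\<dots> \<le> (\<integral>\<^sup>+s. ennreal (4 * D * g (x + s *\<^sub>R h)) * indicator {0..1} s \<partial>lborel)"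
        using K_le[of h] True by (intro nn_integral_mono mult_right_mono ennreal_leI) (auto simp: g_def)
      finally have "ennreal (b x) * ennreal (b x powr (r - 1))
          \<le> (\<integral>\<^sup>+s. ennreal (4 * D * g (x + s *\<^sub>R h)) * indicator {0..1} s \<partial>lborel) * ennreal (b x powr (r - 1))"
        by (rule mult_right_mono) simp
      also have "\<dots> = (\<integral>\<^sup>+s. ennreal (4 * D * g (x + s *\<^sub>R h)) * indicator {0..1} s * ennreal (b x powr (r - 1)) \<partial>lborel)"
        by (rule nn_integral_multc[symmetric]) measurable
      also have "\<dots> = (\<integral>\<^sup>+s. ennreal (4 * D) * (ennreal (g (x + s *\<^sub>R h)) * indicator K h * ennreal (b x powr (r - 1)) * indicator {0..1} s) \<partial>lborel)"
        using True D by (intro nn_integral_cong) (simp add: ennreal_mult' g_def mult_ac)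
      finally have "ennreal (b x) * ennreal (b x powr (r - 1))
          \<le> (\<integral>\<^sup>+s. ennreal (4 * D) * (ennreal (g (x + s *\<^sub>R h)) * indicator K h * ennreal (b x powr (r - 1)) * indicator {0..1} s) \<partial>lborel)" .
      moreover have "ennreal (b x powr r) * indicator K h = ennreal (b x) * ennreal (b x powr (r - 1))"
        using True unfolding br[of x] by (subst ennreal_mult) (auto simp: b_def)
      ultimately show ?thesis by (simp only:)
    qed
    \<comment> \<open>Averaging over the translations: the normalisation is multiplied by the volume
      of \<open>K\<close>, \<open>bound\<close> is inserted under the integral, and the s-integral
      is moved outermost so that the estimate for fixed s applies.\<close>
    have "ennreal m = (\<integral>\<^sup>+x. ennreal (b x powr r) \<partial>lborel) * (\<integral>\<^sup>+h. indicator K h \<partial>lborel)"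
      using one mK by (simp add: b_def)
    also have "\<dots> = (\<integral>\<^sup>+x. (\<integral>\<^sup>+h. ennreal (b x powr r) * indicator K h \<partial>lborel) \<partial>lborel)"
      by (simp add: nn_integral_cmult nn_integral_multc)
    also have "\<dots> \<le> (\<integral>\<^sup>+x. (\<integral>\<^sup>+h. (\<integral>\<^sup>+s. ennreal (4 * D) * (ennreal (g (x + s *\<^sub>R h)) * indicator K h * ennreal (b x powr (r - 1)) * indicator {0..1} s) \<partial>lborel) \<partial>lborel) \<partial>lborel)"
      by (intro nn_integral_mono bound)
    also have "\<dots> = (\<integral>\<^sup>+x. (\<integral>\<^sup>+s. (\<integral>\<^sup>+h. ennreal (4 * D) * (ennreal (g (x + s *\<^sub>R h)) * indicator K h * ennreal (b x powr (r - 1)) * indicator {0..1} s) \<partial>lborel) \<partial>lborel) \<partial>lborel)"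
      by (intro nn_integral_cong lborel_pair.Fubini') measurable
    also have "\<dots> = (\<integral>\<^sup>+s. (\<integral>\<^sup>+x. (\<integral>\<^sup>+h. ennreal (4 * D) * (ennreal (g (x + s *\<^sub>R h)) * indicator K h * ennreal (b x powr (r - 1)) * indicator {0..1} s) \<partial>lborel) \<partial>lborel) \<partial>lborel)"
      by (rule lborel_pair.Fubini') measurable
    also have "\<dots> = (\<integral>\<^sup>+s. ennreal (4 * D) * ((\<integral>\<^sup>+x. (\<integral>\<^sup>+h. ennreal (g (x + s *\<^sub>R h)) * indicator K h \<partial>lborel) * ennreal (b x powr (r - 1)) \<partial>lborel) * indicator {0..1} s) \<partial>lborel)"
      by (simp add: nn_integral_cmult nn_integral_multc)
    also have "\<dots> \<le> (\<integral>\<^sup>+s. ennreal (4 * D) * (ennreal (2 * (s powr - \<beta> * c * N)) * indicator {0..1} s) \<partial>lborel)"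
    proof (rule nn_integral_mono_AE)
      \<comment> \<open>The estimate for fixed s requires s > 0; the single point 0 is a null
        set.\<close>
      have "AE s in lborel. s \<noteq> (0::real)" by (rule AE_lborel_singleton)
      then show "AE s in lborel. ennreal (4 * D) * ((\<integral>\<^sup>+x. (\<integral>\<^sup>+h. ennreal (g (x + s *\<^sub>R h)) * indicator K h \<partial>lborel) * ennreal (b x powr (r - 1)) \<partial>lborel) * indicator {0..1} s)
        \<le> ennreal (4 * D) * (ennreal (2 * (s powr - \<beta> * c * N)) * indicator {0..1} s)"
      proof eventually_elim
        case (elim s)
        show ?case
        proof (cases "s \<in> {0..1}")
          case True
          then have "0 < s" using elim by simp
          from averaged_gradient_bound[OF _ _ Kb _ _ _ N _ r mK m0 this, of g b] one gN
          show ?thesis unfolding \<beta>_def c_def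
            by (intro mult_left_mono mult_right_mono) (auto simp: g_def b_def)
        qed simp
      qed
    qed
    also have "\<dots> = (\<integral>\<^sup>+s. ennreal (8 * D * c * N) * (ennreal (s powr - \<beta>) * indicator {0..1} s) \<partial>lborel)"
      using D N by (intro nn_integral_cong) (auto simp: ennreal_mult[symmetric] c_def indicator_def mult_ac)
    also have "\<dots> = ennreal (8 * D * c * N) * ennreal (1 / (1 - \<beta>))"
      by (subst nn_integral_cmult) (simp_all add: beta_int)
    also have "\<dots> = ennreal (8 * D * c * N * (1 / (1 - \<beta>)))"
      using D N \<beta> by (intro ennreal_mult[symmetric]) (auto simp: c_def \<beta>_def)
    finally have "m \<le> 8 * D * c * N * (1 / (1 - \<beta>))"
      using D N \<beta> by (subst (asm) ennreal_le_iff) (auto simp: c_def \<beta>_def)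
    then have "m / m \<le> 8 * D * c * N * (1 / (1 - \<beta>)) / m"
      using m0 by (intro divide_right_mono) auto
    then show "1 \<le> C * N" using m0 by (simp add: C_def mult_ac)
  qed
qed

text \<open>The normalisation in \<open>Sobolev_normalized\<close> is removed by homogeneity; a
  function whose L^r integral is zero needs no scaling.\<close>

theorem Sobolev_inequality_test:
  fixes U :: "'a::euclidean_space set"
  assumes U: "bounded U" and r: "2 < r" and \<beta>: "real DIM('a) * (r - 2) / (2 * r) < 1"
  shows "\<exists>C>0. \<forall>\<phi>\<in>test_functions U.
    (\<integral>x. \<bar>\<phi> x\<bar> powr r \<partial>lborel) \<le> (C * sqrt (\<integral>x. (norm (grad \<phi> x))\<^sup>2 \<partial>lborel)) powr r"
proof -
  obtain C where C: "C > 0" and CN: "\<And>\<phi> N. \<phi> \<in> test_functions U \<Longrightarrow> N > 0 \<Longrightarrow>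
      (\<integral>\<^sup>+x. ennreal (\<bar>\<phi> x\<bar> powr r) \<partial>lborel) = 1 \<Longrightarrow>
      (\<integral>\<^sup>+x. ennreal ((norm (grad \<phi> x))\<^sup>2) \<partial>lborel) \<le> ennreal (N\<^sup>2) \<Longrightarrow> 1 \<le> C * N"
    using Sobolev_normalized[OF assms] by blast
  show ?thesis
  proof (intro exI[of _ C] conjI C ballI)
    fix \<phi> assume \<phi>: "\<phi> \<in> test_functions U"
    note C1 = test_functionD(1)[OF \<phi>, of 1]
    obtain R where R: "\<And>x. x \<notin> cball 0 R \<Longrightarrow> \<phi> x = 0" "\<And>x. x \<notin> cball 0 R \<Longrightarrow> grad \<phi> x = 0"
      using test_function_support[OF \<phi>] by metis
    have int_r: "integrable lborel (\<lambda>x. \<bar>\<phi> x\<bar> powr r)"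
      by (rule integrable_compactly_supported[of _ R])
         (use r R C_k_imp_continuous[OF C1, of UNIV] in \<open>auto intro!: continuous_intros continuous_on_powr'\<close>)
    have int_g: "integrable lborel (\<lambda>x. (norm (grad \<phi> x))\<^sup>2)"
      by (rule integrable_compactly_supported[of _ R])
         (use R continuous_grad[of 0 \<phi> UNIV] C1 in \<open>auto intro!: continuous_intros\<close>)
    define Y where "Y = (\<integral>x. \<bar>\<phi> x\<bar> powr r \<partial>lborel)"
    define S where "S = sqrt (\<integral>x. (norm (grad \<phi> x))\<^sup>2 \<partial>lborel)"
    have S2: "S\<^sup>2 = (\<integral>x. (norm (grad \<phi> x))\<^sup>2 \<partial>lborel)" and S0: "0 \<le> S" by (auto simp: S_def)
    have Y0: "0 \<le> Y" by (simp add: Y_def)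
    show "(\<integral>x. \<bar>\<phi> x\<bar> powr r \<partial>lborel) \<le> (C * sqrt (\<integral>x. (norm (grad \<phi> x))\<^sup>2 \<partial>lborel)) powr r"
      unfolding Y_def[symmetric] S_def[symmetric]
    proof (cases "Y = 0")
      case False
      then have Y: "Y > 0" using Y0 by simp
      define a where "a = Y powr (- 1 / r)"
      have a: "a > 0" using Y by (simp add: a_def)
      have "a powr r = Y powr - 1" unfolding a_def powr_powr using r by simp
      then have ar: "a powr r * Y = 1" using Y by (simp add: powr_minus)
      define \<psi> where "\<psi> x = a * \<phi> x" for x
      have \<psi>: "\<psi> \<in> test_functions U" unfolding \<psi>_def[abs_def] by (rule test_function_cmult[OF \<phi>])
      have "(\<integral>\<^sup>+x. ennreal (\<bar>\<psi> x\<bar> powr r) \<partial>lborel) = ennreal (\<integral>x. a powr r * \<bar>\<phi> x\<bar> powr r \<partial>lborel)"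
        using a int_r by (simp add: \<psi>_def abs_mult powr_mult nn_integral_eq_integral)
      then have one: "(\<integral>\<^sup>+x. ennreal (\<bar>\<psi> x\<bar> powr r) \<partial>lborel) = 1"
        using ar by (simp add: Y_def)
      \<comment> \<open>The majorant of the gradient norm has to be positive, while S might a priori
        be 0; hence the summand \<epsilon>, which is sent to 0 afterwards.\<close>
      have eps: "1 \<le> C * (a * S + \<epsilon>)" if "\<epsilon> > 0" for \<epsilon>
      proof (rule CN[OF \<psi> _ one])
        show "0 < a * S + \<epsilon>" using a S0 that by (simp add: add_nonneg_pos)
        have "(\<integral>\<^sup>+x. ennreal ((norm (grad \<psi> x))\<^sup>2) \<partial>lborel) = ennreal (\<integral>x. a\<^sup>2 * (norm (grad \<phi> x))\<^sup>2 \<partial>lborel)"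
          unfolding \<psi>_def[abs_def] using a int_g
          by (simp add: grad_cmult[OF C1] power_mult_distrib nn_integral_eq_integral)
        also have "\<dots> = ennreal ((a * S)\<^sup>2)" by (simp add: power_mult_distrib S2)
        also have "\<dots> \<le> ennreal ((a * S + \<epsilon>)\<^sup>2)"
          using a S0 that by (intro ennreal_leI power_mono) auto
        finally show "(\<integral>\<^sup>+x. ennreal ((norm (grad \<psi> x))\<^sup>2) \<partial>lborel) \<le> ennreal ((a * S + \<epsilon>)\<^sup>2)" .
      qed
      have "1 \<le> C * (a * S) + \<epsilon>" if "\<epsilon> > 0" for \<epsilon>
        using eps[of "\<epsilon> / C"] that C by (simp add: distrib_left)
      then have "1 \<le> C * (a * S)" by (rule field_le_epsilon)
      then have "1 powr r \<le> (C * (a * S)) powr r" using r by (intro powr_mono2) auto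
      also have "\<dots> = a powr r * (C * S) powr r"
        using a C S0 by (simp add: powr_mult mult_ac)
      finally have "Y * 1 \<le> Y * (a powr r * (C * S) powr r)" using Y by (intro mult_left_mono) auto
      also have "\<dots> = (a powr r * Y) * (C * S) powr r" by simp
      also have "\<dots> = (C * S) powr r" unfolding ar by simp
      finally show "Y \<le> (C * S) powr r" by simp
    qed simp
  qed
qed

section \<open>The logarithmic nonlinearity\<close>

text \<open>The antiderivative of \<open>log_source p\<close> that vanishes at 0. The last two terms
  of \<open>J\<close> together are minus the integral of this function.\<close>

definition log_primitive :: "real \<Rightarrow> real \<Rightarrow> real" where
  "log_primitive p s = \<bar>s\<bar> powr (1 + p) * ln \<bar>s\<bar> / (1 + p) - \<bar>s\<bar> powr (1 + p) / (1 + p)\<^sup>2"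

lemma log_source_minus: "log_source p (- s) = - log_source p s"
  by (simp add: log_source_def)

lemma log_primitive_minus: "log_primitive p (- s) = log_primitive p s"
  by (simp add: log_primitive_def)

lemma log_source_0 [simp]: "log_source p 0 = 0"
  by (simp add: log_source_def)

lemma log_primitive_0 [simp]: "log_primitive p 0 = 0"
  by (simp add: log_primitive_def)

context
  fixes p :: real assumes p: "1 < p"
begin

definition log_const :: real where "log_const = 1 + 1 / (p - 1)"

lemma log_const_ge: "1 \<le> log_const"
  using p by (simp add: log_const_def)

text \<open>For small s the logarithm is absorbed by the positive power p - 1, at the price 1 / (p -
  1). For |s| at least 1 it is absorbed by one additional power of |s|, which raises the exponent
  from p - 1 to p.\<close>

lemma powr_log_bound: "\<bar>s\<bar> powr (p - 1) * \<bar>ln \<bar>s\<bar>\<bar> \<le> log_const * (1 + \<bar>s\<bar>) powr p"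
proof -
  define x where "x = \<bar>s\<bar>"
  have c: "1 \<le> log_const" by (rule log_const_ge)
  have one: "1 \<le> (1 + x) powr p" using p by (simp add: x_def ge_one_powr_ge_zero)
  consider "x = 0" | "0 < x" "x < 1" | "1 \<le> x" unfolding x_def by linarith
  then have "x powr (p - 1) * \<bar>ln x\<bar> \<le> log_const * (1 + x) powr p"
  proof cases
    case 1
    then show ?thesis using c by simp
  next
    case 2
    have "(p - 1) * ln (1 / x) \<le> (1 / x) powr (p - 1)"
      using ln_le_minus_one[of "(1 / x) powr (p - 1)"] 2 by (simp add: ln_powr)
    then have "x powr (p - 1) * ((p - 1) * ln (1 / x)) \<le> x powr (p - 1) * (1 / x) powr (p - 1)"
      by (rule mult_left_mono) simp
    also have "\<dots> = 1" using 2 by (simp add: powr_divide)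
    finally have "x powr (p - 1) * ln (1 / x) \<le> 1 / (p - 1)"
      using p by (simp add: field_simps)
    moreover have "\<bar>ln x\<bar> = ln (1 / x)" using 2 by (simp add: ln_div)
    ultimately have "x powr (p - 1) * \<bar>ln x\<bar> \<le> log_const * 1" by (simp add: log_const_def)
    also have "\<dots> \<le> log_const * (1 + x) powr p" using c one by (intro mult_left_mono) auto
    finally show ?thesis .
  next
    case 3
    have "\<bar>ln x\<bar> \<le> x" using 3 ln_le_minus_one[of x] by simp
    then have "x powr (p - 1) * \<bar>ln x\<bar> \<le> x powr (p - 1) * x" by (rule mult_left_mono) simp
    also have "\<dots> = x powr p" using 3 by (simp add: powr_diff)
    also have "\<dots> \<le> (1 + x) powr p" using 3 p by (intro powr_mono2) auto
    also have "(1 + x) powr p \<le> log_const * (1 + x) powr p"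
      using mult_right_mono[OF c, of "(1 + x) powr p"] by simp
    finally show ?thesis .
  qed
  then show ?thesis by (simp add: x_def)
qed

lemma powr_bound: "\<bar>s\<bar> powr (p - 1) \<le> (1 + \<bar>s\<bar>) powr p"
proof -
  have "\<bar>s\<bar> powr (p - 1) \<le> (1 + \<bar>s\<bar>) powr (p - 1)" using p by (intro powr_mono2) auto
  also have "\<dots> \<le> (1 + \<bar>s\<bar>) powr p" by (intro powr_mono) auto
  finally show ?thesis .
qed

lemma log_source_bound: "\<bar>log_source p s\<bar> \<le> log_const * (1 + \<bar>s\<bar>) powr p * \<bar>s\<bar>"
  using mult_left_mono[OF powr_log_bound[of s], of "\<bar>s\<bar>"]
  by (simp add: log_source_def abs_mult mult_ac)

lemma log_primitive_bound: "\<bar>log_primitive p s\<bar> \<le> (log_const + 1) * (1 + \<bar>s\<bar>) powr p * s\<^sup>2"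
proof -
  have e: "\<bar>s\<bar> powr (1 + p) = s\<^sup>2 * \<bar>s\<bar> powr (p - 1)"
  proof (cases "s = 0")
    case False
    then have "\<bar>s\<bar> powr (1 + p) = \<bar>s\<bar> powr (2 + (p - 1))" by (simp add: add.commute)
    also have "\<dots> = \<bar>s\<bar> powr 2 * \<bar>s\<bar> powr (p - 1)" by (rule powr_add)
    finally show ?thesis using False by simp
  qed (use p in simp)
  have "\<bar>log_primitive p s\<bar> \<le> \<bar>\<bar>s\<bar> powr (1 + p) * ln \<bar>s\<bar> / (1 + p)\<bar> + \<bar>\<bar>s\<bar> powr (1 + p) / (1 + p)\<^sup>2\<bar>"
    unfolding log_primitive_def by (rule abs_triangle_ineq4)
  also have "\<bar>\<bar>s\<bar> powr (1 + p) * ln \<bar>s\<bar> / (1 + p)\<bar> \<le> \<bar>s\<bar> powr (1 + p) * \<bar>ln \<bar>s\<bar>\<bar>"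
    using p mult_left_mono[of 1 "1 + p" "\<bar>s\<bar> powr (1 + p) * \<bar>ln \<bar>s\<bar>\<bar>"]
    by (simp add: abs_mult divide_le_eq mult.commute)
  also have "\<bar>\<bar>s\<bar> powr (1 + p) / (1 + p)\<^sup>2\<bar> \<le> \<bar>s\<bar> powr (1 + p)"
    using p one_le_power[of "1 + p" 2] mult_left_mono[of 1 "(1 + p)\<^sup>2" "\<bar>s\<bar> powr (1 + p)"]
    by (simp add: divide_le_eq)
  also have "\<bar>s\<bar> powr (1 + p) * \<bar>ln \<bar>s\<bar>\<bar> + \<bar>s\<bar> powr (1 + p)
      = s\<^sup>2 * (\<bar>s\<bar> powr (p - 1) * \<bar>ln \<bar>s\<bar>\<bar> + \<bar>s\<bar> powr (p - 1))"
    by (simp add: e algebra_simps)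
  also have "\<dots> \<le> s\<^sup>2 * (log_const * (1 + \<bar>s\<bar>) powr p + (1 + \<bar>s\<bar>) powr p)"
    by (intro mult_left_mono add_mono powr_log_bound powr_bound) simp
  finally show ?thesis by (simp add: algebra_simps)
qed

text \<open>A single weight that dominates \<open>(1 + \<bar>z\<bar>) powr p\<close> at a, at b and
  at every point between them, as the mean value theorem demands.\<close>

definition growth :: "real \<Rightarrow> real \<Rightarrow> real" where
  "growth a b = (1 + \<bar>a\<bar> + \<bar>b\<bar>) powr p"

lemma growth_ge: "0 \<le> growth a b" "(1 + \<bar>a\<bar>) powr p \<le> growth a b" "(1 + \<bar>b\<bar>) powr p \<le> growth a b"
  using p by (auto simp: growth_def intro!: powr_mono2)

lemma log_source_deriv:
  assumes "0 < s"
  shows "(log_source p has_real_derivative (p * (s powr (p - 1) * ln s) + s powr (p - 1))) (at s)"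
proof -
  have "((\<lambda>s. s powr p * ln s) has_real_derivative (p * (s powr (p - 1) * ln s) + s powr (p - 1))) (at s)"
    using assms by (auto intro!: derivative_eq_intros simp: powr_diff)
  then show ?thesis
    by (rule has_field_derivative_transform_within_open[of _ _ _ "{0<..}"])
       (use assms in \<open>auto simp: log_source_def powr_diff\<close>)
qed

lemma log_primitive_deriv:
  assumes "0 < s"
  shows "(log_primitive p has_real_derivative log_source p s) (at s)"
proof -
  define q where "q = 1 + p"
  have q: "q > 0" using p by (simp add: q_def)
  have d: "((\<lambda>s. s powr q) has_real_derivative q * s powr p) (at s)"
    using has_real_derivative_powr[OF assms, of q] by (simp add: q_def)
  have "((\<lambda>s. s powr q * ln s / q - s powr q / q\<^sup>2) has_real_derivative
      (q * s powr p * ln s + 1 / s * s powr q) / q - q * s powr p / q\<^sup>2) (at s)"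
    by (intro DERIV_diff DERIV_cdivide DERIV_mult d DERIV_ln_divide assms)
  moreover have "(q * s powr p * ln s + 1 / s * s powr q) / q - q * s powr p / q\<^sup>2 = log_source p s"
  proof -
    have "1 / s * s powr q = s powr p" using assms by (simp add: q_def powr_add)
    moreover have "q * s powr p / q\<^sup>2 = s powr p / q" using q by (simp add: power2_eq_square)
    moreover have "q * s powr p * ln s / q = s powr p * ln s" using q by simp
    moreover have "s * s powr (p - 1) = s powr p" using assms by (simp add: powr_diff)
    ultimately show ?thesis using assms by (simp add: log_source_def add_divide_distrib)
  qed
  ultimately have "((\<lambda>s. s powr (1 + p) * ln s / (1 + p) - s powr (1 + p) / (1 + p)\<^sup>2) has_real_derivative log_source p s) (at s)"
    by (simp add: q_def)
  then show ?thesis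
    by (rule has_field_derivative_transform_within_open[of _ _ _ "{0<..}"])
       (use assms in \<open>auto simp: log_primitive_def\<close>)
qed

text \<open>\<open>p * log_const + 1\<close> bounds the derivative between points of equal sign; the
  factor 2 covers opposite signs, where two function values are added.\<close>

definition lip_const :: real where "lip_const = 2 * (p * log_const + 1)"

lemma lip_const_ge: "p * log_const + 1 \<le> lip_const" "2 * log_const \<le> lip_const" "0 \<le> lip_const"
proof -
  have "0 \<le> p * log_const" using p log_const_ge by simp
  moreover have "1 * log_const \<le> p * log_const" using p log_const_ge by (intro mult_right_mono) auto
  ultimately show "p * log_const + 1 \<le> lip_const" "2 * log_const \<le> lip_const" "0 \<le> lip_const"
    by (auto simp: lip_const_def)
qed

lemma log_source_Lipschitz_pos:
  assumes "0 < b" "b < a"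
  shows "\<bar>log_source p a - log_source p b\<bar> \<le> lip_const * growth a b * \<bar>a - b\<bar>"
proof -
  obtain z where z: "b < z" "z < a" "log_source p a - log_source p b
      = (a - b) * (p * (z powr (p - 1) * ln z) + z powr (p - 1))"
    using MVT2[OF assms(2) log_source_deriv] assms by fastforce
  have z0: "0 < z" using z assms by simp
  have "\<bar>p * (z powr (p - 1) * ln z) + z powr (p - 1)\<bar> \<le> p * (\<bar>z\<bar> powr (p - 1) * \<bar>ln \<bar>z\<bar>\<bar>) + \<bar>z\<bar> powr (p - 1)"
    using p z0 abs_triangle_ineq[of "p * (z powr (p - 1) * ln z)" "z powr (p - 1)"] by (simp add: abs_mult)
  also have "\<dots> \<le> p * (log_const * (1 + \<bar>z\<bar>) powr p) + (1 + \<bar>z\<bar>) powr p"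
    using p by (intro add_mono mult_left_mono powr_log_bound powr_bound) auto
  also have "\<dots> = (p * log_const + 1) * (1 + \<bar>z\<bar>) powr p" by (simp add: algebra_simps)
  also have "\<dots> \<le> lip_const * growth a b"
  proof (rule mult_mono)
    show "(1 + \<bar>z\<bar>) powr p \<le> growth a b"
      unfolding growth_def using z z0 assms p by (intro powr_mono2) auto
  qed (use lip_const_ge in auto)
  finally have "\<bar>p * (z powr (p - 1) * ln z) + z powr (p - 1)\<bar> * \<bar>a - b\<bar> \<le> lip_const * growth a b * \<bar>a - b\<bar>"
    by (rule mult_right_mono) simp
  then show ?thesis by (simp add: z(3) abs_mult mult.commute)
qed

lemma growth_commute: "growth a b = growth b a"
  by (simp add: growth_def add.commute add.left_commute)

text \<open>The mean value theorem is applied on the positive half line, and by oddness on the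
  negative one. If a and b do not have the same strict sign, then |a| and |b| are at most |a - b|,
  and the growth bound on each value is already a Lipschitz bound.\<close>

lemma log_source_Lipschitz: "\<bar>log_source p a - log_source p b\<bar> \<le> lip_const * growth a b * \<bar>a - b\<bar>"
proof -
  have pos: "\<bar>log_source p a - log_source p b\<bar> \<le> lip_const * growth a b * \<bar>a - b\<bar>" if "0 < a" "0 < b" for a b
    using log_source_Lipschitz_pos[of a b] log_source_Lipschitz_pos[of b a] that
    by (cases a b rule: linorder_cases) (auto simp: abs_minus_commute growth_commute)
  have "0 < a \<and> 0 < b \<or> a < 0 \<and> b < 0 \<or> a * b \<le> 0" unfolding mult_le_0_iff by linarith
  then consider "0 < a" "0 < b" | "a < 0" "b < 0" | "a * b \<le> 0" by blast
  then show ?thesis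
  proof cases
    case 1
    then show ?thesis by (rule pos)
  next
    case 2
    then show ?thesis using pos[of "- a" "- b"]
      by (simp add: log_source_minus growth_def abs_minus_commute)
  next
    case 3
    then have ab: "\<bar>a\<bar> \<le> \<bar>a - b\<bar>" "\<bar>b\<bar> \<le> \<bar>a - b\<bar>" by (auto simp: mult_le_0_iff)
    have "\<bar>log_source p a - log_source p b\<bar> \<le> \<bar>log_source p a\<bar> + \<bar>log_source p b\<bar>" by (rule abs_triangle_ineq4)
    also have "\<dots> \<le> log_const * growth a b * \<bar>a - b\<bar> + log_const * growth a b * \<bar>a - b\<bar>"
      using ab growth_ge[where a=a and b=b] log_const_ge
      by (intro add_mono order_trans[OF log_source_bound] mult_mono) auto
    also have "\<dots> = (2 * log_const) * (growth a b * \<bar>a - b\<bar>)" by simp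
    also have "\<dots> \<le> lip_const * (growth a b * \<bar>a - b\<bar>)"
      using growth_ge(1)[of a b] by (intro mult_right_mono lip_const_ge) auto
    finally show ?thesis by (simp add: mult.assoc)
  qed
qed

text \<open>The sum of the constants of the two cases below: 2^p compares the weight at an
  intermediate point with the weight at a and b, and 3 \<open>log_const\<close> + 2 adds up two
  primitives and one source term.\<close>

definition rem_const :: real where "rem_const = lip_const * 2 powr p + 3 * log_const + 2"

lemma rem_const_ge: "lip_const * 2 powr p \<le> rem_const" "3 * log_const + 2 \<le> rem_const" "lip_const \<le> rem_const" "0 \<le> rem_const"
proof -
  have "1 \<le> 2 powr p" using p by (intro ge_one_powr_ge_zero) auto
  from mult_left_mono[OF this lip_const_ge(3)] have "lip_const \<le> lip_const * 2 powr p" by simp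
  with lip_const_ge(3) log_const_ge show "lip_const * 2 powr p \<le> rem_const" "3 * log_const + 2 \<le> rem_const"
    "lip_const \<le> rem_const" "0 \<le> rem_const"
    unfolding rem_const_def by linarith+
qed

text \<open>A second-order Taylor remainder obtained from first-order facts: the mean value theorem
  turns the difference of primitives into (a - b) times the source at an intermediate point, and the
  Lipschitz bound controls its distance from the source at b. When a b is not positive, each term is
  separately of second order in a - b.\<close>

lemma log_primitive_remainder:
  "\<bar>log_primitive p a - log_primitive p b - log_source p b * (a - b)\<bar> \<le> rem_const * growth a b * (a - b)\<^sup>2"
proof -
  have pos: "\<bar>log_primitive p a - log_primitive p b - log_source p b * (a - b)\<bar> \<le> rem_const * growth a b * (a - b)\<^sup>2"
    if ab: "0 < a" "0 < b" for a b
  proof (cases "a = b")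
    case False
    have "\<exists>z. min a b < z \<and> z < max a b \<and> log_primitive p a - log_primitive p b = (a - b) * log_source p z"
    proof (cases "b < a")
      case True
      then obtain z where "b < z" "z < a" "log_primitive p a - log_primitive p b = (a - b) * log_source p z"
        using MVT2[OF True log_primitive_deriv] ab by fastforce
      with True show ?thesis by (intro exI[of _ z]) auto
    next
      case 2: False
      then have "a < b" using False by simp
      then obtain z where z: "a < z" "z < b" "log_primitive p b - log_primitive p a = (b - a) * log_source p z"
        using MVT2[OF \<open>a < b\<close> log_primitive_deriv] ab by fastforce
      then have "log_primitive p a - log_primitive p b = (a - b) * log_source p z" by (simp add: algebra_simps)
      with z show ?thesis by (intro exI[of _ z]) auto
    qed
    then obtain z where z: "min a b < z" "z < max a b"
      "log_primitive p a - log_primitive p b = (a - b) * log_source p z" by blast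
    have zb: "\<bar>z - b\<bar> \<le> \<bar>a - b\<bar>" using z by (auto simp: min_def max_def split: if_splits)
    have "growth z b \<le> 2 powr p * growth a b"
    proof -
      have "growth z b \<le> (2 * (1 + \<bar>a\<bar> + \<bar>b\<bar>)) powr p"
        unfolding growth_def using z ab p by (intro powr_mono2) (auto simp: min_def max_def split: if_splits)
      also have "\<dots> = 2 powr p * (1 + \<bar>a\<bar> + \<bar>b\<bar>) powr p" by (rule powr_mult)
      finally show ?thesis by (simp add: growth_def)
    qed
    then have g: "lip_const * growth z b \<le> rem_const * growth a b"
      using mult_left_mono[of "growth z b" "2 powr p * growth a b" lip_const] lip_const_ge(3)
        mult_right_mono[OF rem_const_ge(1) growth_ge(1)[of a b]] by (simp add: mult.assoc)
    have "\<bar>log_primitive p a - log_primitive p b - log_source p b * (a - b)\<bar> = \<bar>log_source p z - log_source p b\<bar> * \<bar>a - b\<bar>"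
      unfolding z(3) by (simp add: abs_mult[symmetric] algebra_simps)
    also have "\<dots> \<le> (lip_const * growth z b * \<bar>z - b\<bar>) * \<bar>a - b\<bar>"
      by (intro mult_right_mono log_source_Lipschitz) simp
    also have "\<dots> \<le> (rem_const * growth a b * \<bar>a - b\<bar>) * \<bar>a - b\<bar>"
      by (intro mult_right_mono mult_mono[OF g zb]) (auto intro: mult_nonneg_nonneg rem_const_ge(4) growth_ge(1))
    also have "\<dots> = rem_const * growth a b * (a - b)\<^sup>2" by (simp add: power2_eq_square)
    finally show ?thesis .
  qed simp
  have "0 < a \<and> 0 < b \<or> a < 0 \<and> b < 0 \<or> a * b \<le> 0" unfolding mult_le_0_iff by linarith
  then consider "0 < a" "0 < b" | "a < 0" "b < 0" | "a * b \<le> 0" by blast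
  then show ?thesis
  proof cases
    case 1
    then show ?thesis by (rule pos)
  next
    case 2
    have "(b - a)\<^sup>2 = (a - b)\<^sup>2" by (simp add: power2_commute)
    then show ?thesis using pos[of "- a" "- b"] 2
      by (simp add: log_source_minus log_primitive_minus growth_def algebra_simps)
  next
    case 3
    then have ab: "\<bar>a\<bar> \<le> \<bar>a - b\<bar>" "\<bar>b\<bar> \<le> \<bar>a - b\<bar>" by (auto simp: mult_le_0_iff)
    have prim: "\<bar>log_primitive p s\<bar> \<le> (log_const + 1) * growth a b * (a - b)\<^sup>2"
      if "\<bar>s\<bar> \<le> \<bar>a - b\<bar>" "(1 + \<bar>s\<bar>) powr p \<le> growth a b" for s
      using that growth_ge(1)[of a b] log_const_ge
      by (intro order_trans[OF log_primitive_bound] mult_mono) (auto simp: abs_le_square_iff)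
    have src: "\<bar>log_source p b * (a - b)\<bar> \<le> log_const * growth a b * (a - b)\<^sup>2"
    proof -
      have "\<bar>log_source p b * (a - b)\<bar> \<le> (log_const * growth a b * \<bar>a - b\<bar>) * \<bar>a - b\<bar>"
        unfolding abs_mult using ab growth_ge[where a=a and b=b] log_const_ge
        by (intro mult_right_mono order_trans[OF log_source_bound] mult_mono) auto
      then show ?thesis by (simp add: power2_eq_square)
    qed
    have "\<bar>log_primitive p a - log_primitive p b - log_source p b * (a - b)\<bar>
        \<le> \<bar>log_primitive p a\<bar> + \<bar>log_primitive p b\<bar> + \<bar>log_source p b * (a - b)\<bar>" by linarith
    also have "\<dots> \<le> (3 * log_const + 2) * (growth a b * (a - b)\<^sup>2)"
      using prim[OF ab(1) growth_ge(2)] prim[OF ab(2) growth_ge(3)] src by (simp add: algebra_simps)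
    also have "\<dots> \<le> rem_const * (growth a b * (a - b)\<^sup>2)"
      using growth_ge(1)[of a b] by (intro mult_right_mono rem_const_ge) auto
    finally show ?thesis by (simp add: mult.assoc)
  qed
qed

end

lemma log_source_estimates:
  assumes "1 < p"
  obtains C where "0 \<le> C"
    "\<And>a b. \<bar>log_source p a - log_source p b\<bar> \<le> C * (1 + \<bar>a\<bar> + \<bar>b\<bar>) powr p * \<bar>a - b\<bar>"
    "\<And>a b. \<bar>log_primitive p a - log_primitive p b - log_source p b * (a - b)\<bar> \<le> C * (1 + \<bar>a\<bar> + \<bar>b\<bar>) powr p * (a - b)\<^sup>2"
proof
  show "0 \<le> rem_const p" by (rule rem_const_ge[OF assms])
  fix a b
  show "\<bar>log_source p a - log_source p b\<bar> \<le> rem_const p * (1 + \<bar>a\<bar> + \<bar>b\<bar>) powr p * \<bar>a - b\<bar>"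
    using log_source_Lipschitz[OF assms, of a b]
      mult_right_mono[OF rem_const_ge(3)[OF assms], of "(1 + \<bar>a\<bar> + \<bar>b\<bar>) powr p * \<bar>a - b\<bar>"]
    by (simp add: growth_def[OF assms] mult.assoc)
  show "\<bar>log_primitive p a - log_primitive p b - log_source p b * (a - b)\<bar> \<le> rem_const p * (1 + \<bar>a\<bar> + \<bar>b\<bar>) powr p * (a - b)\<^sup>2"
    using log_primitive_remainder[OF assms, of a b] by (simp add: growth_def[OF assms])
qed

section \<open>Sobolev inequality and nonlinear functionals on the closed subspace\<close>

abbreviation val :: "('a::euclidean_space, real \<times> 'a) L2fun \<Rightarrow> 'a \<Rightarrow> real" where
  "val h x \<equiv> fst (of_L2 h x)"

lemma borel_measurable_val [measurable]: "val h \<in> borel_measurable lebesgue"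
  by (rule square_integrable_measurable[OF square_integrable_fst_snd(1)])

text \<open>The bound extends from test functions by Fatou's lemma along a subsequence that
  converges almost everywhere; the right-hand side is continuous in h. Integrability belongs to the
  conclusion, since h is initially known only to be square integrable.\<close>

theorem Sobolev_inequality_H01:
  fixes U :: "'a::euclidean_space set"
  assumes U: "bounded U" and r: "2 < r" and \<beta>: "real DIM('a) * (r - 2) / (2 * r) < 1"
  shows "\<exists>C>0. \<forall>h\<in>H01_space U. integrable lebesgue (\<lambda>x. \<bar>val h x\<bar> powr r) \<and>
    (\<integral>x. \<bar>val h x\<bar> powr r \<partial>lebesgue) \<le> (C * norm (sndL h)) powr r"
proof -
  obtain C where C: "C > 0" and S: "\<And>\<phi>. \<phi> \<in> test_functions U \<Longrightarrow>
      (\<integral>x. \<bar>\<phi> x\<bar> powr r \<partial>lborel) \<le> (C * sqrt (\<integral>x. (norm (grad \<phi> x))\<^sup>2 \<partial>lborel)) powr r"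
    using Sobolev_inequality_test[OF assms] by blast
  have test: "(\<integral>\<^sup>+x. ennreal (\<bar>val h x\<bar> powr r) \<partial>lebesgue) \<le> ennreal ((C * norm (sndL h)) powr r)"
    if "h \<in> H01_test U" for h
  proof -
    obtain \<phi> where \<phi>: "\<phi> \<in> test_functions U" and h: "h = to_L2 (\<lambda>x. (\<phi> x, grad \<phi> x))"
      using \<open>h \<in> H01_test U\<close> by (auto simp: H01_test_def)
    note C1 = test_functionD(1)[OF \<phi>, of 1]
    obtain R where R: "\<And>x. x \<notin> cball 0 R \<Longrightarrow> \<phi> x = 0" using test_function_support[OF \<phi>] by metis
    have int_r: "integrable lborel (\<lambda>x. \<bar>\<phi> x\<bar> powr r)"
      by (rule integrable_compactly_supported[of _ R])
         (use r R C_k_imp_continuous[OF C1, of UNIV] in \<open>auto intro!: continuous_intros continuous_on_powr'\<close>)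
    have [measurable]: "grad \<phi> \<in> borel_measurable borel"
      using continuous_grad[of 0 \<phi> UNIV] C1 by (intro borel_measurable_continuous_onI) simp
    have "(norm (sndL h))\<^sup>2 = (\<integral>x. (norm (grad \<phi> x))\<^sup>2 \<partial>lborel)"
      using square_integrable_test[OF \<phi>] unfolding h
      by (subst sndL_to_L2) (simp_all add: norm_to_L2_square integral_completion)
    then have sn: "norm (sndL h) = sqrt (\<integral>x. (norm (grad \<phi> x))\<^sup>2 \<partial>lborel)"
      by (metis norm_ge_zero real_sqrt_unique)
    have "(\<integral>\<^sup>+x. ennreal (\<bar>val h x\<bar> powr r) \<partial>lebesgue) = (\<integral>\<^sup>+x. ennreal (\<bar>\<phi> x\<bar> powr r) \<partial>lebesgue)"
      by (rule nn_integral_cong_AE, use of_L2_to_L2[OF square_integrable_test(3)[OF \<phi>]] in \<open>unfold h, eventually_elim, simp\<close>)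
    also have "\<dots> = (\<integral>\<^sup>+x. ennreal (\<bar>\<phi> x\<bar> powr r) \<partial>lborel)"
      using int_r by (simp add: nn_integral_completion)
    also have "\<dots> = ennreal (\<integral>x. \<bar>\<phi> x\<bar> powr r \<partial>lborel)"
      using int_r by (rule nn_integral_eq_integral) simp
    also have "\<dots> \<le> ennreal ((C * norm (sndL h)) powr r)"
      unfolding sn by (intro ennreal_leI S \<phi>)
    finally show ?thesis .
  qed
  have bound: "(\<integral>\<^sup>+x. ennreal (\<bar>val h x\<bar> powr r) \<partial>lebesgue) \<le> ennreal ((C * norm (sndL h)) powr r)"
    if "h \<in> H01_space U" for h
  proof -
    obtain X where X: "\<And>n. X n \<in> H01_test U" "X \<longlonglongrightarrow> h"
      using \<open>h \<in> H01_space U\<close> unfolding H01_space_def closure_sequential by blast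
    obtain s where s: "strict_mono (s :: nat \<Rightarrow> nat)"
      "AE t in lebesgue. (\<lambda>n. of_L2 (X (s n)) t) \<longlonglongrightarrow> of_L2 h t"
      using L2_tendsto_AE_subseq[OF X(2)] by blast
    have Xs: "(\<lambda>n. X (s n)) \<longlonglongrightarrow> h"
      using LIMSEQ_subseq_LIMSEQ[OF X(2) s(1)] by (simp add: comp_def)
    have "(\<integral>\<^sup>+x. ennreal (\<bar>val h x\<bar> powr r) \<partial>lebesgue)
        = (\<integral>\<^sup>+x. liminf (\<lambda>n. ennreal (\<bar>val (X (s n)) x\<bar> powr r)) \<partial>lebesgue)"
    proof (rule nn_integral_cong_AE, use s(2) in eventually_elim)
      case (elim t)
      have "(\<lambda>n. ennreal (\<bar>val (X (s n)) t\<bar> powr r)) \<longlonglongrightarrow> ennreal (\<bar>val h t\<bar> powr r)"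
        using r by (intro tendsto_intros tendsto_powr' elim) auto
      from lim_imp_Liminf[OF _ this] show ?case by simp
    qed
    also have "\<dots> \<le> liminf (\<lambda>n. \<integral>\<^sup>+x. ennreal (\<bar>val (X (s n)) x\<bar> powr r) \<partial>lebesgue)"
      by (rule nn_integral_liminf) measurable
    also have "\<dots> \<le> liminf (\<lambda>n. ennreal ((C * norm (sndL (X (s n)))) powr r))"
      by (intro Liminf_mono always_eventually allI test X)
    also have "\<dots> = ennreal ((C * norm (sndL h)) powr r)"
    proof (rule lim_imp_Liminf)
      show "(\<lambda>n. ennreal ((C * norm (sndL (X (s n)))) powr r)) \<longlonglongrightarrow> ennreal ((C * norm (sndL h)) powr r)"
        using r C by (intro tendsto_intros tendsto_powr' bounded_linear.tendsto[OF bounded_linear_sndL Xs]) auto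
    qed simp
    finally show ?thesis .
  qed
  show ?thesis
  proof (intro exI[of _ C] conjI C ballI)
    fix h assume h: "h \<in> H01_space U"
    show i: "integrable lebesgue (\<lambda>x. \<bar>val h x\<bar> powr r)"
    proof (rule integrableI_bounded)
      have "(\<integral>\<^sup>+x. ennreal (norm (\<bar>val h x\<bar> powr r)) \<partial>lebesgue) \<le> ennreal ((C * norm (sndL h)) powr r)"
        using bound[OF h] by simp
      also have "\<dots> < \<infinity>" by simp
      finally show "(\<integral>\<^sup>+x. ennreal (norm (\<bar>val h x\<bar> powr r)) \<partial>lebesgue) < \<infinity>" .
    qed measurable
    have "ennreal (\<integral>x. \<bar>val h x\<bar> powr r \<partial>lebesgue) \<le> ennreal ((C * norm (sndL h)) powr r)"
      using bound[OF h] by (subst (asm) nn_integral_eq_integral[OF i]) auto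
    then show "(\<integral>x. \<bar>val h x\<bar> powr r \<partial>lebesgue) \<le> (C * norm (sndL h)) powr r"
      by (subst (asm) ennreal_le_iff) auto
  qed
qed

text \<open>Each factor is at most the maximum of a, b, c, and the power p + 2 of the maximum is one
  of the summands. This coarse form of Young's inequality costs only a constant.\<close>

lemma powr_trilinear_le:
  fixes a b c p :: real
  assumes "0 \<le> a" "0 \<le> b" "0 \<le> c" "0 < p"
  shows "a powr p * b * c \<le> a powr (p + 2) + b powr (p + 2) + c powr (p + 2)"
proof -
  define m where "m = max a (max b c)"
  have m: "a \<le> m" "b \<le> m" "c \<le> m" "0 \<le> m" using assms by (auto simp: m_def)
  have "a powr p * b * c \<le> m powr p * m * m"
    using m assms by (intro mult_mono powr_mono2) auto
  also have "\<dots> = m powr (p + 2)"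
    using m by (cases "m = 0") (auto simp: powr_add power2_eq_square)
  also have "\<dots> \<le> a powr (p + 2) + b powr (p + 2) + c powr (p + 2)"
    by (auto simp: m_def max_def)
  finally show ?thesis .
qed

text \<open>Hoelder's inequality with exponents (p + 2) / p, p + 2 and p + 2, up to the factor 3:
  each function is divided by its norm bound before the pointwise inequality is integrated.\<close>

lemma integral_trilinear_bound:
  fixes \<alpha> \<beta> \<gamma> :: "'a \<Rightarrow> real" and p :: real
  assumes p: "0 < p"
    and [measurable]: "\<alpha> \<in> borel_measurable M" "\<beta> \<in> borel_measurable M" "\<gamma> \<in> borel_measurable M"
    and nonneg: "\<And>x. 0 \<le> \<alpha> x" "\<And>x. 0 \<le> \<beta> x" "\<And>x. 0 \<le> \<gamma> x"
    and int: "integrable M (\<lambda>x. \<alpha> x powr (p + 2))" "integrable M (\<lambda>x. \<beta> x powr (p + 2))" "integrable M (\<lambda>x. \<gamma> x powr (p + 2))"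
    and pos: "0 < A" "0 < B" "0 < D"
    and le: "(\<integral>x. \<alpha> x powr (p + 2) \<partial>M) \<le> A powr (p + 2)" "(\<integral>x. \<beta> x powr (p + 2) \<partial>M) \<le> B powr (p + 2)"
      "(\<integral>x. \<gamma> x powr (p + 2) \<partial>M) \<le> D powr (p + 2)"
  shows "integrable M (\<lambda>x. \<alpha> x powr p * \<beta> x * \<gamma> x)"
    "(\<integral>x. \<alpha> x powr p * \<beta> x * \<gamma> x \<partial>M) \<le> 3 * A powr p * B * D"
proof -
  define q where "q = p + 2"
  define w where "w x = (\<alpha> x powr q / A powr q + \<beta> x powr q / B powr q + \<gamma> x powr q / D powr q) * (A powr p * B * D)" for x
  have iw: "integrable M w" unfolding w_def[abs_def] using int by (simp add: q_def)
  have pt: "\<alpha> x powr p * \<beta> x * \<gamma> x \<le> w x" for x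
  proof -
    have "(\<alpha> x / A) powr p * (\<beta> x / B) * (\<gamma> x / D) \<le> (\<alpha> x / A) powr q + (\<beta> x / B) powr q + (\<gamma> x / D) powr q"
      unfolding q_def using p pos nonneg by (intro powr_trilinear_le) auto
    then have "(\<alpha> x / A) powr p * (\<beta> x / B) * (\<gamma> x / D) * (A powr p * B * D) \<le> w x"
      unfolding w_def using pos nonneg
      by (intro mult_right_mono) (auto simp: powr_divide less_imp_le)
    moreover have "(\<alpha> x / A) powr p * (\<beta> x / B) * (\<gamma> x / D) * (A powr p * B * D) = \<alpha> x powr p * \<beta> x * \<gamma> x"
      using pos nonneg[of x] by (simp add: powr_divide less_imp_le)
    ultimately show ?thesis by simp
  qed
  show i: "integrable M (\<lambda>x. \<alpha> x powr p * \<beta> x * \<gamma> x)"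
    by (rule Bochner_Integration.integrable_bound[OF iw])
       (use nonneg in \<open>auto intro!: AE_I2 order_trans[OF pt abs_ge_self]\<close>)
  have "(\<integral>x. \<alpha> x powr p * \<beta> x * \<gamma> x \<partial>M) \<le> (\<integral>x. w x \<partial>M)"
    by (intro integral_mono i iw pt)
  also have "\<dots> = ((\<integral>x. \<alpha> x powr q \<partial>M) / A powr q + (\<integral>x. \<beta> x powr q \<partial>M) / B powr q + (\<integral>x. \<gamma> x powr q \<partial>M) / D powr q) * (A powr p * B * D)"
    unfolding w_def[abs_def] using int by (simp add: q_def)
  also have "\<dots> \<le> (1 + 1 + 1) * (A powr p * B * D)"
    using pos le by (intro mult_right_mono add_mono) (auto simp: q_def divide_le_eq_1)
  finally show "(\<integral>x. \<alpha> x powr p * \<beta> x * \<gamma> x \<partial>M) \<le> 3 * A powr p * B * D" by simp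
qed

text \<open>For r = p + 2 the condition \<beta> < 1 reads n p < 2 (p + 2), that is p (n - 2) < 4.
  This is automatic for n at most 2 and the upper bound on p otherwise.\<close>

lemma subcritical_exponent:
  fixes p :: real
  assumes "(n \<le> 2 \<and> 1 < p) \<or> (3 \<le> n \<and> n \<le> 5 \<and> 1 < p \<and> p < 4 / (real n - 2))"
  shows "1 < p" "real n * ((p + 2) - 2) / (2 * (p + 2)) < 1"
proof -
  show p: "1 < p" using assms by auto
  have "real n * p < 2 * (p + 2)"
  proof (cases "n \<le> 2")
    case True
    then have "real n * p \<le> 2 * p" using p by (intro mult_right_mono) auto
    then show ?thesis by simp
  next
    case False
    then have "p * (real n - 2) < 4" using assms by (auto simp: less_divide_eq)
    then show ?thesis by (simp add: algebra_simps)
  qed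
  then show "real n * ((p + 2) - 2) / (2 * (p + 2)) < 1" using p by (simp add: divide_less_eq)
qed

lemma val_zero: "AE x in (lebesgue :: 'a::euclidean_space measure). val 0 x = 0"
  by (rule eventually_mono[OF of_L2_zero[where 'a='a and 'b="real \<times> 'a"]]) simp

lemma val_add: "AE x in lebesgue. val (v + w) x = val v x + val w x"
  using of_L2_add[of v w] by eventually_elim simp

lemma val_diff: "AE x in lebesgue. val (v - w) x = val v x - val w x"
  using of_L2_diff[of v w] by eventually_elim simp

lemma val_scaleR: "AE x in lebesgue. val (c *\<^sub>R v) x = c * val v x"
  using of_L2_scaleR[of c v] by eventually_elim simp

lemma borel_measurable_log_source [measurable]: "log_source p \<in> borel_measurable borel"
  unfolding log_source_def[abs_def] by measurable

lemma borel_measurable_log_primitive [measurable]: "log_primitive p \<in> borel_measurable borel"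
  unfolding log_primitive_def[abs_def] by measurable

text \<open>The constant depends on a and b only through the radius R, while w and z enter linearly
  in their norms. This shape yields Lipschitz and second-order estimates that are uniform on
  balls.\<close>

lemma growth_trilinear_bound:
  fixes U :: "'a::euclidean_space set"
  assumes U: "open U" "bounded U" and p: "1 < p" and \<beta>: "real DIM('a) * ((p + 2) - 2) / (2 * (p + 2)) < 1"
  shows "\<exists>K\<ge>0. \<forall>a\<in>H01_space U. \<forall>b\<in>H01_space U. \<forall>w\<in>H01_space U. \<forall>z\<in>H01_space U. norm a \<le> R \<longrightarrow> norm b \<le> R \<longrightarrow>
     integrable lebesgue (\<lambda>x. (1 + \<bar>val a x\<bar> + \<bar>val b x\<bar>) powr p * \<bar>val w x\<bar> * \<bar>val z x\<bar>) \<and>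
     (\<integral>x. (1 + \<bar>val a x\<bar> + \<bar>val b x\<bar>) powr p * \<bar>val w x\<bar> * \<bar>val z x\<bar> \<partial>lebesgue) \<le> K * norm w * norm z"
proof -
  define q where "q = p + 2"
  have q: "2 < q" using p by (simp add: q_def)
  obtain S where S: "S > 0" and Sob: "\<And>h. h \<in> H01_space U \<Longrightarrow> integrable lebesgue (\<lambda>x. \<bar>val h x\<bar> powr q)"
    "\<And>h. h \<in> H01_space U \<Longrightarrow> (\<integral>x. \<bar>val h x\<bar> powr q \<partial>lebesgue) \<le> (S * norm (sndL h)) powr q"
    using Sobolev_inequality_H01[OF U(2) q] \<beta> unfolding q_def by blast
  have Sob': "(\<integral>x. \<bar>val h x\<bar> powr q \<partial>lebesgue) \<le> (S * norm h) powr q" if "h \<in> H01_space U" for h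
    using Sob(2)[OF that] norm_sndL_le[of h] S q
    by (elim order_trans) (intro powr_mono2 mult_left_mono, auto)
  have Us: "U \<in> sets lebesgue" using U by auto
  have iU: "integrable lebesgue (\<lambda>x. indicator U x :: real)"
    using emeasure_bounded_finite[OF U(2)] U(1) by (intro integrable_real_indicator) auto
  define R' where "R' = max R 0"
  \<comment> \<open>Bounds the integral of the q-th power of the weight cut to U, the factor 3^q
    coming from splitting a sum of three terms; the final 1 makes the bound positive.\<close>
  define m where "m = 3 powr q * ((\<integral>x. indicator U x \<partial>lebesgue) + (S * R') powr q + (S * R') powr q) + 1"
  have m: "m > 0" by (simp add: m_def add_nonneg_pos)
  define A where "A = m powr (1 / q)"
  have A: "A > 0" "A powr q = m" using m q by (auto simp: A_def powr_powr)
  define K where "K = 3 * A powr p * S * S"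
  have K: "K \<ge> 0" using S by (simp add: K_def)
  show ?thesis
  proof (intro exI[of _ K] conjI K ballI impI)
    fix a b w z :: "('a, real \<times> 'a) L2fun"
    assume H: "a \<in> H01_space U" "b \<in> H01_space U" "w \<in> H01_space U" "z \<in> H01_space U"
      and R: "norm a \<le> R" "norm b \<le> R"
    define F where "F x = (1 + \<bar>val a x\<bar> + \<bar>val b x\<bar>) powr p * \<bar>val w x\<bar> * \<bar>val z x\<bar>" for x
    \<comment> \<open>The summand 1 of the weight is not integrable over the whole space. As w
      vanishes almost everywhere outside U, the weight may be cut to U.\<close>
    define F' where "F' x = (indicator U x * (1 + \<bar>val a x\<bar> + \<bar>val b x\<bar>)) powr p * \<bar>val w x\<bar> * \<bar>val z x\<bar>" for x
    have [measurable]: "U \<in> sets lebesgue" by (rule Us)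
    have [measurable]: "F \<in> borel_measurable lebesgue" unfolding F_def[abs_def] by measurable
    have [measurable]: "F' \<in> borel_measurable lebesgue" unfolding F'_def[abs_def] by measurable
    have FF': "AE x in lebesgue. F x = F' x"
      using H01_space_outside[OF H(3) Us]
      by eventually_elim (auto simp: F_def F'_def indicator_def)
    have "integrable lebesgue F' \<and> (\<integral>x. F' x \<partial>lebesgue) \<le> K * norm w * norm z"
    \<comment> \<open>The trilinear bound divides by the norm bounds of w and z, so vanishing
      factors are treated apart.\<close>
    proof (cases "w = 0 \<or> z = 0")
      case True
      have "AE x in lebesgue. F' x = 0"
        using True
      proof
        assume "w = 0"
        show ?thesis using val_zero unfolding F'_def \<open>w = 0\<close> by eventually_elim simp
      next
        assume "z = 0"
        show ?thesis using val_zero unfolding F'_def \<open>z = 0\<close> by eventually_elim simp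
      qed
      then have "integrable lebesgue F'" "integral\<^sup>L lebesgue F' = 0"
        using integrable_cong_AE[of F' lebesgue "\<lambda>_. 0"] integral_cong_AE[of F' lebesgue "\<lambda>_. 0"] by simp_all
      then show ?thesis using K by simp
    next
      case False
      have bound: "(indicator U x * (1 + \<bar>val a x\<bar> + \<bar>val b x\<bar>)) powr q
          \<le> 3 powr q * (indicator U x + \<bar>val a x\<bar> powr q + \<bar>val b x\<bar> powr q)" for x
      proof (cases "x \<in> U")
        case True
        define M where "M = max 1 (max \<bar>val a x\<bar> \<bar>val b x\<bar>)"
        have "(1 + \<bar>val a x\<bar> + \<bar>val b x\<bar>) powr q \<le> (3 * M) powr q"
          using q by (intro powr_mono2) (auto simp: M_def)
        also have "\<dots> = 3 powr q * M powr q" by (rule powr_mult)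
        also have "\<dots> \<le> 3 powr q * (1 + \<bar>val a x\<bar> powr q + \<bar>val b x\<bar> powr q)"
          by (intro mult_left_mono) (auto simp: M_def max_def)
        finally show ?thesis using True by simp
      qed (use q in auto)
      have ib: "integrable lebesgue (\<lambda>x. 3 powr q * (indicator U x + \<bar>val a x\<bar> powr q + \<bar>val b x\<bar> powr q))"
        by (intro integrable_mult_right Bochner_Integration.integrable_add iU Sob(1) H)
      have i\<alpha>: "integrable lebesgue (\<lambda>x. (indicator U x * (1 + \<bar>val a x\<bar> + \<bar>val b x\<bar>)) powr q)"
      proof (rule Bochner_Integration.integrable_bound[OF ib])
        show "(\<lambda>x. (indicator U x * (1 + \<bar>val a x\<bar> + \<bar>val b x\<bar>)) powr q) \<in> borel_measurable lebesgue"
          by measurable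
        show "AE x in lebesgue. norm ((indicator U x * (1 + \<bar>val a x\<bar> + \<bar>val b x\<bar>)) powr q)
            \<le> norm (3 powr q * (indicator U x + \<bar>val a x\<bar> powr q + \<bar>val b x\<bar> powr q))"
          by (intro AE_I2, unfold real_norm_def abs_of_nonneg[OF powr_ge_zero]) (rule order_trans[OF bound abs_ge_self])
      qed
      have "(\<integral>x. (indicator U x * (1 + \<bar>val a x\<bar> + \<bar>val b x\<bar>)) powr q \<partial>lebesgue)
          \<le> (\<integral>x. 3 powr q * (indicator U x + \<bar>val a x\<bar> powr q + \<bar>val b x\<bar> powr q) \<partial>lebesgue)"
        by (intro integral_mono i\<alpha> ib bound)
      also have "\<dots> = 3 powr q * ((\<integral>x. indicator U x \<partial>lebesgue) + (\<integral>x. \<bar>val a x\<bar> powr q \<partial>lebesgue) + (\<integral>x. \<bar>val b x\<bar> powr q \<partial>lebesgue))"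
        using iU Sob(1)[OF H(1)] Sob(1)[OF H(2)] by simp
      also have "\<dots> \<le> 3 powr q * ((\<integral>x. indicator U x \<partial>lebesgue) + (S * R') powr q + (S * R') powr q)"
      proof -
        have "(S * norm h) powr q \<le> (S * R') powr q" if "norm h \<le> R" for h :: "('a, real \<times> 'a) L2fun"
          using that S q by (intro powr_mono2 mult_left_mono) (auto simp: R'_def)
        with R Sob'[OF H(1)] Sob'[OF H(2)] show ?thesis
          by (intro mult_left_mono add_mono) (auto intro: order_trans)
      qed
      also have "\<dots> \<le> A powr q" unfolding A(2) by (simp add: m_def)
      finally have le\<alpha>: "(\<integral>x. (indicator U x * (1 + \<bar>val a x\<bar> + \<bar>val b x\<bar>)) powr q \<partial>lebesgue) \<le> A powr q" .
      have Sw: "0 < S * norm w" "0 < S * norm z" using False S by auto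
      note tri = integral_trilinear_bound[of p "\<lambda>x. indicator U x * (1 + \<bar>val a x\<bar> + \<bar>val b x\<bar>)" lebesgue
          "\<lambda>x. \<bar>val w x\<bar>" "\<lambda>x. \<bar>val z x\<bar>" A "S * norm w" "S * norm z", folded q_def,
          OF _ _ _ _ _ _ _ i\<alpha> Sob(1)[OF H(3)] Sob(1)[OF H(4)] A(1) Sw le\<alpha> Sob'[OF H(3)] Sob'[OF H(4)]]
      have "integrable lebesgue F'" unfolding F'_def[abs_def]
        by (rule tri(1)) (use p in auto)
      moreover have "(\<integral>x. F' x \<partial>lebesgue) \<le> 3 * A powr p * (S * norm w) * (S * norm z)"
        unfolding F'_def[abs_def] by (rule tri(2)) (use p in auto)
      ultimately show ?thesis by (simp add: K_def mult_ac)
    qed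
    then have "integrable lebesgue F" "(\<integral>x. F x \<partial>lebesgue) \<le> K * norm w * norm z"
      using FF' integrable_cong_AE[of F lebesgue F'] integral_cong_AE[of F lebesgue F'] by simp_all
    then show "integrable lebesgue (\<lambda>x. (1 + \<bar>val a x\<bar> + \<bar>val b x\<bar>) powr p * \<bar>val w x\<bar> * \<bar>val z x\<bar>)"
      "(\<integral>x. (1 + \<bar>val a x\<bar> + \<bar>val b x\<bar>) powr p * \<bar>val w x\<bar> * \<bar>val z x\<bar> \<partial>lebesgue) \<le> K * norm w * norm z"
      unfolding F_def[abs_def] by simp_all
  qed
qed

definition energy :: "real \<Rightarrow> ('a::euclidean_space, real \<times> 'a) L2fun \<Rightarrow> real" where
  "energy p v = (norm (sndL v))\<^sup>2 / 2 - (\<integral>x. log_primitive p (val v x) \<partial>lebesgue)"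

text \<open>Provides what the abstract flow theorem asks of the vector field and its potential. The
  Lipschitz bound uses the trilinear estimate with the difference a - b and a test element; the
  remainder of the energy uses it with a - b in both places.\<close>

lemma potential_operator:
  fixes U :: "'a::euclidean_space set"
  assumes U: "open U" "bounded U" and p: "1 < p" and \<beta>: "real DIM('a) * ((p + 2) - 2) / (2 * (p + 2)) < 1"
  obtains G where
    "\<And>v. v \<in> H01_space U \<Longrightarrow> G v \<in> H01_space U"
    "\<And>v w. v \<in> H01_space U \<Longrightarrow> w \<in> H01_space U \<Longrightarrow> integrable lebesgue (\<lambda>x. log_source p (val v x) * val w x)"
    "\<And>v w. v \<in> H01_space U \<Longrightarrow> w \<in> H01_space U \<Longrightarrow>
        G v \<bullet> w = - (sndL v \<bullet> sndL w) + (\<integral>x. log_source p (val v x) * val w x \<partial>lebesgue)"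
    "\<And>v. v \<in> H01_space U \<Longrightarrow> integrable lebesgue (\<lambda>x. log_primitive p (val v x))"
    "G 0 = 0"
    "\<And>R. \<exists>L. \<forall>a\<in>H01_space U. \<forall>b\<in>H01_space U. norm a \<le> R \<longrightarrow> norm b \<le> R \<longrightarrow> norm (G a - G b) \<le> L * norm (a - b)"
    "\<And>R. \<exists>K. \<forall>a\<in>H01_space U. \<forall>b\<in>H01_space U. norm a \<le> R \<longrightarrow> norm b \<le> R \<longrightarrow>
        \<bar>energy p a - energy p b + G b \<bullet> (a - b)\<bar> \<le> K * (norm (a - b))\<^sup>2"
proof -
  define H where "H = H01_space U"
  have subH: "subspace H" unfolding H_def by (rule subspace_H01_space)
  have clH: "closed H" unfolding H_def by (rule closed_H01_space)
  have H0: "0 \<in> H" by (rule subspace_0[OF subH])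
  have Hd: "a - b \<in> H" if "a \<in> H" "b \<in> H" for a b using subH that by (rule subspace_diff)
  obtain C where C: "0 \<le> C"
    and f: "\<And>a b. \<bar>log_source p a - log_source p b\<bar> \<le> C * (1 + \<bar>a\<bar> + \<bar>b\<bar>) powr p * \<bar>a - b\<bar>"
    and F: "\<And>a b. \<bar>log_primitive p a - log_primitive p b - log_source p b * (a - b)\<bar> \<le> C * (1 + \<bar>a\<bar> + \<bar>b\<bar>) powr p * (a - b)\<^sup>2"
    using log_source_estimates[OF p] by metis
  have "\<forall>R. \<exists>K\<ge>0. \<forall>a\<in>H. \<forall>b\<in>H. \<forall>w\<in>H. \<forall>z\<in>H. norm a \<le> R \<longrightarrow> norm b \<le> R \<longrightarrow>
     integrable lebesgue (\<lambda>x. (1 + \<bar>val a x\<bar> + \<bar>val b x\<bar>) powr p * \<bar>val w x\<bar> * \<bar>val z x\<bar>) \<and>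
     (\<integral>x. (1 + \<bar>val a x\<bar> + \<bar>val b x\<bar>) powr p * \<bar>val w x\<bar> * \<bar>val z x\<bar> \<partial>lebesgue) \<le> K * norm w * norm z"
    unfolding H_def by (intro allI growth_trilinear_bound U p \<beta>)
  from choice[OF this] obtain K where KK: "\<forall>R. 0 \<le> K R \<and> (\<forall>a\<in>H. \<forall>b\<in>H. \<forall>w\<in>H. \<forall>z\<in>H. norm a \<le> R \<longrightarrow> norm b \<le> R \<longrightarrow>
     integrable lebesgue (\<lambda>x. (1 + \<bar>val a x\<bar> + \<bar>val b x\<bar>) powr p * \<bar>val w x\<bar> * \<bar>val z x\<bar>) \<and>
     (\<integral>x. (1 + \<bar>val a x\<bar> + \<bar>val b x\<bar>) powr p * \<bar>val w x\<bar> * \<bar>val z x\<bar> \<partial>lebesgue) \<le> K R * norm w * norm z)"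
    by (rule exE)
  then have K: "0 \<le> K R" for R by simp
  have Kib: "integrable lebesgue (\<lambda>x. (1 + \<bar>val a x\<bar> + \<bar>val b x\<bar>) powr p * \<bar>val w x\<bar> * \<bar>val z x\<bar>) \<and>
     (\<integral>x. (1 + \<bar>val a x\<bar> + \<bar>val b x\<bar>) powr p * \<bar>val w x\<bar> * \<bar>val z x\<bar> \<partial>lebesgue) \<le> K R * norm w * norm z"
    if "a \<in> H" "b \<in> H" "w \<in> H" "z \<in> H" "norm a \<le> R" "norm b \<le> R" for a b w z R
    using KK[THEN spec, of R, THEN conjunct2, rule_format, OF that] .
  note Ki = Kib[THEN conjunct1] and Kb = Kib[THEN conjunct2]
  \<comment> \<open>All nonlinear integrals below are controlled in this way; the bounds for a
    single element v are the case in which the second argument of the weight is 0.\<close>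
  have dominated: "integrable lebesgue g \<and> \<bar>\<integral>x. g x \<partial>lebesgue\<bar> \<le> C * (K R * norm w * norm z)"
    if H: "a \<in> H" "b \<in> H" "w \<in> H" "z \<in> H" and R: "norm a \<le> R" "norm b \<le> R"
      and [measurable]: "g \<in> borel_measurable lebesgue"
      and g: "AE x in lebesgue. \<bar>g x\<bar> \<le> C * ((1 + \<bar>val a x\<bar> + \<bar>val b x\<bar>) powr p * \<bar>val w x\<bar> * \<bar>val z x\<bar>)"
    for g a b w z R
  proof
    note i = integrable_mult_right[OF Ki[OF H R], of C]
    show ig: "integrable lebesgue g"
      by (rule Bochner_Integration.integrable_bound[OF i])
         (measurable, use g in \<open>auto elim!: eventually_mono intro: order_trans[OF _ abs_ge_self]\<close>)
    have "\<bar>\<integral>x. g x \<partial>lebesgue\<bar> \<le> (\<integral>x. \<bar>g x\<bar> \<partial>lebesgue)" by (rule integral_abs_bound)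
    also have "\<dots> \<le> (\<integral>x. C * ((1 + \<bar>val a x\<bar> + \<bar>val b x\<bar>) powr p * \<bar>val w x\<bar> * \<bar>val z x\<bar>) \<partial>lebesgue)"
      by (rule integral_mono_AE[OF integrable_abs[OF ig] i g])
    also have "\<dots> = C * (\<integral>x. (1 + \<bar>val a x\<bar> + \<bar>val b x\<bar>) powr p * \<bar>val w x\<bar> * \<bar>val z x\<bar> \<partial>lebesgue)"
      by simp
    also have "\<dots> \<le> C * (K R * norm w * norm z)" by (intro mult_left_mono Kb H R C)
    finally show "\<bar>\<integral>x. g x \<partial>lebesgue\<bar> \<le> C * (K R * norm w * norm z)" .
  qed
  have f_diff: "integrable lebesgue (\<lambda>x. (log_source p (val a x) - log_source p (val b x)) * val w x) \<and>
      \<bar>\<integral>x. (log_source p (val a x) - log_source p (val b x)) * val w x \<partial>lebesgue\<bar> \<le> C * (K R * norm (a - b) * norm w)"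
    if H: "a \<in> H" "b \<in> H" "w \<in> H" and R: "norm a \<le> R" "norm b \<le> R" for a b w R
  proof (rule dominated[OF H(1,2) Hd[OF H(1,2)] H(3) R])
    show "AE x in lebesgue. \<bar>(log_source p (val a x) - log_source p (val b x)) * val w x\<bar>
        \<le> C * ((1 + \<bar>val a x\<bar> + \<bar>val b x\<bar>) powr p * \<bar>val (a - b) x\<bar> * \<bar>val w x\<bar>)"
      using val_diff[of a b]
    proof eventually_elim
      case (elim x)
      then show ?case
        using mult_right_mono[OF f[of "val a x" "val b x"], of "\<bar>val w x\<bar>"] by (simp add: abs_mult mult.assoc)
    qed
  qed measurable
  have f_int: "integrable lebesgue (\<lambda>x. log_source p (val v x) * val w x)"
    and f_bound: "\<bar>\<integral>x. log_source p (val v x) * val w x \<partial>lebesgue\<bar> \<le> C * K (norm v) * norm v * norm w"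
    if H: "v \<in> H" "w \<in> H" for v w
  proof -
    have *: "integrable lebesgue (\<lambda>x. log_source p (val v x) * val w x) \<and>
       \<bar>\<integral>x. log_source p (val v x) * val w x \<partial>lebesgue\<bar> \<le> C * (K (norm v) * norm v * norm w)"
    proof (rule dominated[OF H(1) H0 H(1,2)])
      show "AE x in lebesgue. \<bar>log_source p (val v x) * val w x\<bar>
          \<le> C * ((1 + \<bar>val v x\<bar> + \<bar>val 0 x\<bar>) powr p * \<bar>val v x\<bar> * \<bar>val w x\<bar>)"
        using val_zero
      proof eventually_elim
        case (elim x)
        then show ?case
          using mult_right_mono[OF f[of "val v x" 0], of "\<bar>val w x\<bar>"] by (simp add: abs_mult mult.assoc)
      qed
      show "(\<lambda>x. log_source p (val v x) * val w x) \<in> borel_measurable lebesgue" by measurable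
    qed auto
    show "integrable lebesgue (\<lambda>x. log_source p (val v x) * val w x)"
      "\<bar>\<integral>x. log_source p (val v x) * val w x \<partial>lebesgue\<bar> \<le> C * K (norm v) * norm v * norm w"
      using * by (simp_all add: mult.assoc)
  qed
  have F_int: "integrable lebesgue (\<lambda>x. log_primitive p (val v x))" if v: "v \<in> H" for v
  proof -
    have "integrable lebesgue (\<lambda>x. log_primitive p (val v x)) \<and>
       \<bar>\<integral>x. log_primitive p (val v x) \<partial>lebesgue\<bar> \<le> C * (K (norm v) * norm v * norm v)"
    proof (rule dominated[OF v H0 v v])
      show "AE x in lebesgue. \<bar>log_primitive p (val v x)\<bar>
          \<le> C * ((1 + \<bar>val v x\<bar> + \<bar>val 0 x\<bar>) powr p * \<bar>val v x\<bar> * \<bar>val v x\<bar>)"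
        using val_zero
      proof eventually_elim
        case (elim x)
        then show ?case using F[of "val v x" 0] by (simp add: mult.assoc power2_eq_square)
      qed
      show "(\<lambda>x. log_primitive p (val v x)) \<in> borel_measurable lebesgue" by measurable
    qed auto
    then show ?thesis by blast
  qed
  define l where "l v w = - (sndL v \<bullet> sndL w) + (\<integral>x. log_source p (val v x) * val w x \<partial>lebesgue)"
    for v w :: "('a, real \<times> 'a) L2fun"
  have "\<exists>g\<in>H. \<forall>w\<in>H. l v w = g \<bullet> w" if v: "v \<in> H" for v
  proof (rule Riesz_closed_subspace[OF subH clH])
    show "l v (w + z) = l v w + l v z" if wz: "w \<in> H" "z \<in> H" for w z
    proof -
      have "(\<integral>x. log_source p (val v x) * val (w + z) x \<partial>lebesgue)
          = (\<integral>x. log_source p (val v x) * val w x + log_source p (val v x) * val z x \<partial>lebesgue)"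
      proof (rule integral_cong_AE)
        show "AE x in lebesgue. log_source p (val v x) * val (w + z) x
            = log_source p (val v x) * val w x + log_source p (val v x) * val z x"
          using val_add[of w z] by eventually_elim (simp add: distrib_left)
      qed measurable
      then show ?thesis
        using f_int[OF v] wz by (simp add: l_def sndL_add inner_add_right)
    qed
    show "l v (c *\<^sub>R w) = c * l v w" if w: "w \<in> H" for c w
    proof -
      have "(\<integral>x. log_source p (val v x) * val (c *\<^sub>R w) x \<partial>lebesgue)
          = (\<integral>x. c * (log_source p (val v x) * val w x) \<partial>lebesgue)"
      proof (rule integral_cong_AE)
        show "AE x in lebesgue. log_source p (val v x) * val (c *\<^sub>R w) x = c * (log_source p (val v x) * val w x)"
          using val_scaleR[of c w] by eventually_elim simp
      qed measurable
      then show ?thesis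
        by (simp add: l_def sndL_scaleR algebra_simps)
    qed
    show "\<bar>l v w\<bar> \<le> (norm v + C * K (norm v) * norm v) * norm w" if w: "w \<in> H" for w
    proof -
      have "\<bar>sndL v \<bullet> sndL w\<bar> \<le> norm v * norm w"
        by (rule order_trans[OF Cauchy_Schwarz_ineq2]) (intro mult_mono norm_sndL_le; simp)
      with f_bound[OF v w] show ?thesis by (simp add: l_def distrib_right)
    qed
  qed
  then obtain G0 where G0: "\<And>v. v \<in> H \<Longrightarrow> G0 v \<in> H" "\<And>v w. v \<in> H \<Longrightarrow> w \<in> H \<Longrightarrow> l v w = G0 v \<bullet> w" by metis
  have G_diff: "(G0 a - G0 b) \<bullet> w = - (sndL (a - b) \<bullet> sndL w)
      + (\<integral>x. (log_source p (val a x) - log_source p (val b x)) * val w x \<partial>lebesgue)"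
    if "a \<in> H" "b \<in> H" "w \<in> H" for a b w
  proof -
    have "(\<integral>x. (log_source p (val a x) - log_source p (val b x)) * val w x \<partial>lebesgue)
        = (\<integral>x. log_source p (val a x) * val w x \<partial>lebesgue) - (\<integral>x. log_source p (val b x) * val w x \<partial>lebesgue)"
      unfolding left_diff_distrib using that by (intro Bochner_Integration.integral_diff f_int)
    then show ?thesis
      using G0(2)[OF that(1,3)] G0(2)[OF that(2,3)]
      by (simp add: l_def inner_diff_left sndL_diff)
  qed
  show ?thesis
  proof (rule that[of G0])
    show "G0 v \<in> H01_space U" if "v \<in> H01_space U" for v using G0(1) that by (simp add: H_def)
    show "integrable lebesgue (\<lambda>x. log_source p (val v x) * val w x)"
      if "v \<in> H01_space U" "w \<in> H01_space U" for v w using f_int that by (simp add: H_def)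
    show "G0 v \<bullet> w = - (sndL v \<bullet> sndL w) + (\<integral>x. log_source p (val v x) * val w x \<partial>lebesgue)"
      if "v \<in> H01_space U" "w \<in> H01_space U" for v w
      using G0(2)[of v w] that by (simp add: H_def l_def)
    show "integrable lebesgue (\<lambda>x. log_primitive p (val v x))" if "v \<in> H01_space U" for v
      using F_int that by (simp add: H_def)
    show "G0 0 = 0"
    proof -
      have "(\<integral>x. log_source p (val 0 x) * val (G0 0) x \<partial>lebesgue) = (\<integral>x. 0 \<partial>(lebesgue :: 'a measure))"
      proof (rule integral_cong_AE)
        show "AE x in lebesgue. log_source p (val 0 x) * val (G0 0) x = 0"
          using val_zero by eventually_elim simp
      qed measurable
      moreover have "sndL (0 :: ('a, real \<times> 'a) L2fun) = 0"
        by (rule linear_0[OF bounded_linear.linear[OF bounded_linear_sndL]])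
      ultimately have "G0 0 \<bullet> G0 0 = 0"
        using G0(2)[OF H0 G0(1)[OF H0]] by (simp add: l_def)
      then show ?thesis by simp
    qed
    show "\<exists>L. \<forall>a\<in>H01_space U. \<forall>b\<in>H01_space U. norm a \<le> R \<longrightarrow> norm b \<le> R \<longrightarrow> norm (G0 a - G0 b) \<le> L * norm (a - b)" for R
      unfolding H_def[symmetric]
    proof (intro exI[of _ "1 + C * K R"] ballI impI)
      fix a b assume ab: "a \<in> H" "b \<in> H" "norm a \<le> R" "norm b \<le> R"
      \<comment> \<open>The difference itself is the test element: its squared norm is then at most
        a multiple of \<open>norm (a - b) * norm w\<close>, and one factor \<open>norm w\<close> is
        cancelled.\<close>
      define w where "w = G0 a - G0 b"
      have w: "w \<in> H" unfolding w_def by (intro Hd G0(1) ab)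
      have "w \<bullet> w \<le> \<bar>sndL (a - b) \<bullet> sndL w\<bar> + \<bar>\<integral>x. (log_source p (val a x) - log_source p (val b x)) * val w x \<partial>lebesgue\<bar>"
        using G_diff[OF ab(1,2) w] by (simp add: w_def)
      also have "\<dots> \<le> norm (a - b) * norm w + C * (K R * norm (a - b) * norm w)"
      proof (rule add_mono)
        show "\<bar>sndL (a - b) \<bullet> sndL w\<bar> \<le> norm (a - b) * norm w"
          by (rule order_trans[OF Cauchy_Schwarz_ineq2]) (intro mult_mono norm_sndL_le; simp)
      qed (use f_diff[OF ab(1,2) w ab(3,4)] in blast)
      finally have "norm w * norm w \<le> ((1 + C * K R) * norm (a - b)) * norm w"
        by (simp add: norm_eq_sqrt_inner algebra_simps)
      then have "norm w \<le> (1 + C * K R) * norm (a - b)" if "w \<noteq> 0"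
        by (rule mult_right_le_imp_le) (use that in simp)
      moreover have "0 \<le> (1 + C * K R) * norm (a - b)" using C K[of R] by simp
      ultimately have "norm w \<le> (1 + C * K R) * norm (a - b)" by (cases "w = 0") auto
      then show "norm (G0 a - G0 b) \<le> (1 + C * K R) * norm (a - b)" by (simp add: w_def)
    qed
    show "\<exists>K. \<forall>a\<in>H01_space U. \<forall>b\<in>H01_space U. norm a \<le> R \<longrightarrow> norm b \<le> R \<longrightarrow>
        \<bar>energy p a - energy p b + G0 b \<bullet> (a - b)\<bar> \<le> K * (norm (a - b))\<^sup>2" for R
      unfolding H_def[symmetric]
    proof (intro exI[of _ "1 / 2 + C * K R"] ballI impI)
      fix a b assume ab: "a \<in> H" "b \<in> H" "norm a \<le> R" "norm b \<le> R"
      define w where "w = a - b"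
      have w: "w \<in> H" unfolding w_def by (intro Hd ab)
      \<comment> \<open>The pointwise second-order remainder of the nonlinear part. For the
        quadratic part of the energy the remainder is exactly half the square of
        \<open>norm (sndL w)\<close>.\<close>
      define g where "g x = log_primitive p (val a x) - log_primitive p (val b x) - log_source p (val b x) * val w x" for x
      have g: "integrable lebesgue g \<and> \<bar>\<integral>x. g x \<partial>lebesgue\<bar> \<le> C * (K R * norm w * norm w)"
      proof (rule dominated[OF ab(1,2) w w ab(3,4)])
        show "AE x in lebesgue. \<bar>g x\<bar> \<le> C * ((1 + \<bar>val a x\<bar> + \<bar>val b x\<bar>) powr p * \<bar>val w x\<bar> * \<bar>val w x\<bar>)"
          using val_diff[of a b]
        proof eventually_elim
          case (elim x)
          then show ?case using F[of "val a x" "val b x"]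
            by (simp add: g_def w_def mult.assoc power2_eq_square)
        qed
        show "g \<in> borel_measurable lebesgue" unfolding g_def[abs_def] by measurable
      qed
      have ig: "(\<integral>x. g x \<partial>lebesgue) = (\<integral>x. log_primitive p (val a x) \<partial>lebesgue)
          - (\<integral>x. log_primitive p (val b x) \<partial>lebesgue) - (\<integral>x. log_source p (val b x) * val w x \<partial>lebesgue)"
        unfolding g_def using F_int[OF ab(1)] F_int[OF ab(2)] f_int[OF ab(2) w] by simp
      have "energy p a - energy p b + G0 b \<bullet> w
          = ((norm (sndL a))\<^sup>2 - (norm (sndL b))\<^sup>2) / 2 - sndL b \<bullet> sndL w - (\<integral>x. g x \<partial>lebesgue)"
        using G0(2)[OF ab(2) w] by (simp add: energy_def l_def ig diff_divide_distrib)
      also have "((norm (sndL a))\<^sup>2 - (norm (sndL b))\<^sup>2) / 2 - sndL b \<bullet> sndL w = (norm (sndL w))\<^sup>2 / 2"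
        by (simp add: w_def sndL_diff power2_norm_eq_inner inner_diff inner_commute field_simps)
      finally have "\<bar>energy p a - energy p b + G0 b \<bullet> w\<bar> \<le> (norm (sndL w))\<^sup>2 / 2 + \<bar>\<integral>x. g x \<partial>lebesgue\<bar>"
        using zero_le_power2[of "norm (sndL w)"] by linarith
      also have "\<dots> \<le> (norm w)\<^sup>2 / 2 + C * (K R * norm w * norm w)"
        using g by (intro add_mono divide_right_mono power_mono norm_sndL_le) auto
      also have "\<dots> = (1 / 2 + C * K R) * (norm w)\<^sup>2" by (simp add: power2_eq_square algebra_simps)
      finally show "\<bar>energy p a - energy p b + G0 b \<bullet> (a - b)\<bar> \<le> (1 / 2 + C * K R) * (norm (a - b))\<^sup>2"
        by (simp add: w_def)
    qed
  qed
qed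

section \<open>The global weak solution\<close>

lemma time_interval_infinity: "time_interval \<infinity> = {0<..}"
  by (auto simp: time_interval_def)

text \<open>The Sobolev bound has only the gradient on its right-hand side, as in Poincare's
  inequality. It bridges a gap: the Nehari manifold asks for a nonzero gradient, the abstract well
  condition only for a nonzero element.\<close>

lemma H01_space_sndL_zero:
  fixes U :: "'a::euclidean_space set"
  assumes U: "bounded U" and p: "1 < p" and \<beta>: "real DIM('a) * ((p + 2) - 2) / (2 * (p + 2)) < 1"
    and h: "h \<in> H01_space U" "sndL h = 0"
  shows "h = 0"
proof -
  obtain C where C: "integrable lebesgue (\<lambda>x. \<bar>val h x\<bar> powr (p + 2))"
    "(\<integral>x. \<bar>val h x\<bar> powr (p + 2) \<partial>lebesgue) \<le> (C * norm (sndL h)) powr (p + 2)"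
    using Sobolev_inequality_H01[OF U _ \<beta>] p h(1) by auto
  have "(\<integral>x. \<bar>val h x\<bar> powr (p + 2) \<partial>lebesgue) = 0"
    using C(2) h(2) p by (intro antisym) auto
  then have "AE x in lebesgue. \<bar>val h x\<bar> powr (p + 2) = 0"
    by (subst (asm) integral_nonneg_eq_0_iff_AE[OF C(1)]) auto
  then have "AE x in lebesgue. of_L2 (fstL h) x = of_L2 0 x"
    using of_L2_fstL[of h] of_L2_zero[where 'a='a and 'b=real] by eventually_elim simp
  then have "fstL h = 0" by (rule L2_eqI)
  then show ?thesis using inner_fstL_sndL[of h h] h(2) by simp
qed

text \<open>All integrands vanish at 0, so integrals over U become integrals of the extension by
  zero. Integrability is assumed so that the integral of the primitive can be split into its
  logarithmic part and its power part.\<close>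

lemma H01_energy:
  fixes U :: "'a::euclidean_space set"
  assumes U: "open U" "bounded U" and p: "1 < p" and v: "v \<in> H01 U"
    and f: "integrable lebesgue (\<lambda>x. log_source p (val (embed U v) x) * val (embed U v) x)"
    and F: "integrable lebesgue (\<lambda>x. log_primitive p (val (embed U v) x))"
  shows "J p U v = energy p (embed U v)"
    "I p U v = (norm (sndL (embed U v)))\<^sup>2 - (\<integral>x. log_source p (val (embed U v) x) * val (embed U v) x \<partial>lebesgue)"
proof -
  define h where "h = embed U v"
  have vH: "v \<in> H1 U" by (rule H01_imp_H1[OF U v])
  note Us = U_sets[OF U]
  have vE: "AE x in lebesgue. val h x = (if x \<in> U then v x else 0)"
    using of_L2_embed[OF U vH] by eventually_elim (simp add: h_def)
  have cut: "(\<lambda>x. if x \<in> U then v x else 0) \<in> borel_measurable lebesgue"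
    using square_integrable_embed(2)[OF U vH] by (rule square_integrable_measurable)
  have cut_int: "(\<integral>x. g (v x) \<partial>lebesgue_on U) = (\<integral>x. g (val h x) \<partial>lebesgue)"
    if g: "g 0 = 0" "g \<in> borel_measurable borel" for g :: "real \<Rightarrow> real"
  proof -
    have [measurable]: "g \<in> borel_measurable borel" by fact
    have "(\<integral>x. g (v x) \<partial>lebesgue_on U) = (\<integral>x. (if x \<in> U then g (v x) else 0) \<partial>lebesgue)"
      by (simp add: Lebesgue_Measure.integral_restrict_UNIV[OF Us])
    also have "\<dots> = (\<integral>x. g (if x \<in> U then v x else 0) \<partial>lebesgue)"
      using g(1) by (intro Bochner_Integration.integral_cong) auto
    also have "\<dots> = (\<integral>x. g (val h x) \<partial>lebesgue)"
    proof (rule integral_cong_AE)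
      show "(\<lambda>x. g (if x \<in> U then v x else 0)) \<in> borel_measurable lebesgue"
        by (rule measurable_compose[OF cut g(2)])
      show "AE x in lebesgue. g (if x \<in> U then v x else 0) = g (val h x)"
        using vE by eventually_elim simp
    qed measurable
    finally show ?thesis .
  qed
  have s: "\<bar>s\<bar> powr (1 + p) * ln \<bar>s\<bar> = log_source p s * s" for s
  proof (cases "s = 0")
    case False
    have "\<bar>s\<bar> powr (1 + p) = \<bar>s\<bar> powr (2 + (p - 1))" by simp
    also have "\<dots> = \<bar>s\<bar> powr 2 * \<bar>s\<bar> powr (p - 1)" by (rule powr_add)
    also have "\<bar>s\<bar> powr 2 = s * s" using False by (simp add: power2_eq_square)
    finally show ?thesis by (simp add: log_source_def)
  qed simp
  have log_int: "(\<integral>x. \<bar>v x\<bar> powr (1 + p) * ln \<bar>v x\<bar> \<partial>lebesgue_on U) = (\<integral>x. log_source p (val h x) * val h x \<partial>lebesgue)"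
    unfolding s by (rule cut_int[of "\<lambda>s. log_source p s * s"]) simp_all
  have grad: "Lnorm 2 U (wgrad U v) = norm (sndL h)"
    unfolding h_def by (rule Lnorm_sndL[OF U vH])
  show "I p U v = (norm (sndL (embed U v)))\<^sup>2 - (\<integral>x. log_source p (val (embed U v) x) * val (embed U v) x \<partial>lebesgue)"
    unfolding I_def log_int grad h_def ..
  \<comment> \<open>Solving the definition of the primitive for the pure power exhibits it as a
    combination of two functions already known to be integrable.\<close>
  have pw: "\<bar>s\<bar> powr (1 + p) = (1 + p)\<^sup>2 * (log_source p s * s / (1 + p) - log_primitive p s)" for s
    using p by (simp add: log_primitive_def s[symmetric] right_diff_distrib)
  have pwi: "integrable lebesgue (\<lambda>x. \<bar>val h x\<bar> powr (1 + p))"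
    unfolding pw h_def using f F by simp
  have "Lnorm (1 + p) U v powr (1 + p) = (\<integral>x. \<bar>v x\<bar> powr (1 + p) \<partial>lebesgue_on U)"
    using p by (simp add: Lnorm_def powr_powr)
  also have "\<dots> = (\<integral>x. \<bar>val h x\<bar> powr (1 + p) \<partial>lebesgue)"
    by (rule cut_int[of "\<lambda>s. \<bar>s\<bar> powr (1 + p)"]) simp_all
  finally have Lp: "Lnorm (1 + p) U v powr (1 + p) = (\<integral>x. \<bar>val h x\<bar> powr (1 + p) \<partial>lebesgue)" .
  have "(\<integral>x. log_primitive p (val h x) \<partial>lebesgue)
      = (\<integral>x. log_source p (val h x) * val h x / (1 + p) - \<bar>val h x\<bar> powr (1 + p) / (1 + p)\<^sup>2 \<partial>lebesgue)"
    by (simp add: log_primitive_def s)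
  also have "\<dots> = (\<integral>x. log_source p (val h x) * val h x \<partial>lebesgue) / (1 + p) - (\<integral>x. \<bar>val h x\<bar> powr (1 + p) \<partial>lebesgue) / (1 + p)\<^sup>2"
    using f pwi by (simp add: h_def)
  finally show "J p U v = energy p (embed U v)"
    unfolding J_def log_int grad Lp energy_def h_def[symmetric] by simp
qed

section \<open>Measurability, weak derivatives and integrability in time\<close>

lemma step_function_approximation:
  "\<exists>g :: nat \<Rightarrow> real \<Rightarrow> real. (\<forall>k. simple_function (lebesgue_on {0<..}) (g k)) \<and> (\<forall>k t. 0 < t \<longrightarrow> 0 < g k t) \<and>
    (\<forall>t>0. (\<lambda>k. g k t) \<longlonglongrightarrow> t)"
proof -
  \<comment> \<open>Rounding up to a multiple of 1 / (k + 1): one more than the floor keeps the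
    value positive, so that a curve on the open half line can be sampled there. The cutoff at k + 1
    makes the range finite, and 1 is a positive default beyond it.\<close>
  define g where "g k t = (if t < real k + 1 then (of_int \<lfloor>(real k + 1) * t\<rfloor> + 1) / (real k + 1) else 1)" for k :: nat and t :: real
  have pos: "0 < g k t" if "0 < t" for k t
  proof -
    have "0 \<le> (real k + 1) * t" using that by simp
    then have "0 \<le> \<lfloor>(real k + 1) * t\<rfloor>" by simp
    then have "0 < (of_int \<lfloor>(real k + 1) * t\<rfloor> + 1 :: real)" by linarith
    then show ?thesis by (simp add: g_def)
  qed
  moreover have "simple_function (lebesgue_on {0<..}) (g k)" for k
  proof (rule simple_function_borel_measurable)
    have "g k \<in> borel_measurable borel" unfolding g_def[abs_def] by measurable
    then have "g k \<in> borel_measurable lebesgue" by (simp add: measurable_completion)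
    then show "g k \<in> borel_measurable (lebesgue_on {0<..})" by (rule measurable_restrict_space1)
    have "g k ` {0<..} \<subseteq> insert 1 ((\<lambda>i. (of_int i + 1) / (real k + 1)) ` {0..\<lceil>(real k + 1) * (real k + 1)\<rceil>})"
    proof
      fix y assume "y \<in> g k ` {0<..}"
      then obtain t where t: "t > 0" "y = g k t" by auto
      show "y \<in> insert 1 ((\<lambda>i. (of_int i + 1) / (real k + 1)) ` {0..\<lceil>(real k + 1) * (real k + 1)\<rceil>})"
      proof (cases "t < real k + 1")
        case True
        have "(real k + 1) * t \<le> (real k + 1) * (real k + 1)" using True by (intro mult_left_mono) auto
        then have "\<lfloor>(real k + 1) * t\<rfloor> \<le> \<lceil>(real k + 1) * (real k + 1)\<rceil>" by linarith
        moreover have "0 \<le> \<lfloor>(real k + 1) * t\<rfloor>" using t by simp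
        ultimately show ?thesis using t True by (auto simp: g_def)
      qed (use t in \<open>simp add: g_def\<close>)
    qed
    then show "finite (g k ` space (lebesgue_on {0<..}))" by (auto intro: finite_subset)
  qed
  moreover have "(\<lambda>k. g k t) \<longlonglongrightarrow> t" if "0 < t" for t
  proof (rule tendsto_sandwich)
    show "\<forall>\<^sub>F k in sequentially. t \<le> g k t"
    proof (rule eventually_sequentiallyI[of "nat \<lceil>t\<rceil>"])
      fix k assume "nat \<lceil>t\<rceil> \<le> k"
      then have "t < real k + 1" by linarith
      moreover have "(real k + 1) * t \<le> of_int \<lfloor>(real k + 1) * t\<rfloor> + 1" by linarith
      ultimately show "t \<le> g k t" by (simp add: g_def le_divide_eq mult.commute)
    qed
    show "\<forall>\<^sub>F k in sequentially. g k t \<le> t + inverse (real (Suc k))"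
    proof (rule eventually_sequentiallyI[of "nat \<lceil>t\<rceil>"])
      fix k assume "nat \<lceil>t\<rceil> \<le> k"
      then have "t < real k + 1" by linarith
      moreover have "of_int \<lfloor>(real k + 1) * t\<rfloor> + 1 \<le> (real k + 1) * t + 1" by simp
      moreover have "t + inverse (real (Suc k)) = ((real k + 1) * t + 1) / (real k + 1)" by (simp add: field_simps)
      ultimately show "g k t \<le> t + inverse (real (Suc k))" by (simp add: g_def divide_right_mono)
    qed
    show "(\<lambda>k. t + inverse (real (Suc k))) \<longlonglongrightarrow> t"
      using tendsto_add[OF tendsto_const LIMSEQ_inverse_real_of_nat] by simp
  qed simp
  ultimately show ?thesis by blast
qed

text \<open>A curve sampled at the step functions is a simple function of time. Continuity is asked
  of an auxiliary curve whose increments dominate those in \<open>N\<close>, so the same argument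
  serves v in \<open>H1norm\<close> and its derivative in the weaker \<open>Lnorm 2\<close>.\<close>

lemma strongly_measurable_continuous:
  fixes V :: "real \<Rightarrow> 'a \<Rightarrow> real" and y :: "real \<Rightarrow> 'x::real_normed_vector"
  assumes V: "\<And>t. 0 < t \<Longrightarrow> V t \<in> X" and y: "continuous_on {0<..} y"
    and N: "\<And>s t. 0 < s \<Longrightarrow> 0 < t \<Longrightarrow> 0 \<le> N (\<lambda>x. V t x - V s x) \<and> N (\<lambda>x. V t x - V s x) \<le> norm (y t - y s)"
  shows "strongly_measurable {0<..} X N V"
proof -
  obtain g :: "nat \<Rightarrow> real \<Rightarrow> real" where g: "\<And>k. simple_function (lebesgue_on {0<..}) (g k)"
    "\<And>k t. 0 < t \<Longrightarrow> 0 < g k t" "\<And>t. 0 < t \<Longrightarrow> (\<lambda>k. g k t) \<longlonglongrightarrow> t"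
    using step_function_approximation by metis
  show ?thesis
    unfolding strongly_measurable_def
  proof (intro conjI exI[of _ "\<lambda>k t. V (g k t)"] ballI allI)
    show "V t \<in> X" if "t \<in> {0<..}" for t using V that by simp
    show "simple_function (lebesgue_on {0<..}) (\<lambda>t. V (g k t))" for k
      using g(1) by (rule simple_function_compose1)
    show "(\<lambda>t. V (g k t)) ` {0<..} \<subseteq> X" for k using V g(2) by auto
    show "AE t in lebesgue_on {0<..}. (\<lambda>k. N (\<lambda>x. V t x - V (g k t) x)) \<longlonglongrightarrow> 0"
    proof (rule AE_I2)
      fix t :: real assume "t \<in> space (lebesgue_on {0<..})"
      then have t: "0 < t" by simp
      have "(\<lambda>k. y (g k t)) \<longlonglongrightarrow> y t"
        using y t g(2)[OF t] g(3)[OF t]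
        by (intro continuous_on_tendsto_compose[OF y]) (auto intro: always_eventually)
      then have "(\<lambda>k. norm (y t - y (g k t))) \<longlonglongrightarrow> norm (y t - y t)" by (intro tendsto_intros)
      then have lim: "(\<lambda>k. norm (y t - y (g k t))) \<longlonglongrightarrow> 0" by simp
      show "(\<lambda>k. N (\<lambda>x. V t x - V (g k t) x)) \<longlonglongrightarrow> 0"
        by (rule tendsto_sandwich[OF _ _ tendsto_const lim]) (use N g(2) t in \<open>auto intro!: always_eventually\<close>)
    qed
  qed
qed

text \<open>The fundamental theorem of calculus for the product of \<phi> and l on a compact
  interval around the support of \<phi>, where the boundary terms vanish.\<close>

lemma weak_time_derivative_half_line:
  fixes \<phi> l dl :: "real \<Rightarrow> real"
  assumes \<phi>: "\<phi> \<in> test_functions {0<..}"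
    and l: "\<And>t. 0 < t \<Longrightarrow> (l has_real_derivative dl t) (at t)" and cont: "continuous_on {0<..} dl"
  shows "(\<integral>t. deriv \<phi> t * l t \<partial>lebesgue_on {0<..}) = - (\<integral>t. \<phi> t * dl t \<partial>lebesgue_on {0<..})"
proof -
  note C1 = test_functionD(1)[OF \<phi>, of 1]
  have d\<phi>: "(\<phi> has_real_derivative deriv \<phi> t) (at t)" for t
    using C1 by (intro DERIV_deriv_iff_real_differentiable[THEN iffD2]) simp
  have deriv_eq: "deriv \<phi> t = frechet_derivative \<phi> (at t) 1" for t
    using frechet_derivative_eq[OF d\<phi>[unfolded has_field_derivative_def], of t] by simp
  have cont_d: "continuous_on S (deriv \<phi>)" for S
    using continuous_frechet_derivative[of 0 \<phi> S 1] C1 by (simp add: deriv_eq[abs_def])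
  define T where "T = closure {t. \<phi> t \<noteq> 0}"
  have T: "compact T" "T \<subseteq> {0<..}" using \<phi> by (auto simp: T_def test_functions_def)
  \<comment> \<open>The compact support misses 0 and therefore fits strictly inside a compact
    interval of positive times, on which l is differentiable up to the ends.\<close>
  have "\<exists>a b. 0 < a \<and> a < b \<and> T \<subseteq> {a<..<b}"
  proof (cases "T = {}")
    case True
    then show ?thesis by (intro exI[of _ 1] exI[of _ 2]) simp
  next
    case False
    obtain i where i: "i \<in> T" "\<And>t. t \<in> T \<Longrightarrow> i \<le> t" using compact_attains_inf[OF T(1) False] by blast
    obtain s where s: "s \<in> T" "\<And>t. t \<in> T \<Longrightarrow> t \<le> s" using compact_attains_sup[OF T(1) False] by blast
    have "0 < i" using i T by auto
    then show ?thesis using i s by (intro exI[of _ "i/2"] exI[of _ "s + 1"]) (force simp: subset_iff)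
  qed
  then obtain a b where ab: "0 < a" "a < b" "T \<subseteq> {a<..<b}" by blast
  have out: "\<phi> t = 0" "deriv \<phi> t = 0" if "t \<notin> {a<..<b}" for t
  proof -
    have tT: "t \<notin> T" using that ab by auto
    have z: "x \<notin> T \<Longrightarrow> \<phi> x = 0" for x using closure_subset[of "{t. \<phi> t \<noteq> 0}"] by (auto simp: T_def)
    show "\<phi> t = 0" by (rule z[OF tT])
    show "deriv \<phi> t = 0"
      using frechet_derivative_zero_outside[OF z _ tT] by (simp add: deriv_eq T_def)
  qed
  have conv: "(\<integral>t. g t \<partial>lebesgue_on {0<..}) = integral {a..b} g"
    if g: "continuous_on {a..b} g" "\<And>t. t \<notin> {a<..<b} \<Longrightarrow> g t = 0" for g :: "real \<Rightarrow> real"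
  proof -
    have "(\<integral>t. g t \<partial>lebesgue_on {0<..}) = (\<integral>t. (if t \<in> {0<..} then g t else 0) \<partial>lebesgue)"
      by (rule Lebesgue_Measure.integral_restrict_UNIV[symmetric]) simp
    also have "\<dots> = (\<integral>t. (if t \<in> {a..b} then g t else 0) \<partial>lebesgue)"
      using g(2) ab by (intro Bochner_Integration.integral_cong) (auto simp: not_less)
    also have "\<dots> = (\<integral>t. g t \<partial>lebesgue_on {a..b})"
      by (rule Lebesgue_Measure.integral_restrict_UNIV) simp
    also have "\<dots> = integral {a..b} g"
      by (rule lebesgue_integral_eq_integral[OF continuous_imp_integrable_real[OF g(1)]]) simp
    finally show ?thesis .
  qed
  have cl: "continuous_on {a..b} l"
    using ab by (intro continuous_at_imp_continuous_on ballI DERIV_isCont[OF l]) auto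
  have cdl: "continuous_on {a..b} dl" using ab by (intro continuous_on_subset[OF cont]) auto
  have c\<phi>: "continuous_on {a..b} \<phi>" by (rule test_function_continuous[OF \<phi>])
  have "((\<lambda>t. deriv \<phi> t * l t + \<phi> t * dl t) has_integral (\<phi> b * l b - \<phi> a * l a)) {a..b}"
  proof (rule fundamental_theorem_of_calculus)
    fix t assume t: "t \<in> {a..b}"
    have "((\<lambda>t. \<phi> t * l t) has_real_derivative deriv \<phi> t * l t + \<phi> t * dl t) (at t)"
      using DERIV_mult[OF d\<phi> l[of t]] t ab by (simp add: algebra_simps)
    then show "((\<lambda>t. \<phi> t * l t) has_vector_derivative deriv \<phi> t * l t + \<phi> t * dl t) (at t within {a..b})"
      by (simp add: has_real_derivative_iff_has_vector_derivative has_vector_derivative_at_within)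
  qed (use ab in simp)
  then have "integral {a..b} (\<lambda>t. deriv \<phi> t * l t + \<phi> t * dl t) = 0"
    using out by (auto dest: integral_unique)
  moreover have "integral {a..b} (\<lambda>t. deriv \<phi> t * l t + \<phi> t * dl t)
      = integral {a..b} (\<lambda>t. deriv \<phi> t * l t) + integral {a..b} (\<lambda>t. \<phi> t * dl t)"
    by (intro Henstock_Kurzweil_Integration.integral_add integrable_continuous_real continuous_intros cl cdl c\<phi> cont_d)
  moreover have "(\<integral>t. deriv \<phi> t * l t \<partial>lebesgue_on {0<..}) = integral {a..b} (\<lambda>t. deriv \<phi> t * l t)"
    by (rule conv) (auto intro!: continuous_intros cl cont_d simp: out)
  moreover have "(\<integral>t. \<phi> t * dl t \<partial>lebesgue_on {0<..}) = integral {a..b} (\<lambda>t. \<phi> t * dl t)"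
    by (rule conv) (auto intro!: continuous_intros cdl c\<phi> simp: out)
  ultimately show ?thesis by simp
qed

text \<open>The majorant is known only through its integrals over the intervals [0, T], in the gauge
  sense and with a bound uniform in T. Nonnegativity makes these Lebesgue integrals, and Fatou's
  lemma passes to the half line.\<close>

lemma integrable_half_line:
  fixes f :: "real \<Rightarrow> real"
  assumes cont: "continuous_on {0<..} f" and nonneg: "\<And>t. 0 < t \<Longrightarrow> 0 \<le> f t \<and> f t \<le> g t"
    and g0: "\<And>t. 0 \<le> t \<Longrightarrow> 0 \<le> g t"
    and g: "\<And>T. 0 \<le> T \<Longrightarrow> (g has_integral e T) {0..T}" "\<And>T. 0 \<le> T \<Longrightarrow> e T \<le> B"
  shows "integrable (lebesgue_on {0<..}) f"
proof (rule integrableI_bounded)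
  have "(\<lambda>t. indicator {0<..} t *\<^sub>R f t) \<in> borel_measurable borel"
    by (rule borel_measurable_continuous_on_indicator[OF _ cont]) simp
  then show m: "f \<in> borel_measurable (lebesgue_on {0<..})"
    by (subst borel_measurable_restrict_space_iff) (auto simp: measurable_completion)
  have "(\<lambda>t. indicator {0<..} t *\<^sub>R f t) \<in> borel_measurable lborel"
    using borel_measurable_continuous_on_indicator[OF _ cont] by simp
  then have [measurable]: "(\<lambda>t. indicator {0<..} t * f t) \<in> borel_measurable borel" by simp
  have "(\<integral>\<^sup>+t. ennreal (norm (f t)) \<partial>lebesgue_on {0<..}) = (\<integral>\<^sup>+t. ennreal (norm (f t)) * indicator {0<..} t \<partial>lebesgue)"
    by (subst nn_integral_restrict_space) auto
  also have "\<dots> = (\<integral>\<^sup>+t. ennreal (indicator {0<..} t * f t) \<partial>lebesgue)"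
    using nonneg by (intro nn_integral_cong) (auto simp: indicator_def)
  also have "\<dots> = (\<integral>\<^sup>+t. ennreal (indicator {0<..} t * f t) \<partial>lborel)"
    by (rule nn_integral_completion)
  also have "\<dots> = (\<integral>\<^sup>+t. liminf (\<lambda>n. ennreal (indicator {0<..} t * f t) * indicator {0..real n} t) \<partial>lborel)"
  proof (rule nn_integral_cong)
    fix t :: real
    have "\<forall>\<^sub>F n in sequentially. ennreal (indicator {0<..} t * f t) * indicator {0..real n} t = ennreal (indicator {0<..} t * f t)"
    proof (rule eventually_sequentiallyI[of "nat \<lceil>t\<rceil>"])
      fix n assume "nat \<lceil>t\<rceil> \<le> n"
      then have "t \<le> real n" by linarith
      then show "ennreal (indicator {0<..} t * f t) * indicator {0..real n} t = ennreal (indicator {0<..} t * f t)"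
        by (simp add: indicator_def)
    qed
    then have "(\<lambda>n. ennreal (indicator {0<..} t * f t) * indicator {0..real n} t) \<longlonglongrightarrow> ennreal (indicator {0<..} t * f t)"
      by (rule tendsto_eventually)
    from lim_imp_Liminf[OF _ this]
    show "ennreal (indicator {0<..} t * f t) = liminf (\<lambda>n. ennreal (indicator {0<..} t * f t) * indicator {0..real n} t)"
      by simp
  qed
  also have "\<dots> \<le> liminf (\<lambda>n. \<integral>\<^sup>+t. ennreal (indicator {0<..} t * f t) * indicator {0..real n} t \<partial>lborel)"
    by (rule nn_integral_liminf) measurable
  also have "\<dots> \<le> ennreal B"
  proof (rule Liminf_le[OF _ eventually_sequentiallyI[of 0]])
    fix n :: nat
    have "(\<integral>\<^sup>+t. ennreal (indicator {0<..} t * f t) * indicator {0..real n} t \<partial>lborel)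
        \<le> (\<integral>\<^sup>+t. ennreal (indicator {0..real n} t * g t) \<partial>lborel)"
      using nonneg by (intro nn_integral_mono) (auto simp: indicator_def intro!: ennreal_leI)
    also have "\<dots> = ennreal (e (real n))"
      using g0 by (intro nn_integral_has_integral_lebesgue g(1)) auto
    also have "\<dots> \<le> ennreal B" by (intro ennreal_leI g(2)) simp
    finally show "(\<integral>\<^sup>+t. ennreal (indicator {0<..} t * f t) * indicator {0..real n} t \<partial>lborel) \<le> ennreal B" .
  qed simp
  also have "\<dots> < \<infinity>" by simp
  finally show "(\<integral>\<^sup>+t. ennreal (norm (f t)) \<partial>lebesgue_on {0<..}) < \<infinity>" .
qed

theorem theorem3p2:
  fixes U :: "'a::euclidean_space set" and p \<alpha> :: real and v0 :: "'a \<Rightarrow> real"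
  assumes "smooth_bounded_domain U"
    and "(DIM('a) \<le> 2 \<and> 1 < p) \<or>
         (3 \<le> DIM('a) \<and> DIM('a) \<le> 5 \<and> 1 < p \<and> p < 4 / (real DIM('a) - 2))"
    and "v0 \<in> H01 U"
    and "well_depth p U < \<alpha>"
    and "J p U v0 < \<alpha>"
    and "(H1norm U v0)\<^sup>2 < Lambda p U \<alpha>"
    and "0 < I p U v0"
  shows "\<exists>v vt. global_weak_solution p U v0 v vt \<and>
           v \<in> Linf_time {0<..} (H01 U) (H1norm U) \<and>
           vt \<in> Linf_time {0<..} (Lebesgue_space 2 U) (Lnorm 2 U)"
proof -
  have U: "open U" "bounded U" using assms(1) by (auto simp: smooth_bounded_domain_def)
  note p = subcritical_exponent(1)[OF assms(2)] and \<beta> = subcritical_exponent(2)[OF assms(2)]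
  define H where "H = H01_space U"
  obtain G where GH: "\<And>v. v \<in> H \<Longrightarrow> G v \<in> H"
    and f_int: "\<And>v w. v \<in> H \<Longrightarrow> w \<in> H \<Longrightarrow> integrable lebesgue (\<lambda>x. log_source p (val v x) * val w x)"
    and G: "\<And>v w. v \<in> H \<Longrightarrow> w \<in> H \<Longrightarrow>
        G v \<bullet> w = - (sndL v \<bullet> sndL w) + (\<integral>x. log_source p (val v x) * val w x \<partial>lebesgue)"
    and F_int: "\<And>v. v \<in> H \<Longrightarrow> integrable lebesgue (\<lambda>x. log_primitive p (val v x))"
    and G0: "G 0 = 0"
    and lip: "\<And>R. \<exists>L. \<forall>a\<in>H. \<forall>b\<in>H. norm a \<le> R \<longrightarrow> norm b \<le> R \<longrightarrow> norm (G a - G b) \<le> L * norm (a - b)"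
    and diff: "\<And>R. \<exists>K. \<forall>a\<in>H. \<forall>b\<in>H. norm a \<le> R \<longrightarrow> norm b \<le> R \<longrightarrow>
        \<bar>energy p a - energy p b + G b \<bullet> (a - b)\<bar> \<le> K * (norm (a - b))\<^sup>2"
    using potential_operator[OF U p \<beta>] unfolding H_def by blast
  have subH: "subspace H" "closed H" unfolding H_def by (rule subspace_H01_space closed_H01_space)+
  have emb: "embed U v \<in> H" if "v \<in> H01 U" for v
    unfolding H_def by (rule embed_H01[OF U that])
  have J_eq: "J p U v = energy p (embed U v)" and I_eq: "I p U v = - (G (embed U v) \<bullet> embed U v)"
    if v: "v \<in> H01 U" for v
    using H01_energy[OF U p v f_int[OF emb emb] F_int[OF emb]] v G[OF emb[OF v] emb[OF v]]
    by (simp_all add: power2_norm_eq_inner)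
  have H1norm_eq: "H1norm U v = norm (embed U v)" if "v \<in> H01 U" for v
    by (rule H1norm_embed[OF U H01_imp_H1[OF U that]])
  define y0 where "y0 = embed U v0"
  have y0: "y0 \<in> H" "energy p y0 < \<alpha>" "(norm y0)\<^sup>2 < Lambda p U \<alpha>" "G y0 \<bullet> y0 < 0"
    using assms(3,5,6,7) emb[OF assms(3)] J_eq[OF assms(3)] I_eq[OF assms(3)] H1norm_eq[OF assms(3)]
    by (simp_all add: y0_def)
  \<comment> \<open>Here the infimum \<open>Lambda\<close> enters: \<open>val x\<close> is one of
    its competitors, because a nonzero x in H has a nonzero gradient.\<close>
  have well: "Lambda p U \<alpha> \<le> (norm x)\<^sup>2"
    if x: "x \<in> H" "x \<noteq> 0" "G x \<bullet> x = 0" "energy p x < \<alpha>" for x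
  proof -
    note v = H01_space_embed[OF U x(1)[unfolded H_def]]
    have "sndL x \<noteq> 0" using H01_space_sndL_zero[OF U(2) p \<beta> x(1)[unfolded H_def]] x(2) by blast
    then have "(Lnorm 2 U (wgrad U (val x)))\<^sup>2 \<noteq> 0"
      unfolding Lnorm_sndL[OF U H01_imp_H1[OF U v(1)]] v(2) by simp
    then have "val x \<in> nehari_below p U \<alpha>"
      using v x(3,4) I_eq[OF v(1)] J_eq[OF v(1)] by (simp add: nehari_below_def nehari_def)
    moreover have "bdd_below ((\<lambda>v. (H1norm U v)\<^sup>2) ` nehari_below p U \<alpha>)"
      by (intro bdd_belowI2[of _ 0]) simp
    ultimately have "Lambda p U \<alpha> \<le> (H1norm U (val x))\<^sup>2"
      unfolding Lambda_def by (intro cINF_lower)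
    then show ?thesis using H1norm_eq[OF v(1)] v(2) by simp
  qed
  obtain u where u0: "u 0 = y0" and uH: "\<And>t. t \<ge> 0 \<Longrightarrow> u t \<in> H" and u_le: "\<And>t. t \<ge> 0 \<Longrightarrow> norm (u t) \<le> norm y0"
    and u': "\<And>t. t \<ge> 0 \<Longrightarrow> (u has_vector_derivative G (u t)) (at t within {0..})"
    and u_en: "\<And>t. t \<ge> 0 \<Longrightarrow> ((\<lambda>s. (norm (G (u s)))\<^sup>2) has_integral (energy p y0 - energy p (u t))) {0..t}"
    using potential_well_flow[OF subH GH G0 lip diff y0 well] by blast
  have contu: "continuous_on {0..} u"
    using u' by (auto simp: continuous_on_eq_continuous_within intro: has_vector_derivative_continuous)
  obtain L where L: "\<And>a b. a \<in> H \<Longrightarrow> b \<in> H \<Longrightarrow> norm a \<le> norm y0 \<Longrightarrow> norm b \<le> norm y0 \<Longrightarrow>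
      norm (G a - G b) \<le> L * norm (a - b)"
    using lip[of "norm y0"] by blast
  have contG: "continuous_on {0..} (\<lambda>t. G (u t))"
    unfolding continuous_on_def
  proof
    fix s :: real assume s: "s \<in> {0..}"
    have "((\<lambda>t. L * norm (u t - u s)) \<longlongrightarrow> L * norm (u s - u s)) (at s within {0..})"
      using contu s by (intro tendsto_intros) (auto simp: continuous_on_def)
    then have "((\<lambda>t. L * norm (u t - u s)) \<longlongrightarrow> 0) (at s within {0..})" by simp
    then have "((\<lambda>t. G (u t) - G (u s)) \<longlongrightarrow> 0) (at s within {0..})"
    proof (rule Lim_null_comparison[rotated])
      show "\<forall>\<^sub>F t in at s within {0..}. norm (G (u t) - G (u s)) \<le> L * norm (u t - u s)"
        using s by (auto simp: eventually_at_filter intro!: always_eventually L uH u_le)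
    qed
    then show "((\<lambda>t. G (u t)) \<longlongrightarrow> G (u s)) (at s within {0..})" by (rule LIM_zero_cancel)
  qed
  \<comment> \<open>\<open>val (u 0)\<close> is merely some representative of the class of
    \<open>v0\<close>. Inserting \<open>v0\<close> itself at time 0 makes the initial condition an
    identity, and the embedding of \<open>v t\<close> is \<open>u t\<close> in either case.\<close>
  define v where "v t = (if t = 0 then v0 else val (u t))" for t
  \<comment> \<open>The derivative of u exists at every time, so this representative satisfies the
    equation at all times and not only almost everywhere.\<close>
  define vt where "vt t = val (G (u t))" for t
  have v: "v t \<in> H01 U" "embed U (v t) = u t" if "t \<ge> 0" for t
    using H01_space_embed[OF U uH[OF that, unfolded H_def]] assms(3) u0 by (auto simp: v_def y0_def)
  have vt: "vt t \<in> H01 U" "embed U (vt t) = G (u t)" if "t \<ge> 0" for t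
    using H01_space_embed[OF U GH[OF uH[OF that], unfolded H_def]] by (auto simp: vt_def)
  note vH1 = H01_imp_H1[OF U v(1)] and vtH1 = H01_imp_H1[OF U vt(1)]
  have H1_L2: "w \<in> H1 U \<Longrightarrow> w \<in> Lebesgue_space 2 U" for w by (simp add: H1_def)
  have v_norm: "H1norm U (v t) = norm (u t)" if "t \<ge> 0" for t
    using H1norm_eq[OF v(1)[OF that]] v(2)[OF that] by simp
  have vt_norm: "Lnorm 2 U (vt t) = norm (fstL (G (u t)))" if "t \<ge> 0" for t
    using Lnorm_fstL[OF U vtH1[OF that]] vt(2)[OF that] by simp
  have Linf_v: "v \<in> Linf_time {0<..} (H01 U) (H1norm U)"
  proof -
    have "strongly_measurable {0<..} (H01 U) (H1norm U) v"
    proof (rule strongly_measurable_continuous)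
      show "v t \<in> H01 U" if "0 < t" for t using v that by simp
      show "continuous_on {0<..} u" by (rule continuous_on_subset[OF contu]) auto
      show "0 \<le> H1norm U (\<lambda>x. v t x - v s x) \<and> H1norm U (\<lambda>x. v t x - v s x) \<le> norm (u t - u s)"
        if "0 < s" "0 < t" for s t
        using embed_diff[OF U vH1[of t] vH1[of s]] v(2)[of t] v(2)[of s] that by (simp add: H1norm_embed[OF U])
    qed
    then show ?thesis unfolding Linf_time_def using v_norm u_le by (auto intro!: exI[of _ "norm y0"])
  qed
  have vt_meas: "strongly_measurable {0<..} (Lebesgue_space 2 U) (Lnorm 2 U) vt"
  proof (rule strongly_measurable_continuous)
    show "vt t \<in> Lebesgue_space 2 U" if "0 < t" for t using H1_L2[OF vtH1] that by simp
    show "continuous_on {0<..} (\<lambda>t. G (u t))" by (rule continuous_on_subset[OF contG]) auto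
    show "0 \<le> Lnorm 2 U (\<lambda>x. vt t x - vt s x) \<and> Lnorm 2 U (\<lambda>x. vt t x - vt s x) \<le> norm (G (u t) - G (u s))"
      if "0 < s" "0 < t" for s t
      using embed_diff[OF U vtH1[of t] vtH1[of s]] vt(2)[of t] vt(2)[of s] that
      by (simp add: Lnorm_fstL[OF U] norm_fstL_le)
  qed
  have Linf_vt: "vt \<in> Linf_time {0<..} (Lebesgue_space 2 U) (Lnorm 2 U)"
  proof -
    \<comment> \<open>The derivative is \<open>G\<close> along a bounded orbit; since
      \<open>G 0 = 0\<close>, the Lipschitz constant on the ball bounds it.\<close>
    have "Lnorm 2 U (vt t) \<le> \<bar>L\<bar> * norm y0" if t: "0 \<le> t" for t
    proof -
      have "Lnorm 2 U (vt t) \<le> norm (G (u t) - G 0)" using vt_norm[OF t] norm_fstL_le[of "G (u t)"] G0 by simp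
      also have "\<dots> \<le> L * norm (u t - 0)"
        using uH[OF t] u_le[OF t] subspace_0[OF subH(1)] by (intro L) auto
      also have "\<dots> \<le> \<bar>L\<bar> * norm y0" using u_le[OF t] by (intro mult_mono) auto
      finally show ?thesis .
    qed
    then show ?thesis unfolding Linf_time_def using vt_meas by (auto intro!: exI[of _ "\<bar>L\<bar> * norm y0"])
  qed
  have L2_vt: "vt \<in> L2_time {0<..} (Lebesgue_space 2 U) (Lnorm 2 U)"
  proof -
    obtain K where K: "\<And>a b. a \<in> H \<Longrightarrow> b \<in> H \<Longrightarrow> norm a \<le> norm y0 \<Longrightarrow> norm b \<le> norm y0 \<Longrightarrow>
        \<bar>energy p a - energy p b + G b \<bullet> (a - b)\<bar> \<le> K * (norm (a - b))\<^sup>2"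
      using diff[of "norm y0"] by blast
    \<comment> \<open>The squared norm of \<open>G (u s)\<close> integrated over [0, t] is the loss
      of energy, so a bound uniform in t amounts to a lower bound for the energy on the ball of
      radius \<open>norm y0\<close>. The expansion of the energy around \<open>y0\<close> supplies
      one.\<close>
    define B where "B = \<bar>K\<bar> * (2 * norm y0)\<^sup>2 + norm (G y0) * (2 * norm y0)"
    have B: "energy p y0 - energy p (u t) \<le> B" if t: "0 \<le> t" for t
    proof -
      have d: "norm (u t - y0) \<le> 2 * norm y0" using norm_triangle_ineq4[of "u t" y0] u_le[OF t] by simp
      have "\<bar>energy p (u t) - energy p y0 + G y0 \<bullet> (u t - y0)\<bar> \<le> K * (norm (u t - y0))\<^sup>2"
        using uH[OF t] y0(1) u_le[OF t] by (intro K) auto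
      also have "\<dots> \<le> \<bar>K\<bar> * (2 * norm y0)\<^sup>2" using d by (intro mult_mono power_mono) auto
      finally have "\<bar>energy p (u t) - energy p y0 + G y0 \<bullet> (u t - y0)\<bar> \<le> \<bar>K\<bar> * (2 * norm y0)\<^sup>2" .
      moreover have "\<bar>G y0 \<bullet> (u t - y0)\<bar> \<le> norm (G y0) * (2 * norm y0)"
        using d by (intro order_trans[OF Cauchy_Schwarz_ineq2] mult_left_mono) auto
      ultimately show ?thesis unfolding B_def by linarith
    qed
    have "integrable (lebesgue_on {0<..}) (\<lambda>t. (norm (fstL (G (u t))))\<^sup>2)"
    proof (rule integrable_half_line[OF _ _ _ u_en B])
      show "continuous_on {0<..} (\<lambda>t. (norm (fstL (G (u t))))\<^sup>2)"
        by (intro continuous_intros bounded_linear.continuous_on[OF bounded_linear_fstL]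
            continuous_on_subset[OF contG]) auto
      show "0 \<le> (norm (fstL (G (u t))))\<^sup>2 \<and> (norm (fstL (G (u t))))\<^sup>2 \<le> (norm (G (u t)))\<^sup>2" if "0 < t" for t
        by (auto intro!: power_mono norm_fstL_le)
    qed auto
    moreover have "integrable (lebesgue_on {0<..}) (\<lambda>t. (Lnorm 2 U (vt t))\<^sup>2)
        \<longleftrightarrow> integrable (lebesgue_on {0<..}) (\<lambda>t. (norm (fstL (G (u t))))\<^sup>2)"
      by (rule Bochner_Integration.integrable_cong) (auto simp: vt_norm)
    ultimately show ?thesis using vt_meas by (simp add: L2_time_def)
  qed
  have wtd: "weak_time_derivative {0<..} U v vt"
    unfolding weak_time_derivative_def
  proof (intro ballI)
    fix \<phi> :: "real \<Rightarrow> real" and w :: "'a \<Rightarrow> real" assume \<phi>: "\<phi> \<in> test_functions {0<..}" and w: "w \<in> Lebesgue_space 2 U"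
    define W where "W = to_L2 (\<lambda>x. if x \<in> U then w x else 0)"
    have vi: "Defs.inner_L2 U (v t) w = fstL (u t) \<bullet> W" if "0 \<le> t" for t
      using inner_L2_fstL[OF U vH1[OF that] w] v(2)[OF that] by (simp add: W_def)
    have vti: "Defs.inner_L2 U (vt t) w = fstL (G (u t)) \<bullet> W" if "0 \<le> t" for t
      using inner_L2_fstL[OF U vtH1[OF that] w] vt(2)[OF that] by (simp add: W_def)
    have "(\<integral>t. deriv \<phi> t * (fstL (u t) \<bullet> W) \<partial>lebesgue_on {0<..}) = - (\<integral>t. \<phi> t * (fstL (G (u t)) \<bullet> W) \<partial>lebesgue_on {0<..})"
    proof (rule weak_time_derivative_half_line[OF \<phi>])
      show "((\<lambda>t. fstL (u t) \<bullet> W) has_real_derivative fstL (G (u t)) \<bullet> W) (at t)" if t: "0 < t" for t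
      proof -
        have "at t within {0..} = at t within UNIV"
          by (rule at_within_nhd[of t "{0<..}"]) (use t in auto)
        then have "(u has_vector_derivative G (u t)) (at t)" using u'[of t] t by simp
        from bounded_linear.has_vector_derivative[OF bounded_linear_compose[OF bounded_linear_inner_left[of W] bounded_linear_fstL] this]
        show ?thesis by (simp add: has_real_derivative_iff_has_vector_derivative)
      qed
      show "continuous_on {0<..} (\<lambda>t. fstL (G (u t)) \<bullet> W)"
        by (intro continuous_intros bounded_linear.continuous_on[OF bounded_linear_fstL]
            continuous_on_subset[OF contG]) auto
    qed
    moreover have "(\<integral>t. deriv \<phi> t * Defs.inner_L2 U (v t) w \<partial>lebesgue_on {0<..}) = (\<integral>t. deriv \<phi> t * (fstL (u t) \<bullet> W) \<partial>lebesgue_on {0<..})"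
      by (rule Bochner_Integration.integral_cong) (auto simp: vi)
    moreover have "(\<integral>t. \<phi> t * Defs.inner_L2 U (vt t) w \<partial>lebesgue_on {0<..}) = (\<integral>t. \<phi> t * (fstL (G (u t)) \<bullet> W) \<partial>lebesgue_on {0<..})"
      by (rule Bochner_Integration.integral_cong) (auto simp: vti)
    ultimately show "(\<integral>t. deriv \<phi> t * Defs.inner_L2 U (v t) w \<partial>lebesgue_on {0<..}) = - (\<integral>t. \<phi> t * Defs.inner_L2 U (vt t) w \<partial>lebesgue_on {0<..})"
      by simp
  qed
  have half: "insert 0 {0<..} = {0::real..}" by auto
  have cont_v: "((\<lambda>t. Lnorm 2 U (\<lambda>x. v t x - v s x)) \<longlongrightarrow> 0) (at s within {0..})" if s: "s \<in> {0..}" for s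
  proof -
    have eq: "Lnorm 2 U (\<lambda>x. v t x - v s x) = norm (fstL (u t - u s))" if "0 \<le> t" for t
      using embed_diff[OF U vH1[OF that] vH1[of s]] v(2)[OF that] v(2)[of s] s by (simp add: Lnorm_fstL[OF U])
    have "((\<lambda>t. norm (fstL (u t - u s))) \<longlongrightarrow> norm (fstL (u s - u s))) (at s within {0..})"
      using contu s
      by (intro tendsto_intros bounded_linear.tendsto[OF bounded_linear_fstL]) (auto simp: continuous_on_def)
    moreover have "norm (fstL (u s - u s)) = 0"
      using linear_0[OF bounded_linear.linear[OF bounded_linear_fstL]] by simp
    ultimately have "((\<lambda>t. norm (fstL (u t - u s))) \<longlongrightarrow> 0) (at s within {0..})" by simp
    then show ?thesis
      by (rule Lim_transform_eventually) (use eq in \<open>auto simp: eventually_at_filter intro!: always_eventually\<close>)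
  qed
  have equation: "vt t \<in> H01 U \<and> (\<forall>w\<in>H01 U. integrable (lebesgue_on U) (\<lambda>x. log_source p (v t x) * w x) \<and>
           Defs.inner_L2 U (vt t) w + Defs.inner_L2 U (wgrad U (vt t)) (wgrad U w)
             + Defs.inner_L2 U (wgrad U (v t)) (wgrad U w)
           = Defs.inner_L2 U (\<lambda>x. log_source p (v t x)) w)" if "0 < t" for t
  proof (intro conjI ballI)
    have t: "0 \<le> t" using that by simp
    show "vt t \<in> H01 U" by (rule vt(1)[OF t])
    fix w assume w: "w \<in> H01 U"
    note wH1 = H01_imp_H1[OF U w] and Us = U_sets[OF U]
    define W where "W = embed U w"
    have WH: "W \<in> H" unfolding W_def by (rule emb[OF w])
    have vE: "AE x in lebesgue. val (u t) x = (if x \<in> U then v t x else 0)"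
      using of_L2_embed[OF U vH1[OF t]] unfolding v(2)[OF t] by eventually_elim simp
    have wE: "AE x in lebesgue. val W x = (if x \<in> U then w x else 0)"
      using of_L2_embed[OF U wH1] unfolding W_def by eventually_elim simp
    have AE: "AE x in lebesgue. log_source p (val (u t) x) * val W x = (if x \<in> U then log_source p (v t x) * w x else 0)"
      using vE wE by eventually_elim simp
    have vm: "(\<lambda>x. if x \<in> U then v t x else 0) \<in> borel_measurable lebesgue"
      using square_integrable_embed(2)[OF U vH1[OF t]] by (rule square_integrable_measurable)
    have wm: "(\<lambda>x. if x \<in> U then w x else 0) \<in> borel_measurable lebesgue"
      using square_integrable_embed(2)[OF U wH1] by (rule square_integrable_measurable)
    have "(\<lambda>x. log_source p (if x \<in> U then v t x else 0) * (if x \<in> U then w x else 0)) \<in> borel_measurable lebesgue"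
      by (intro borel_measurable_times measurable_compose[OF vm borel_measurable_log_source] wm)
    also have "(\<lambda>x. log_source p (if x \<in> U then v t x else 0) * (if x \<in> U then w x else 0))
        = (\<lambda>x. if x \<in> U then log_source p (v t x) * w x else 0)" by (auto simp: fun_eq_iff)
    finally have m: "(\<lambda>x. if x \<in> U then log_source p (v t x) * w x else 0) \<in> borel_measurable lebesgue" .
    have fm: "(\<lambda>x. log_source p (val (u t) x) * val W x) \<in> borel_measurable lebesgue" by measurable
    show "integrable (lebesgue_on U) (\<lambda>x. log_source p (v t x) * w x)"
      unfolding Lebesgue_Measure.integrable_restrict_UNIV[OF Us, symmetric]
      using integrable_cong_AE[OF fm m AE] f_int[OF uH[OF t] WH] by simp
    have "Defs.inner_L2 U (\<lambda>x. log_source p (v t x)) w = (\<integral>x. (if x \<in> U then log_source p (v t x) * w x else 0) \<partial>lebesgue)"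
      by (simp add: Defs.inner_L2_def Lebesgue_Measure.integral_restrict_UNIV[OF Us])
    also have "\<dots> = (\<integral>x. log_source p (val (u t) x) * val W x \<partial>lebesgue)"
      by (rule integral_cong_AE[OF fm m AE, symmetric])
    \<comment> \<open>The defining identity of \<open>G\<close>, tested with \<open>W\<close>, moves
      the gradient term of v to the other side. The inner product with \<open>G (u t)\<close> then
      splits into the two terms that contain the time derivative.\<close>
    also have "\<dots> = G (u t) \<bullet> W + sndL (u t) \<bullet> sndL W" using G[OF uH[OF t] WH] by simp
    also have "\<dots> = fstL (G (u t)) \<bullet> fstL W + sndL (G (u t)) \<bullet> sndL W + sndL (u t) \<bullet> sndL W"
      by (simp add: inner_fstL_sndL[of "G (u t)" W])
    also have "\<dots> = Defs.inner_L2 U (vt t) w + Defs.inner_L2 U (wgrad U (vt t)) (wgrad U w)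
             + Defs.inner_L2 U (wgrad U (v t)) (wgrad U w)"
      using inner_L2_fstL[OF U vtH1[OF t] H1_L2[OF wH1]] inner_L2_sndL[OF U vtH1[OF t] wH1]
        inner_L2_sndL[OF U vH1[OF t] wH1] fstL_embed[OF U wH1]
      by (simp add: W_def v(2)[OF t] vt(2)[OF t])
    finally show "Defs.inner_L2 U (vt t) w + Defs.inner_L2 U (wgrad U (vt t)) (wgrad U w)
             + Defs.inner_L2 U (wgrad U (v t)) (wgrad U w)
           = Defs.inner_L2 U (\<lambda>x. log_source p (v t x)) w" by simp
  qed
  have "global_weak_solution p U v0 v vt"
    unfolding global_weak_solution_def weak_solution_def time_interval_infinity half
    using Linf_v L2_vt wtd cont_v equation by (auto simp: v_def)
  with Linf_v Linf_vt show ?thesis by blast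
qed

end
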